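(* Let $m$ be a positive integer, let $\alpha\in[0,1]$, let $C$ be the compact set of positive Lebesgue measure defined in the context, and let $(\Omega,P)$ and $f_\omega : C\to\mathbf{R}$ be constructed from $C$, $m$ and $\alpha$ as in the context. Let $s \geq 0$ and let $F$ be a Borel subset of $\mathbf{R}$ such that $\mathcal{H}^s(F) > 0$. Then there is some $t\in\mathbf{R}$ such that for $P$-almost every $\omega\in\Omega$, $$\dim_{\mathrm{F}} f_\omega(C\cap(F+t)) \geq \frac{s}{m+\alpha}.$$
   Context: $\mathcal{H}^s$ denotes $s$-dimensional Hausdorff measure and $F+t = \{x+t : x\in F\}$. The Fourier transform of a Borel probability measure $\mu$ on $\mathbf{R}$ is $\widehat\mu(\xi) = \int e^{-2\pi i \xi x}\,\mathrm{d}\mu(x)$. The Fourier dimension of $\mu$ is $\dim_{\mathrm{F}} \mu = \sup\{ s \in [0,1] : |\widehat\mu(\xi)|\,|\xi|^{s/2} \text{ is bounded in } \xi\}$. The Fourier dimension of a Borel set $G \subset \mathbf{R}$ is $\dim_{\mathrm{F}} G = \sup\{\dim_{\mathrm{F}} \mu : \mu \text{ a Borel probability measure on } \mathbf{R},\ \mu(G) = 1\}$. The set $C$: let $(c_k)_{k=1}^\infty$ be an increasing sequence of positive numbers with $c_k < 1/2$ that converges to $1/2$ and satisfies $$\prod_{k=1}^\infty 2c_k > 0 \quad\text{and}\quad \lim_{k\to\infty}\frac{\log(1-2c_k)}{k} = 0.$$ Let $C_0 = [0,1]$ and for $k\geq1$ let $C_k$ be the set obtained by removing from every connected component $I$ of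 $C_{k-1}$ the open interval that is concentric with $I$ and has length $(1-2c_k)|I|$, where $|I|$ is the length of $I$. Let $C = \bigcap_{k=0}^\infty C_k$. Construction of $f_\omega$: let $D$ be the (countable) set of bounded connected components of $\mathbf{R}\setminus C$, and for $U\in D$ let $|U|$ be its length. Define, for $t>0$, $$\delta(t) = \frac{1}{\max(-\log t, \log 2)} \ \text{ if } \alpha = 0, \qquad \delta(t) = t^\alpha \ \text{ if } \alpha\in(0,1],$$ and put $\delta_U = |U|^m\,\delta(|U|)$ for $U\in D$. Let $\Omega = \prod_{U\in D}[0,\delta_U]$. For $\omega = (\omega_U)_{U\in D}\in\Omega$ define $f_\omega : C\to\mathbf{R}$ by $$f_\omega(x) = x + \sum_{U\in D,\ U\subset(-\infty,x)}\omega_U.$$ Fix a Borel probability measure $\nu$ on $[0,1]$ such that $\lim_{|\xi|\to\infty}\widehat\nu(\xi) = 0$, let $\nu_U$ be the image of $\nu$ under the map $x\mapsto\delta_U x$, and let $P$ be the product measure $\prod_{U\in D}\nu_U$ on $\Omega$. *)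

theory Defs
  imports "HOL-Probability.Probability"
begin

(* The convention behind diam(U)^s for s = 0: the value is 1 for every nonempty U (also for a
   single point, where 0 powr 0 = 0 would be wrong) and 0 for the empty set, so that the
   0-dimensional Hausdorff measure is counting measure. *)
definition diam_pow :: "real \<Rightarrow> 'a::metric_space set \<Rightarrow> real" where
  "diam_pow s U = (if U = {} then 0 else if s = 0 then 1 else diameter U powr s)"

(* Boundedness is required because diameter is meaningless on unbounded sets. Finite covers are
   included, since the U i may be empty. *)
definition hausdorff_premeasure :: "real \<Rightarrow> real \<Rightarrow> 'a::metric_space set \<Rightarrow> ennreal" where
  "hausdorff_premeasure s \<epsilon> A =
     (INF U \<in> {U :: nat \<Rightarrow> 'a set. A \<subseteq> (\<Union>i. U i) \<and> (\<forall>i. bounded (U i) \<and> diameter (U i) \<le> \<epsilon>)}.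
        \<Sum>i. ennreal (diam_pow s (U i)))"

definition hausdorff_measure :: "real \<Rightarrow> 'a::metric_space set \<Rightarrow> ennreal" where
  "hausdorff_measure s A = (SUP \<epsilon> \<in> {0<..}. hausdorff_premeasure s \<epsilon> A)"

definition fourier_transform :: "real measure \<Rightarrow> real \<Rightarrow> complex" where
  "fourier_transform \<mu> \<xi> = (CLINT x|\<mu>. exp (- 2 * pi * \<i> * \<xi> * x))"

lemma fourier_transform_char: "fourier_transform \<mu> \<xi> = char \<mu> (- 2 * pi * \<xi>)"
  unfolding fourier_transform_def char_def by (simp add: ac_simps)

definition fourier_dim_measure :: "real measure \<Rightarrow> real" where
  "fourier_dim_measure \<mu> =
     Sup {s \<in> {0..1}. bounded (range (\<lambda>\<xi>. norm (fourier_transform \<mu> \<xi>) * \<bar>\<xi>\<bar> powr (s / 2)))}"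

(* Intended for Borel sets G. The supremum is taken in [0,1]: inserting 0 only matters for G = {},
   where there is no such measure and the dimension is 0; otherwise all values are in [0,1] anyway. *)
definition fourier_dim :: "real set \<Rightarrow> real" where
  "fourier_dim G =
     Sup (insert 0 {fourier_dim_measure \<mu> | \<mu>. real_distribution \<mu> \<and> measure \<mu> G = 1})"

definition concentric_interval :: "real set \<Rightarrow> real \<Rightarrow> real set" where
  "concentric_interval I l = {(Inf I + Sup I) / 2 - l / 2 <..< (Inf I + Sup I) / 2 + l / 2}"

(* The sequence is indexed from 1: the value c 0 is never used. *)
fun cantor_stage :: "(nat \<Rightarrow> real) \<Rightarrow> nat \<Rightarrow> real set" where
  "cantor_stage c 0 = {0..1}"
| "cantor_stage c (Suc k) = cantor_stage c k -
     (\<Union>I \<in> components (cantor_stage c k).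
        concentric_interval I ((1 - 2 * c (Suc k)) * measure lborel I))"

definition cantor_set :: "(nat \<Rightarrow> real) \<Rightarrow> real set" where
  "cantor_set c = (\<Inter>k. cantor_stage c k)"

definition gaps :: "real set \<Rightarrow> real set set" where
  "gaps K = {U \<in> components (- K). bounded U}"

definition gap_modulus :: "real \<Rightarrow> real \<Rightarrow> real" where
  "gap_modulus \<alpha> t = (if \<alpha> = 0 then 1 / max (- ln t) (ln 2) else t powr \<alpha>)"

definition gap_bound :: "nat \<Rightarrow> real \<Rightarrow> real set \<Rightarrow> real" where
  "gap_bound m \<alpha> U = measure lborel U ^ m * gap_modulus \<alpha> (measure lborel U)"

(* The gaps are disjoint subintervals of [0,1] and \<omega> U is at most a constant multiple of |U|,
   so the sum converges in the case of interest. *)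
definition random_map :: "real set \<Rightarrow> (real set \<Rightarrow> real) \<Rightarrow> real \<Rightarrow> real" where
  "random_map K \<omega> x = x + (\<Sum>\<^sub>\<infinity>U \<in> {U \<in> gaps K. U \<subseteq> {..<x}}. \<omega> U)"

definition scaled_measure :: "real measure \<Rightarrow> real \<Rightarrow> real measure" where
  "scaled_measure \<nu> d = distr \<nu> (restrict_space borel {0..d}) (\<lambda>x. d * x)"

definition omega_measure ::
  "real set \<Rightarrow> nat \<Rightarrow> real \<Rightarrow> real measure \<Rightarrow> (real set \<Rightarrow> real) measure" where
  "omega_measure K m \<alpha> \<nu> = (\<Pi>\<^sub>M U \<in> gaps K. scaled_measure \<nu> (gap_bound m \<alpha> U))"

lemma space_omega_measure:
  "space (omega_measure K m \<alpha> \<nu>) = (\<Pi>\<^sub>E U \<in> gaps K. {0..gap_bound m \<alpha> U})"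
  by (simp add: omega_measure_def scaled_measure_def space_PiM space_restrict_space)

end

theory Submission
  imports Defs
begin

text \<open>Since \<open>C\<close> has positive length, some translate of a Frostman measure of \<open>F\<close> charges \<open>C\<close>; let
  \<open>\<rho>\<close> be its normalised restriction to \<open>C\<close>. Fix a frequency \<open>\<xi>\<close>. The gaps \<open>U\<close> for which \<open>\<xi> \<delta>_U\<close> is
  large cut \<open>C\<close> into pieces of diameter at most \<open>\<xi> powr (- \<beta>)\<close>, for any given \<open>\<beta> < 1 / (m + \<alpha>)\<close>. The Fourier
  coefficient at \<open>\<xi>\<close> of the image of \<open>\<rho>\<close> is \<open>\<Sum>j. a_j * (\<Prod>i<j. p_i)\<close>, where \<open>a_j\<close> is bounded by the mass of
  the \<open>j\<close>-th piece and the \<open>p_i\<close> are independent phases, independent of all \<open>a_j\<close>, whose expectations have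
  modulus at most \<open>1 / 2\<close>. A martingale argument with Hoeffding's lemma bounds the probability that
  this sum exceeds \<open>\<xi> powr (- \<sigma> / 2)\<close>, \<open>\<sigma> < s / (m + \<alpha>)\<close>, by a stretched exponential in \<open>\<xi>\<close>. The Borel-Cantelli
  lemma along \<open>\<xi> = sqrt n\<close> gives decay on this grid, whose spacing is about \<open>1 / \<xi>\<close>, and the Lipschitz
  continuity of the Fourier transform gives it everywhere.

  Frostman's lemma for Borel sets follows from that for compact sets by Choquet's capacitability argument:
  the dyadic net content is continuous along increasing sequences of arbitrary sets and along the
  decreasing sequences that approximate a compact set.\<close>

subsection \<open>Sums of independent random phases\<close>

text \<open>A second moment estimate would bound the probability at frequency \<xi> only by about
  \<open>\<xi> powr (\<sigma> - \<sigma>')\<close> with a small difference of exponents, and this is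
  not summable over the grid; hence exponential moments. The terms of the sum share phases and are
  far from independent, but the j-th term contains only the first j of them. Integrating the phases
  out from the last one backwards therefore meets one fresh variable at a time.

  The exponent m + \<alpha> appears because a gap U randomises the phase once \<xi> \<delta>_U is
  large, that is, once its length exceeds about \<open>\<xi> powr (- 1 / (m + \<alpha>))\<close>.
  The condition on ln (1 - 2 c_k) / k guarantees that between two points of C at distance r there is
  a gap of length at least \<open>r powr \<theta>\<close>, for any \<theta> > 1 and small r, so
  passing from gaps to pieces costs arbitrarily little in the exponent. The strict inequality
  between \<sigma> and s / (m + \<alpha>) pays for all such losses.\<close>

lemma nn_integral_PiM_update:
  fixes f :: "('i \<Rightarrow> 'a) \<Rightarrow> ennreal"
  assumes M: "\<And>i. i \<in> I \<Longrightarrow> prob_space (M i)" and k: "k \<in> I"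
    and f: "f \<in> borel_measurable (PiM I M)"
  shows "(\<integral>\<^sup>+\<omega>. f \<omega> \<partial>PiM I M) = (\<integral>\<^sup>+\<omega>. (\<integral>\<^sup>+y. f (fun_upd \<omega> k y) \<partial>M k) \<partial>PiM I M)"
proof -
  \<comment> \<open>Overwriting coordinate \<open>k\<close> by an independent value with law
    \<open>M k\<close> preserves the product measure. This integrates out one coordinate, as a
    conditional expectation given the others would, without splitting the index set.\<close>
  have eq: "distr (M k \<Otimes>\<^sub>M PiM I M) (PiM I M) (\<lambda>(x, X). X(k := x)) = PiM I M"
    using distr_pair_PiM_eq_PiM[of I M k] M k by (simp add: insert_absorb)
  interpret k: prob_space "M k" using M k by blast
  interpret I: prob_space "PiM I M" using M by (rule prob_space_PiM)
  interpret pair_sigma_finite "M k" "PiM I M" ..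
  have ms: "(\<lambda>(x, X). X(k := x)) \<in> M k \<Otimes>\<^sub>M PiM I M \<rightarrow>\<^sub>M PiM I M"
    unfolding split_beta'
    by (rule measurable_fun_upd[where J = I and I = I]) (use k in auto)
  have "(\<integral>\<^sup>+\<omega>. f \<omega> \<partial>PiM I M) = (\<integral>\<^sup>+z. f ((\<lambda>(x, X). X(k := x)) z) \<partial>(M k \<Otimes>\<^sub>M PiM I M))"
    by (subst eq[symmetric], subst nn_integral_distr[OF ms]) (use f in auto)
  also have "\<dots> = (\<integral>\<^sup>+\<omega>. (\<integral>\<^sup>+y. f (fun_upd \<omega> k y) \<partial>M k) \<partial>PiM I M)"
    by (subst nn_integral_snd[symmetric]) (use measurable_compose[OF ms f] in auto)
  finally show ?thesis .
qed

text \<open>Hoeffding's lemma: the real part is centred and lies in an interval of length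
  \<open>4 * cmod w\<close>, and the square of this length divided by 8 is
  \<open>2 * (cmod w)^2\<close>.\<close>

lemma (in prob_space) exp_Re_centered_bound:
  fixes p :: "'a \<Rightarrow> complex"
  assumes p: "p \<in> borel_measurable M" and p1: "\<And>y. cmod (p y) \<le> 1"
  shows "(\<integral>\<^sup>+y. ennreal (exp (Re (w * (p y - integral\<^sup>L M p)))) \<partial>M)
    \<le> ennreal (exp (2 * (cmod w)\<^sup>2))"
proof -
  let ?\<phi> = "integral\<^sup>L M p"
  let ?f = "\<lambda>y. Re (w * (p y - ?\<phi>))"
  have int: "integrable M p"
    by (rule integrable_const_bound[where B = 1]) (use p p1 in auto)
  have \<phi>1: "cmod ?\<phi> \<le> 1"
  proof -
    have "cmod ?\<phi> \<le> (\<integral>y. cmod (p y) \<partial>M)" by (rule integral_norm_bound)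
    also have "\<dots> \<le> (\<integral>y. 1 \<partial>M)"
      by (rule integral_mono) (use int p1 in auto)
    finally show ?thesis by (simp add: prob_space)
  qed
  have b: "\<bar>?f y\<bar> \<le> 2 * cmod w" for y
  proof -
    have "\<bar>?f y\<bar> \<le> cmod (w * (p y - ?\<phi>))" by (rule abs_Re_le_cmod)
    also have "\<dots> \<le> cmod w * 2"
      unfolding norm_mult
      by (intro mult_left_mono order_trans[OF norm_triangle_ineq4]) (use p1[of y] \<phi>1 in auto)
    finally show ?thesis by simp
  qed
  interpret h: interval_bounded_random_variable M ?f "- (2 * cmod w)" "2 * cmod w"
  proof
    show "?f \<in> borel_measurable M" using p by measurable
    show "AE x in M. ?f x \<in> {- (2 * cmod w)..2 * cmod w}"
    proof (rule AE_I2)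
      fix x show "?f x \<in> {- (2 * cmod w)..2 * cmod w}"
        using b[of x] unfolding atLeastAtMost_iff abs_le_iff by linarith
    qed
  qed
  have "(\<integral>y. w * (p y - ?\<phi>) \<partial>M) = 0"
    using int by (simp add: prob_space)
  moreover have "integrable M (\<lambda>y. w * (p y - ?\<phi>))" using int by simp
  ultimately have "expectation ?f = 0"
    by (metis integral_Re zero_complex.simps(1))
  from h.Hoeffdings_lemma_nn_integral_0[OF _ this, of 1] show ?thesis
    by (simp add: power2_eq_square algebra_simps)
qed

text \<open>The last term is replaced by its conditional expectation given the earlier phases, which
  adds half of its coefficient to the preceding one; this is why the bound on the last coefficient
  is relaxed to \<open>2 * B\<close>.\<close>

lemma nn_integral_exp_random_phases:
  fixes p :: "nat \<Rightarrow> 'b \<Rightarrow> complex" and a :: "nat \<Rightarrow> ('i \<Rightarrow> 'b) \<Rightarrow> complex"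
    and M :: "'i \<Rightarrow> 'b measure"
  assumes M: "\<And>i. i \<in> I \<Longrightarrow> prob_space (M i)"
    and "inj_on u {..<N}" and "\<And>n. n < N \<Longrightarrow> u n \<in> I"
    and "\<And>n. n < N \<Longrightarrow> p n \<in> borel_measurable (M (u n))" and p1: "\<And>n y. cmod (p n y) \<le> 1"
    and "\<And>n. n < N \<Longrightarrow> cmod (integral\<^sup>L (M (u n)) (p n)) \<le> 1 / 2"
    and "\<And>j. j \<le> N \<Longrightarrow> a j \<in> borel_measurable (PiM I M)"
    and "\<And>j n \<omega> y. j \<le> N \<Longrightarrow> n < N \<Longrightarrow> \<omega> \<in> space (PiM I M) \<Longrightarrow> y \<in> space (M (u n)) \<Longrightarrow>
      a j (fun_upd \<omega> (u n) y) = a j \<omega>"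
    and "\<And>j \<omega>. j \<le> N \<Longrightarrow> \<omega> \<in> space (PiM I M) \<Longrightarrow> cmod (a j \<omega>) \<le> b j"
    and "\<And>j. j < N \<Longrightarrow> b j \<le> B" and "b N \<le> 2 * B" and "\<And>j. j \<le> N \<Longrightarrow> 0 \<le> b j"
  shows "(\<integral>\<^sup>+\<omega>. ennreal (exp (Re (z * (\<Sum>j\<le>N. a j \<omega> * (\<Prod>i<j. p i (\<omega> (u i))))))) \<partial>PiM I M)
    \<le> ennreal (exp (2 * cmod z * B + 8 * (cmod z)\<^sup>2 * B * (\<Sum>j\<le>N. b j)))"
  using assms(2-)
proof (induction N arbitrary: a b)
  case 0
  interpret I: prob_space "PiM I M" using M by (rule prob_space_PiM)
  have B: "0 \<le> B" using "0.prems"(10) "0.prems"(11)[of 0] by simp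
  have "(\<integral>\<^sup>+\<omega>. ennreal (exp (Re (z * (\<Sum>j\<le>0. a j \<omega> * (\<Prod>i<j. p i (\<omega> (u i))))))) \<partial>PiM I M)
    \<le> (\<integral>\<^sup>+\<omega>. ennreal (exp (2 * cmod z * B + 8 * (cmod z)\<^sup>2 * B * (\<Sum>j\<le>0. b j))) \<partial>PiM I M)"
  proof (rule nn_integral_mono)
    fix \<omega> assume w: "\<omega> \<in> space (PiM I M)"
    have "Re (z * a 0 \<omega>) \<le> cmod z * cmod (a 0 \<omega>)"
      by (metis complex_Re_le_cmod norm_mult)
    also have "\<dots> \<le> cmod z * (2 * B)"
      by (intro mult_left_mono order_trans[OF "0.prems"(8)[OF _ w]]) (use "0.prems"(10) in auto)
    also have "\<dots> \<le> 2 * cmod z * B + 8 * (cmod z)\<^sup>2 * B * b 0"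
      using "0.prems"(11)[of 0] B by simp
    finally show "ennreal (exp (Re (z * (\<Sum>j\<le>0. a j \<omega> * (\<Prod>i<j. p i (\<omega> (u i)))))))
      \<le> ennreal (exp (2 * cmod z * B + 8 * (cmod z)\<^sup>2 * B * (\<Sum>j\<le>0. b j)))"
      by (intro ennreal_leI) simp
  qed
  then show ?case by (simp add: I.emeasure_space_1)
next
  case (Suc N)
  let ?P = "PiM I M"
  define k where "k = u N"
  have k: "k \<in> I" using Suc.prems(2)[of N] by (simp add: k_def)
  interpret k: prob_space "M k" using M k by blast
  interpret I: prob_space "PiM I M" using M by (rule prob_space_PiM)
  define \<phi> where "\<phi> = integral\<^sup>L (M k) (p N)"
  have \<phi>: "cmod \<phi> \<le> 1 / 2" using Suc.prems(5)[of N] by (simp add: \<phi>_def k_def)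
  define a' where "a' = a(N := \<lambda>\<omega>. a N \<omega> + \<phi> * a (Suc N) \<omega>)"
  define b' where "b' = b(N := b N + b (Suc N) / 2)"
  define e where "e = (\<lambda>j \<omega>. \<Prod>i<j. p i (\<omega> (u i)))"
  define X where "X = (\<lambda>\<omega>. \<Sum>j\<le>N. a' j \<omega> * e j \<omega>)"
  have meas_p: "(\<lambda>\<omega>. p n (\<omega> (u n))) \<in> borel_measurable ?P" if "n < Suc N" for n
    by (rule measurable_compose[OF measurable_component_singleton])
      (use Suc.prems(2,3)[OF that] in auto)
  have meas_e: "e j \<in> borel_measurable ?P" if "j \<le> Suc N" for j
    unfolding e_def using that by (intro borel_measurable_prod meas_p) auto
  note [measurable] = Suc.prems(6) meas_e
  have meas_a': "a' j \<in> borel_measurable ?P" if "j \<le> N" for j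
    using that by (auto simp: a'_def)
  have meas_X: "X \<in> borel_measurable ?P"
    unfolding X_def by (intro borel_measurable_sum borel_measurable_times meas_a' meas_e) auto
  have inv_a: "a j (fun_upd \<omega> k y) = a j \<omega>"
    if "j \<le> Suc N" "\<omega> \<in> space ?P" "y \<in> space (M k)" for j \<omega> y
    using Suc.prems(7)[of j N \<omega> y] that unfolding k_def by blast
  \<comment> \<open>Injectivity of \<open>u\<close> enters here: the first \<open>N\<close> phases
    do not read coordinate \<open>u N\<close>, so the whole of \<open>X\<close> is unchanged when
    that coordinate is resampled.\<close>
  have inv_e: "e j (fun_upd \<omega> k y) = e j \<omega>" if "j \<le> N" for j \<omega> y
    unfolding e_def
  proof (rule prod.cong)
    fix i assume "i \<in> {..<j}"
    then have "u i \<noteq> k"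
      using that inj_onD[OF Suc.prems(1), of i N] by (auto simp: k_def)
    then show "p i ((fun_upd \<omega> k y) (u i)) = p i (\<omega> (u i))" by simp
  qed simp
  have inv_X: "X (fun_upd \<omega> k y) = X \<omega>" if "\<omega> \<in> space ?P" "y \<in> space (M k)" for \<omega> y
    unfolding X_def using that
    by (intro sum.cong refl arg_cong2[where f = "(*)"] inv_e) (auto simp: a'_def inv_a)
  have e1: "cmod (e j \<omega>) \<le> 1" for j \<omega>
    unfolding e_def prod_norm[symmetric] by (intro prod_le_1) (simp add: p1)
  have bS: "b N \<le> B" "b (Suc N) \<le> 2 * B" "0 \<le> b N" "0 \<le> b (Suc N)"
    using Suc.prems(9)[of N] Suc.prems(10) Suc.prems(11)[of "Suc N"] Suc.prems(11)[of N] by auto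
  have split: "(\<Sum>j\<le>Suc N. a j \<omega> * e j \<omega>)
      = X \<omega> + a (Suc N) \<omega> * e N \<omega> * (p N (\<omega> k) - \<phi>)" for \<omega>
  proof -
    have "X \<omega> = (\<Sum>j<N. a j \<omega> * e j \<omega>) + (a N \<omega> + \<phi> * a (Suc N) \<omega>) * e N \<omega>"
      unfolding X_def lessThan_Suc_atMost[symmetric] by (simp add: a'_def)
    moreover have "(\<Sum>j\<le>Suc N. a j \<omega> * e j \<omega>)
      = (\<Sum>j<N. a j \<omega> * e j \<omega>) + a N \<omega> * e N \<omega> + a (Suc N) \<omega> * e N \<omega> * p N (\<omega> k)"
      unfolding lessThan_Suc_atMost[symmetric] by (simp add: e_def k_def)
    ultimately show ?thesis by (simp add: algebra_simps)
  qed
  have sum_b': "(\<Sum>j\<le>N. b' j) = (\<Sum>j\<le>N. b j) + b (Suc N) / 2"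
    unfolding lessThan_Suc_atMost[symmetric] by (simp add: b'_def)
  \<comment> \<open>Passing from \<open>b\<close> to \<open>b'\<close> lowers the sum by
    \<open>b (Suc N) / 2\<close> and thus the inductive bound by exactly the factor
    \<open>K\<close>. This is room enough for the Hoeffding factor of the last phase, because the
    square of \<open>b (Suc N)\<close> is at most \<open>2 * B * b (Suc N)\<close>.\<close>
  define K where "K = exp (4 * (cmod z)\<^sup>2 * B * b (Suc N))"
  have [simp]: "0 \<le> K" by (simp add: K_def)
  have IH: "(\<integral>\<^sup>+\<omega>. ennreal (exp (Re (z * X \<omega>))) \<partial>?P)
    \<le> ennreal (exp (2 * cmod z * B + 8 * (cmod z)\<^sup>2 * B * (\<Sum>j\<le>N. b' j)))"
    unfolding X_def e_def
  proof (rule Suc.IH)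
    show "inj_on u {..<N}" using Suc.prems(1) by (rule inj_on_subset) auto
    show "cmod (a' j \<omega>) \<le> b' j" if "j \<le> N" "\<omega> \<in> space ?P" for j \<omega>
    proof (cases "j = N")
      case True
      have "cmod (a N \<omega> + \<phi> * a (Suc N) \<omega>) \<le> b N + (1 / 2) * b (Suc N)"
      proof (intro order_trans[OF norm_triangle_ineq] add_mono)
        show "cmod (a N \<omega>) \<le> b N" using Suc.prems(8)[of N \<omega>] that by simp
        show "cmod (\<phi> * a (Suc N) \<omega>) \<le> (1 / 2) * b (Suc N)"
          unfolding norm_mult using Suc.prems(8)[of "Suc N" \<omega>] that \<phi> by (intro mult_mono) auto
      qed
      then show ?thesis by (simp add: True a'_def b'_def)
    next
      case False
      then show ?thesis using that Suc.prems(8)[of j \<omega>] by (simp add: a'_def b'_def)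
    qed
    show "a' j (fun_upd \<omega> (u n) y) = a' j \<omega>"
      if "j \<le> N" "n < N" "\<omega> \<in> space ?P" "y \<in> space (M (u n))" for j n \<omega> y
    proof -
      have A: "a i (fun_upd \<omega> (u n) y) = a i \<omega>" if "i \<le> Suc N" for i
        by (rule Suc.prems(7)) (use that \<open>n < N\<close> \<open>\<omega> \<in> space ?P\<close> \<open>y \<in> space (M (u n))\<close> in auto)
      show ?thesis using \<open>j \<le> N\<close> by (simp add: a'_def A)
    qed
    show "b' N \<le> 2 * B" using bS by (simp add: b'_def)
  qed (use Suc.prems meas_a' bS in \<open>auto simp: b'_def\<close>)
  have "(\<integral>\<^sup>+\<omega>. ennreal (exp (Re (z * (\<Sum>j\<le>Suc N. a j \<omega> * e j \<omega>)))) \<partial>?P)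
    = (\<integral>\<^sup>+\<omega>. (\<integral>\<^sup>+y. ennreal (exp (Re (z * (\<Sum>j\<le>Suc N. a j (fun_upd \<omega> k y) * e j (fun_upd \<omega> k y))))) \<partial>M k) \<partial>?P)"
  proof (rule nn_integral_PiM_update[OF M k])
    have "(\<lambda>\<omega>. \<Sum>j\<le>Suc N. a j \<omega> * e j \<omega>) \<in> borel_measurable ?P"
      by (intro borel_measurable_sum borel_measurable_times Suc.prems(6) meas_e) auto
    then show "(\<lambda>\<omega>. ennreal (exp (Re (z * (\<Sum>j\<le>Suc N. a j \<omega> * e j \<omega>))))) \<in> borel_measurable ?P"
      by measurable
  qed
  also have "\<dots> = (\<integral>\<^sup>+\<omega>. (\<integral>\<^sup>+y. ennreal (exp (Re (z * X \<omega>))) *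
      ennreal (exp (Re ((z * a (Suc N) \<omega> * e N \<omega>) * (p N y - \<phi>)))) \<partial>M k) \<partial>?P)"
  proof (intro nn_integral_cong)
    fix \<omega> y assume w: "\<omega> \<in> space ?P" "y \<in> space (M k)"
    have "Re (z * (\<Sum>j\<le>Suc N. a j (fun_upd \<omega> k y) * e j (fun_upd \<omega> k y)))
      = Re (z * X \<omega>) + Re ((z * a (Suc N) \<omega> * e N \<omega>) * (p N y - \<phi>))"
      unfolding split[of "fun_upd \<omega> k y"] by (simp add: inv_X inv_a inv_e w algebra_simps)
    then show "ennreal (exp (Re (z * (\<Sum>j\<le>Suc N. a j (fun_upd \<omega> k y) * e j (fun_upd \<omega> k y)))))
      = ennreal (exp (Re (z * X \<omega>))) * ennreal (exp (Re ((z * a (Suc N) \<omega> * e N \<omega>) * (p N y - \<phi>))))"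
      by (simp add: exp_add ennreal_mult)
  qed
  also have "\<dots> = (\<integral>\<^sup>+\<omega>. ennreal (exp (Re (z * X \<omega>))) *
      (\<integral>\<^sup>+y. ennreal (exp (Re ((z * a (Suc N) \<omega> * e N \<omega>) * (p N y - \<phi>)))) \<partial>M k) \<partial>?P)"
    using Suc.prems(3)[of N] by (intro nn_integral_cong nn_integral_cmult) (auto simp: k_def)
  also have "\<dots> \<le> (\<integral>\<^sup>+\<omega>. ennreal (exp (Re (z * X \<omega>))) * ennreal K \<partial>?P)"
  proof (intro nn_integral_mono mult_left_mono)
    fix \<omega> assume w: "\<omega> \<in> space ?P"
    let ?w = "z * a (Suc N) \<omega> * e N \<omega>"
    have "(cmod (a (Suc N) \<omega>))\<^sup>2 \<le> (b (Suc N))\<^sup>2"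
      using Suc.prems(8)[of "Suc N" \<omega>] w by (intro power_mono) auto
    also have "\<dots> \<le> 2 * B * b (Suc N)"
      unfolding power2_eq_square using bS by (intro mult_right_mono) auto
    finally have A: "(cmod (a (Suc N) \<omega>))\<^sup>2 \<le> 2 * B * b (Suc N)" .
    have "(cmod ?w)\<^sup>2 = (cmod z)\<^sup>2 * (cmod (a (Suc N) \<omega>))\<^sup>2 * (cmod (e N \<omega>))\<^sup>2"
      by (simp add: norm_mult power_mult_distrib)
    also have "\<dots> \<le> (cmod z)\<^sup>2 * (2 * B * b (Suc N)) * 1"
      using A e1[of N \<omega>] bS by (intro mult_mono) (auto simp: power_le_one_iff)
    finally have "2 * (cmod ?w)\<^sup>2 \<le> 4 * (cmod z)\<^sup>2 * B * b (Suc N)"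
      by (simp add: mult_ac)
    moreover have
      "(\<integral>\<^sup>+y. ennreal (exp (Re (?w * (p N y - \<phi>)))) \<partial>M k) \<le> ennreal (exp (2 * (cmod ?w)\<^sup>2))"
      unfolding \<phi>_def using Suc.prems(3)[of N] p1
        by (intro k.exp_Re_centered_bound) (auto simp: k_def)
    ultimately show "(\<integral>\<^sup>+y. ennreal (exp (Re (?w * (p N y - \<phi>)))) \<partial>M k) \<le> ennreal K"
      unfolding K_def by (meson ennreal_leI exp_le_cancel_iff order_trans)
  qed auto
  also have "\<dots> = (\<integral>\<^sup>+\<omega>. ennreal (exp (Re (z * X \<omega>))) \<partial>?P) * ennreal K"
    using meas_X by (intro nn_integral_multc) measurable
  also have "\<dots> \<le> ennreal (exp (2 * cmod z * B + 8 * (cmod z)\<^sup>2 * B * (\<Sum>j\<le>N. b' j))) * ennreal K"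
    by (intro mult_right_mono IH) auto
  also have "\<dots> = ennreal (exp (2 * cmod z * B + 8 * (cmod z)\<^sup>2 * B * (\<Sum>j\<le>Suc N. b j)))"
    unfolding sum_b' K_def by (simp add: ennreal_mult[symmetric] exp_add[symmetric] algebra_simps)
  finally show ?case unfolding e_def .
qed

text \<open>Chernoff's bound with the parameter \<open>r\<close> left free. The modulus is at most
  the sum of the absolute real and imaginary parts, so a large modulus makes
  \<open>Re (z * X \<omega>)\<close> at least \<open>v / 2\<close> for one of the four directions z
  = 1, -1, i, -i. This explains the factor 4 and the half in \<open>r * v / 2\<close>.\<close>

lemma prob_random_phases:
  fixes p :: "nat \<Rightarrow> 'b \<Rightarrow> complex" and a :: "nat \<Rightarrow> ('i \<Rightarrow> 'b) \<Rightarrow> complex"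
    and M :: "'i \<Rightarrow> 'b measure"
  assumes M: "\<And>i. i \<in> I \<Longrightarrow> prob_space (M i)"
    and u: "inj_on u {..<N}" "\<And>n. n < N \<Longrightarrow> u n \<in> I"
    and p: "\<And>n. n < N \<Longrightarrow> p n \<in> borel_measurable (M (u n))" "\<And>n y. cmod (p n y) \<le> 1"
      "\<And>n. n < N \<Longrightarrow> cmod (integral\<^sup>L (M (u n)) (p n)) \<le> 1 / 2"
    and a: "\<And>j. j \<le> N \<Longrightarrow> a j \<in> borel_measurable (PiM I M)"
      "\<And>j n \<omega> y. j \<le> N \<Longrightarrow> n < N \<Longrightarrow> \<omega> \<in> space (PiM I M) \<Longrightarrow> y \<in> space (M (u n)) \<Longrightarrow>
        a j (fun_upd \<omega> (u n) y) = a j \<omega>"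
      "\<And>j \<omega>. j \<le> N \<Longrightarrow> \<omega> \<in> space (PiM I M) \<Longrightarrow> cmod (a j \<omega>) \<le> b j"
    and b: "\<And>j. j \<le> N \<Longrightarrow> b j \<le> B" "\<And>j. j \<le> N \<Longrightarrow> 0 \<le> b j" "(\<Sum>j\<le>N. b j) \<le> 1"
    and X: "\<And>\<omega>. \<omega> \<in> space (PiM I M) \<Longrightarrow> X \<omega> = (\<Sum>j\<le>N. a j \<omega> * (\<Prod>i<j. p i (\<omega> (u i))))"
      "X \<in> borel_measurable (PiM I M)" and r: "0 \<le> r"
  shows "measure (PiM I M) {\<omega> \<in> space (PiM I M). v \<le> cmod (X \<omega>)}
    \<le> 4 * exp (2 * r * B + 8 * r\<^sup>2 * B - r * v / 2)"
proof -
  interpret I: prob_space "PiM I M" using M by (rule prob_space_PiM)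
  have B: "0 \<le> B" using b(1,2)[of 0] by simp
  define Q where "Q = (\<lambda>z. {\<omega> \<in> space (PiM I M). v / 2 \<le> Re (z * X \<omega>)})"
  have [measurable]: "X \<in> borel_measurable (PiM I M)" by (rule X)
  have sQ: "Q z \<in> sets (PiM I M)" for z unfolding Q_def by measurable
  have PQ: "measure (PiM I M) (Q z) \<le> exp (2 * r * B + 8 * r\<^sup>2 * B - r * v / 2)" if z: "cmod z = 1"
    for z
  proof -
    have "emeasure (PiM I M) (Q z) = (\<integral>\<^sup>+\<omega>. indicator (Q z) \<omega> \<partial>PiM I M)"
      using sQ by simp
    also have "\<dots> \<le> (\<integral>\<^sup>+\<omega>. ennreal (exp (- r * v / 2)) *
        ennreal (exp (Re (r * z * (\<Sum>j\<le>N. a j \<omega> * (\<Prod>i<j. p i (\<omega> (u i))))))) \<partial>PiM I M)"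
    proof (rule nn_integral_mono)
      fix \<omega> assume w: "\<omega> \<in> space (PiM I M)"
      have "1 \<le> exp (- r * v / 2 + r * Re (z * X \<omega>))" if "\<omega> \<in> Q z"
        using that r mult_left_mono[of "v / 2" "Re (z * X \<omega>)" r] by (simp add: Q_def)
      also have "r * Re (z * X \<omega>) = Re (r * z * X \<omega>)" by (simp add: algebra_simps)
      finally have "indicator (Q z) \<omega> \<le> exp (- r * v / 2) * exp (Re (r * z * X \<omega>))"
        unfolding exp_add by (auto split: split_indicator)
      then show "indicator (Q z) \<omega> \<le> ennreal (exp (- r * v / 2)) *
        ennreal (exp (Re (r * z * (\<Sum>j\<le>N. a j \<omega> * (\<Prod>i<j. p i (\<omega> (u i)))))))"
        unfolding X(1)[OF w, symmetric] ennreal_mult[symmetric, OF exp_ge_zero exp_ge_zero]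
        by (metis ennreal_indicator ennreal_leI)
    qed
    also have "\<dots> = ennreal (exp (- r * v / 2)) * (\<integral>\<^sup>+\<omega>. 
        ennreal (exp (Re (r * z * (\<Sum>j\<le>N. a j \<omega> * (\<Prod>i<j. p i (\<omega> (u i))))))) \<partial>PiM I M)"
    proof (rule nn_integral_cmult)
      have "(\<lambda>\<omega>. ennreal (exp (Re (r * z * X \<omega>)))) \<in> borel_measurable (PiM I M)" by measurable
      then show
        "(\<lambda>\<omega>. ennreal (exp (Re (r * z * (\<Sum>j\<le>N. a j \<omega> * (\<Prod>i<j. p i (\<omega> (u i))))))))
        \<in> borel_measurable (PiM I M)"
        by (subst (asm) measurable_cong[of _ _ "\<lambda>\<omega>. ennreal (exp (Re (r * z * (\<Sum>j\<le>N. a j \<omega>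
        * (\<Prod>i<j. p i (\<omega> (u i)))))))"])
          (use X(1) in auto)
    qed
    also have "\<dots> \<le> ennreal (exp (- r * v / 2)) *
        ennreal (exp (2 * cmod (r * z) * B + 8 * (cmod (r * z))\<^sup>2 * B * (\<Sum>j\<le>N. b j)))"
      using b(1)[of N] B
      by (intro mult_left_mono nn_integral_exp_random_phases M u p a b) auto
    also have "\<dots> \<le> ennreal (exp (2 * r * B + 8 * r\<^sup>2 * B - r * v / 2))"
    proof -
      have "8 * r\<^sup>2 * B * (\<Sum>j\<le>N. b j) \<le> 8 * r\<^sup>2 * B"
        using B b(3) by (intro mult_left_le) auto
      then show ?thesis using r z
        by (simp add: norm_mult ennreal_mult[symmetric] exp_add[symmetric] del: exp_add)
    qed
    finally show ?thesis by (simp add: I.emeasure_eq_measure)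
  qed
  have "{\<omega> \<in> space (PiM I M). v \<le> cmod (X \<omega>)} \<subseteq> (Q 1 \<union> Q (-1)) \<union> (Q \<i> \<union> Q (-\<i>))"
  proof (safe, rule ccontr)
    fix \<omega> assume "\<omega> \<in> space (PiM I M)" "v \<le> cmod (X \<omega>)"
      "\<omega> \<notin> Q (-\<i>)" "\<omega> \<notin> Q \<i>" "\<omega> \<notin> Q 1" "\<omega> \<notin> Q (-1)"
    then show False using cmod_le[of "X \<omega>"] by (auto simp: Q_def abs_if split: if_splits)
  qed
  then have "measure (PiM I M) {\<omega> \<in> space (PiM I M). v \<le> cmod (X \<omega>)}
    \<le> measure (PiM I M) ((Q 1 \<union> Q (-1)) \<union> (Q \<i> \<union> Q (-\<i>)))"
    using sQ by (intro I.finite_measure_mono) auto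
  also have "\<dots> \<le> (measure (PiM I M) (Q 1) + measure (PiM I M) (Q (-1))) +
      (measure (PiM I M) (Q \<i>) + measure (PiM I M) (Q (-\<i>)))"
    using sQ by (intro order_trans[OF measure_Un_le] add_mono measure_Un_le) auto
  also have "\<dots> \<le> 4 * exp (2 * r * B + 8 * r\<^sup>2 * B - r * v / 2)"
    using PQ[of 1] PQ[of "-1"] PQ[of \<i>] PQ[of "-\<i>"] by simp
  finally show ?thesis .
qed

subsection \<open>Dyadic net content\<close>

text \<open>The code \<open>(k, i)\<close> stands for the interval \<open>[i / 2 ^ k, (i + 1) / 2 ^ k)\<close>.\<close>

definition dyadic_code :: "real \<Rightarrow> nat \<Rightarrow> nat \<times> int" where
  "dyadic_code x k = (k, \<lfloor>x * 2 ^ k\<rfloor>)"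

definition dyadic_interval :: "nat \<times> int \<Rightarrow> real set" where
  "dyadic_interval q = {x. dyadic_code x (fst q) = q}"

definition dyadic_cover :: "(nat \<times> int) set \<Rightarrow> real set" where
  "dyadic_cover Q = {x. \<exists>k. dyadic_code x k \<in> Q}"

text \<open>The cost of a family of intervals is the measure of its set of codes, so that
  subadditivity, modularity and continuity along increasing families are facts of measure
  theory.\<close>

definition code_measure :: "real \<Rightarrow> (nat \<times> int) measure" where
  "code_measure s = density (count_space UNIV) (\<lambda>q. ennreal (2 powr (- s * real (fst q))))"

text \<open>Hausdorff content computed with dyadic intervals of length at most 1. Lengths are not
  forced to tend to 0, so bounded sets have finite content; for \<open>0 < s\<close> a set of
  content 0 still has Hausdorff measure 0 (\<open>hausdorff_measure_eq_0\<close>).\<close>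

definition net_content :: "real \<Rightarrow> real set \<Rightarrow> ennreal" where
  "net_content s A = (INF Q \<in> {Q. A \<subseteq> dyadic_cover Q}. emeasure (code_measure s) Q)"

definition maximal_codes :: "(nat \<times> int) set \<Rightarrow> (nat \<times> int) set" where
  "maximal_codes Q = {q \<in> Q. \<forall>x \<in> dyadic_interval q. \<forall>k < fst q. dyadic_code x k \<notin> Q}"

lemma floor_dyadic_div: "\<lfloor>x * 2 ^ k\<rfloor> = \<lfloor>x * 2 ^ (k + n)\<rfloor> div 2 ^ n" for x :: real
proof -
  have "x * 2 ^ k = (x * 2 ^ (k + n)) / real_of_int (2 ^ n)"
    by (simp add: power_add)
  then show ?thesis
    by (metis floor_divide_real_eq_div zero_le_power zero_le_numeral)
qed

lemma dyadic_code_eq_mono: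
  assumes "dyadic_code x n = dyadic_code y n" "k \<le> n"
  shows "dyadic_code x k = dyadic_code y k"
  using assms floor_dyadic_div[of x k "n - k"] floor_dyadic_div[of y k "n - k"]
  by (simp add: dyadic_code_def)

lemma sets_code_measure [simp]: "sets (code_measure s) = UNIV"
  by (simp add: code_measure_def)

lemma emeasure_code_measure_singleton:
  "emeasure (code_measure s) {q} = ennreal (2 powr (- s * real (fst q)))"
proof -
  have "emeasure (code_measure s) {q}
    = (\<integral>\<^sup>+ r. ennreal (2 powr (- s * real (fst r))) * indicator {q} r \<partial>count_space UNIV)"
    by (simp add: code_measure_def emeasure_density)
  also have "\<dots> = (\<integral>\<^sup>+ r. ennreal (2 powr (- s * real (fst q))) * indicator {q} r \<partial>count_space UNIV)"
    by (intro nn_integral_cong) (auto split: split_indicator)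
  finally show ?thesis by (simp add: nn_integral_cmult)
qed

lemma mem_dyadic_interval_code: "x \<in> dyadic_interval (dyadic_code x k)"
  by (simp add: dyadic_interval_def dyadic_code_def)

lemma dyadic_interval_iff: "x \<in> dyadic_interval q \<longleftrightarrow> q = dyadic_code x (fst q)"
  by (auto simp: dyadic_interval_def)

lemma dyadic_cover_Un [simp]: "dyadic_cover (A \<union> B) = dyadic_cover A \<union> dyadic_cover B"
  by (auto simp: dyadic_cover_def)

lemma dyadic_cover_singleton [simp]: "dyadic_cover {q} = dyadic_interval q"
  by (auto simp: dyadic_cover_def dyadic_interval_def dyadic_code_def)

lemma net_content_le: "A \<subseteq> dyadic_cover Q \<Longrightarrow> net_content s A \<le> emeasure (code_measure s) Q"
  unfolding net_content_def by (rule INF_lower) simp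

lemma net_content_mono: "A \<subseteq> B \<Longrightarrow> net_content s A \<le> net_content s B"
  unfolding net_content_def by (rule INF_superset_mono) auto

lemma net_content_empty [simp]: "net_content s {} = 0"
  using net_content_le[of "{}" "{}" s] by simp

lemma net_content_dyadic_interval:
  "net_content s (A \<inter> dyadic_interval q) \<le> ennreal (2 powr (- s * real (fst q)))"
  using net_content_le[of "A \<inter> dyadic_interval q" "{q}" s]
  by (simp add: emeasure_code_measure_singleton)

lemma net_content_exists_cover:
  assumes "net_content s A < c"
  obtains Q where "A \<subseteq> dyadic_cover Q" "emeasure (code_measure s) Q < c"
  using assms unfolding net_content_def INF_less_iff by auto

lemma net_content_Un: "net_content s (A \<union> B) \<le> net_content s A + net_content s B"
proof (rule ennreal_le_epsilon)
  fix e :: real assume fin: "net_content s A + net_content s B < top" and e: "0 < e"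
  have "net_content s X < net_content s X + ennreal (e / 2)" if "net_content s X < top" for X
    using that e ennreal_add_left_cancel_less[of "net_content s X" 0 "ennreal (e/2)"] by auto
  then have "net_content s A < net_content s A + ennreal (e / 2)"
    "net_content s B < net_content s B + ennreal (e / 2)"
    using fin by auto
  from net_content_exists_cover[OF this(1)] net_content_exists_cover[OF this(2)]
  obtain P Q where P: "A \<subseteq> dyadic_cover P"
    "emeasure (code_measure s) P < net_content s A + ennreal (e / 2)"
    and Q: "B \<subseteq> dyadic_cover Q" "emeasure (code_measure s) Q < net_content s B + ennreal (e / 2)"
    by metis
  have "net_content s (A \<union> B) \<le> emeasure (code_measure s) (P \<union> Q)"
    using P Q by (intro net_content_le) auto
  also have "\<dots> \<le> emeasure (code_measure s) P + emeasure (code_measure s) Q"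
    by (intro emeasure_subadditive) auto
  also have "\<dots> \<le> (net_content s A + ennreal (e / 2)) + (net_content s B + ennreal (e / 2))"
    using P Q by (intro add_mono) auto
  also have "\<dots> = net_content s A + net_content s B + (ennreal (e / 2) + ennreal (e / 2))"
    by (simp add: ac_simps)
  also have "ennreal (e / 2) + ennreal (e / 2) = ennreal e"
    using e by (subst ennreal_plus[symmetric]) auto
  finally show "net_content s (A \<union> B) \<le> net_content s A + net_content s B + ennreal e" .
qed

text \<open>All points of a dyadic interval have the same coarser codes, so the quantifier over
  points in \<open>maximal_codes\<close> may be tested at a single one.\<close>

lemma dyadic_code_maximal_iff:
  "dyadic_code x n \<in> maximal_codes Q \<longleftrightarrow> dyadic_code x n \<in> Q \<and> (\<forall>k<n. dyadic_code x k \<notin> Q)"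
proof -
  have n: "fst (dyadic_code x n) = n" by (simp add: dyadic_code_def)
  have "dyadic_code y k = dyadic_code x k" if "y \<in> dyadic_interval (dyadic_code x n)" "k < n"
    for y k
    using that dyadic_code_eq_mono[of y n x k] by (simp add: dyadic_interval_def n)
  then have "(\<forall>y \<in> dyadic_interval (dyadic_code x n). \<forall>k<n. dyadic_code y k \<notin> Q)
    \<longleftrightarrow> (\<forall>k<n. dyadic_code x k \<notin> Q)"
    using mem_dyadic_interval_code[of x n] by metis
  then show ?thesis by (simp only: maximal_codes_def mem_Collect_eq n)
qed

lemma dyadic_code_maximal_least:
  assumes "dyadic_code x n \<in> Q"
  obtains k where "k \<le> n" "dyadic_code x k \<in> maximal_codes Q"
proof
  let ?k = "LEAST k. dyadic_code x k \<in> Q"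
  show "?k \<le> n" using assms by (rule Least_le)
  show "dyadic_code x ?k \<in> maximal_codes Q"
    unfolding dyadic_code_maximal_iff using LeastI[of "\<lambda>k. dyadic_code x k \<in> Q", OF assms]
    by (auto dest: not_less_Least)
qed

text \<open>A point of \<open>A\<close> lies in an interval of \<open>P\<close> and in one of
  \<open>Q\<close>. These are nested: either they are equal, or the smaller one is not maximal. So
  the common codes together with the non-maximal ones still cover \<open>A\<close>, and what the
  restriction to maximal codes saves pays for \<open>net_content s A\<close>.\<close>

lemma net_content_strong_subadditive:
  assumes "A \<subseteq> dyadic_cover P" "A \<subseteq> dyadic_cover Q"
  shows "emeasure (code_measure s) (maximal_codes (P \<union> Q)) + net_content s A
    \<le> emeasure (code_measure s) P + emeasure (code_measure s) Q"
proof -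
  let ?W = "emeasure (code_measure s)" and ?T = "P \<union> Q"
  let ?U = "maximal_codes ?T"
  have sub: "?U \<subseteq> ?T" by (auto simp: maximal_codes_def)
  have "A \<subseteq> dyadic_cover ((P \<inter> Q) \<union> (?T - ?U))"
  proof
    fix x assume "x \<in> A"
    then have "x \<in> dyadic_cover P" "x \<in> dyadic_cover Q" using assms by auto
    then obtain k l where kl: "dyadic_code x k \<in> P" "dyadic_code x l \<in> Q"
      unfolding dyadic_cover_def by blast
    show "x \<in> dyadic_cover ((P \<inter> Q) \<union> (?T - ?U))"
    proof (cases k l rule: linorder_cases)
      case less
      then have "dyadic_code x l \<in> ?T - ?U" using kl by (auto simp: dyadic_code_maximal_iff)
      then show ?thesis unfolding dyadic_cover_def by blast
    next
      case equal
      then show ?thesis using kl by (auto simp: dyadic_cover_def)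
    next
      case greater
      then have "dyadic_code x k \<in> ?T - ?U" using kl by (auto simp: dyadic_code_maximal_iff)
      then show ?thesis unfolding dyadic_cover_def by blast
    qed
  qed
  then have "net_content s A \<le> ?W ((P \<inter> Q) \<union> (?T - ?U))" by (rule net_content_le)
  also have "\<dots> \<le> ?W (P \<inter> Q) + ?W (?T - ?U)" by (intro emeasure_subadditive) auto
  finally have "?W ?U + net_content s A \<le> ?W ?U + (?W (P \<inter> Q) + ?W (?T - ?U))"
    by (rule add_left_mono)
  also have "\<dots> = (?W ?U + ?W (?T - ?U)) + ?W (P \<inter> Q)" by (simp add: ac_simps)
  also have "?W ?U + ?W (?T - ?U) = ?W ?T"
    using sub by (subst plus_emeasure) (auto intro!: arg_cong[where f = ?W])
  also have "?W ?T + ?W (P \<inter> Q) = ?W P + ?W Q"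
    by (subst emeasure_Un_Int[of P _ Q]) auto
  finally show ?thesis .
qed

text \<open>The covers \<open>U n\<close> of maximal intervals grow coarser with \<open>n\<close>, so that the interval of \<open>U n\<close>
  containing a given point is eventually constant; the limiting intervals cover the union.\<close>

lemma net_content_incseq:
  assumes A: "incseq A"
  shows "net_content s (\<Union>n. A n) \<le> (SUP n. net_content s (A n))"
proof (rule ennreal_le_epsilon)
  fix e :: real assume fin: "(SUP n. net_content s (A n)) < top" and e: "0 < e"
  let ?W = "emeasure (code_measure s)" and ?L = "SUP n. net_content s (A n)"
  define d where "d = (\<lambda>n. e * (1 / 2) ^ Suc n)"
  have d: "0 < d n" for n using e by (simp add: d_def)
  have d0: "0 \<le> d n" for n using d[of n] by simp
  have sum_d: "sum d {..n} \<le> e" for n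
  proof -
    have "d sums e" unfolding d_def using sums_mult[OF power_half_series, of e] by simp
    then show ?thesis using sum_le_suminf[of d "{..n}"] d0 by (simp add: sums_iff)
  qed
  have finA: "net_content s (A n) < top" for n
    using fin by (meson SUP_upper UNIV_I le_less_trans)
  have lt: "net_content s (A n) < net_content s (A n) + ennreal (d n)" for n
    using finA[of n] d[of n] ennreal_add_left_cancel_less[of "net_content s (A n)" 0 "ennreal (d n)"] by auto
  have "\<forall>n. \<exists>Q. A n \<subseteq> dyadic_cover Q \<and> ?W Q < net_content s (A n) + ennreal (d n)"
    by (rule allI, rule net_content_exists_cover[OF lt]) blast
  from choice[OF this] obtain C where C: "\<And>n. A n \<subseteq> dyadic_cover (C n)"
    "\<And>n. ?W (C n) < net_content s (A n) + ennreal (d n)" by blast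
  define U where "U = rec_nat (C 0) (\<lambda>n u. maximal_codes (u \<union> C (Suc n)))"
  have U0: "U 0 = C 0" and US: "U (Suc n) = maximal_codes (U n \<union> C (Suc n))" for n
    by (simp_all add: U_def)
  have grow: "\<exists>l\<le>k. dyadic_code x l \<in> U (Suc n)" if "dyadic_code x k \<in> U n \<union> C (Suc n)" for x k n
    unfolding US by (rule dyadic_code_maximal_least[OF that]) blast
  have cov: "A n \<subseteq> dyadic_cover (U n)" for n
  proof (cases n)
    case (Suc m)
    show ?thesis
    proof
      fix x assume "x \<in> A n"
      then obtain k where "dyadic_code x k \<in> C n" using C(1) by (auto simp: dyadic_cover_def)
      then show "x \<in> dyadic_cover (U n)" using grow[of x k m] Suc by (auto simp: dyadic_cover_def)
    qed
  qed (use C U0 in auto)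
  \<comment> \<open>Both covers that are merged contain \<open>A n\<close>, so strong subadditivity
    puts \<open>?c n\<close> on the left as well. It is finite and cancels, and only the errors
    \<open>d\<close> accumulate; plain subadditivity would add up the contents themselves.\<close>
  have WU: "?W (U n) \<le> net_content s (A n) + ennreal (sum d {..n})" for n
  proof (induction n)
    case 0 then show ?case using C(2)[of 0] U0 by simp
  next
    case (Suc n)
    let ?c = "\<lambda>n. net_content s (A n)"
    have "A n \<subseteq> A (Suc n)" using A by (simp add: incseq_Suc_iff)
    then have "?W (U (Suc n)) + ?c n \<le> ?W (U n) + ?W (C (Suc n))"
      unfolding US using cov[of n] C(1)[of "Suc n"] by (intro net_content_strong_subadditive) auto
    also have "\<dots> \<le> (?c n + ennreal (sum d {..n})) + (?c (Suc n) + ennreal (d (Suc n)))"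
      using Suc C(2)[of "Suc n"] by (intro add_mono) auto
    also have "\<dots> = ?c n + (?c (Suc n) + (ennreal (sum d {..n}) + ennreal (d (Suc n))))"
      by (simp add: ac_simps)
    also have "ennreal (sum d {..n}) + ennreal (d (Suc n)) = ennreal (sum d {..Suc n})"
      using d0 by (simp add: sum_nonneg)
    finally have "?c n + ?W (U (Suc n)) \<le> ?c n + (?c (Suc n) + ennreal (sum d {..Suc n}))"
      by (simp add: add.commute)
    then show ?case using finA[of n] unfolding ennreal_add_left_cancel_le by auto
  qed
  \<comment> \<open>\<open>V n\<close> collects the codes that belong to \<open>U m\<close> for
    every \<open>m \<ge> n\<close>. It increases with \<open>n\<close> and costs no more than
    \<open>U n\<close>.\<close>
  define V where "V = (\<lambda>n. \<Inter>m\<in>{n..}. U m)"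
  have incV: "incseq V" by (auto simp: V_def incseq_def)
  have "(\<Union>n. A n) \<subseteq> dyadic_cover (\<Union>n. V n)"
  proof
    fix x assume "x \<in> (\<Union>n. A n)"
    then obtain N where "x \<in> A N" by blast
    then have N: "x \<in> A n" if "n \<ge> N" for n
      using incseqD[OF A that] by blast
    \<comment> \<open>The level of the largest interval of \<open>U (N + n)\<close> around
      \<open>x\<close>. By \<open>grow\<close> it never increases, so it stabilises, and the code at
      the final level survives in some \<open>V n\<close>.\<close>
    define k where "k = (\<lambda>n. LEAST k. dyadic_code x k \<in> U (N + n))"
    have kU: "dyadic_code x (k n) \<in> U (N + n)" for n
    proof -
      have "\<exists>k. dyadic_code x k \<in> U (N + n)"
        using N[of "N + n"] cov[of "N + n"] by (auto simp: dyadic_cover_def)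
      then show ?thesis unfolding k_def by (rule LeastI_ex)
    qed
    have "k (Suc n) \<le> k n" for n
    proof -
      obtain l where "l \<le> k n" "dyadic_code x l \<in> U (N + Suc n)"
        using grow[of x "k n" "N + n"] kU[of n] by auto
      then show ?thesis unfolding k_def[of] by (meson Least_le order_trans)
    qed
    then have dec: "k n \<le> k m" if "m \<le> n" for m n
      using that by (rule lift_Suc_antimono_le)
    define l where "l = (LEAST v. \<exists>n. k n = v)"
    obtain M where M: "k M = l" unfolding l_def using LeastI_ex[of "\<lambda>v. \<exists>n. k n = v"] by auto
    have "k n = l" if "n \<ge> M" for n
    proof -
      have "l \<le> k n" unfolding l_def by (rule Least_le) blast
      then show ?thesis using dec[OF that] M by simp
    qed
    then have "dyadic_code x l \<in> U m" if "m \<ge> N + M" for m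
      using kU[of "m - N"] that by simp
    then have "dyadic_code x l \<in> V (N + M)" by (auto simp: V_def)
    then show "x \<in> dyadic_cover (\<Union>n. V n)" unfolding dyadic_cover_def by blast
  qed
  then have "net_content s (\<Union>n. A n) \<le> ?W (\<Union>n. V n)" by (rule net_content_le)
  also have "\<dots> = (SUP n. ?W (V n))"
    by (rule SUP_emeasure_incseq[symmetric]) (use incV in auto)
  also have "\<dots> \<le> ?L + ennreal e"
  proof (rule SUP_least)
    fix n
    have "?W (V n) \<le> ?W (U n)" by (intro emeasure_mono) (auto simp: V_def)
    also have "\<dots> \<le> net_content s (A n) + ennreal (sum d {..n})" by (rule WU)
    also have "\<dots> \<le> ?L + ennreal e"
      by (intro add_mono SUP_upper ennreal_leI sum_d) auto
    finally show "?W (V n) \<le> ?L + ennreal e" .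
  qed
  finally show "net_content s (\<Union>n. A n) \<le> ?L + ennreal e" .
qed

subsection \<open>Capacitability of Borel sets\<close>

text \<open>These are the analytic sets, as projections along Baire space. Bounding every entry of
  the sequences cuts out a compact part, which is what the capacitability argument exploits.\<close>

definition closed_projection :: "real set \<Rightarrow> bool" where
  "closed_projection A \<longleftrightarrow> (\<exists>H :: (real \<times> (nat \<Rightarrow> nat)) set. closed H \<and> A = fst ` H)"

lemma continuous_on_reindex:
  "continuous_on UNIV (\<lambda>y :: nat \<Rightarrow> nat. (\<lambda>i. y (f i)) :: nat \<Rightarrow> nat)"
  by (intro continuous_on_coordinatewise_then_product continuous_on_product_coordinates)

lemma closed_vimage_reindex:
  fixes f :: "nat \<Rightarrow> nat"
  assumes "closed (H :: (real \<times> (nat \<Rightarrow> nat)) set)"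
  shows "closed {z. (fst z, (\<lambda>i. snd z (f i))) \<in> H}"
proof -
  have "continuous_on UNIV (\<lambda>z :: real \<times> (nat \<Rightarrow> nat). (fst z, (\<lambda>i. snd z (f i))))"
    by (intro continuous_on_Pair continuous_on_fst continuous_on_id
        continuous_on_compose2[OF continuous_on_reindex continuous_on_snd]) auto
  from closed_vimage[OF assms this] show ?thesis by (simp add: vimage_def)
qed

lemma closed_projection_closed: "closed A \<Longrightarrow> closed_projection A"
  unfolding closed_projection_def
    by (intro exI[of _ "A \<times> UNIV"]) (auto simp: closed_Times image_iff)

text \<open>Entry 0 of the sequence names a set that contains the point, and the remaining entries
  are a witness for that set.\<close>

lemma closed_projection_UN:
  assumes "\<And>n :: nat. closed_projection (A n)"
  shows "closed_projection (\<Union>n. A n)"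
proof -
  have "\<forall>n. \<exists>H :: (real \<times> (nat \<Rightarrow> nat)) set. closed H \<and> A n = fst ` H"
    using assms unfolding closed_projection_def by blast
  from choice[OF this] obtain H :: "nat \<Rightarrow> (real \<times> (nat \<Rightarrow> nat)) set"
    where H: "\<And>n. closed (H n)" "\<And>n. A n = fst ` (H n)" by blast
  let ?G = "{z. \<forall>n. snd z 0 \<noteq> n \<or> (fst z, (\<lambda>i. snd z (Suc i))) \<in> H n}"
  have "closed ({z :: real \<times> (nat \<Rightarrow> nat). snd z 0 \<noteq> n})" for n :: nat
  proof -
    have "continuous_on UNIV (\<lambda>z :: real \<times> (nat \<Rightarrow> nat). snd z 0)"
      by (intro continuous_on_compose2[OF continuous_on_product_coordinates continuous_on_snd]) (auto intro: continuous_on_id)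
    moreover have "closed (- {n} :: nat set)" unfolding closed_def
      by (rule discrete_topology_class.open_discrete)
    ultimately have "closed ((\<lambda>z :: real \<times> (nat \<Rightarrow> nat). snd z 0) -` (- {n}))"
      by (rule closed_vimage[rotated])
    then show ?thesis by (simp add: vimage_def)
  qed
  then have "closed ?G"
    by (intro closed_Collect_all closed_Collect_disj closed_vimage_reindex H)
  moreover have "(\<Union>n. A n) = fst ` ?G"
  proof safe
    fix n x assume "x \<in> A n"
    then obtain y where "(x, y) \<in> H n" using H by auto
    then have "(x, case_nat n y) \<in> ?G" by auto
    then show "x \<in> fst ` ?G" by (metis (no_types, lifting) fst_conv image_eqI)
  next
    fix x y assume "\<forall>n. snd (x, y) 0 \<noteq> n \<or> (fst (x, y), (\<lambda>i. snd (x, y) (Suc i))) \<in> H n"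
    then have "(x, \<lambda>i. y (Suc i)) \<in> H (y 0)" by simp
    then have "x \<in> A (y 0)" unfolding H by force
    then show "fst (x, y) \<in> (\<Union>n. A n)" by auto
  qed
  ultimately show ?thesis unfolding closed_projection_def by blast
qed

text \<open>A point of the intersection has one witness for each \<open>n\<close>;
  \<open>prod_encode\<close> interleaves these countably many sequences into a single one.\<close>

lemma closed_projection_INT:
  assumes "\<And>n :: nat. closed_projection (A n)"
  shows "closed_projection (\<Inter>n. A n)"
proof -
  have "\<forall>n. \<exists>H :: (real \<times> (nat \<Rightarrow> nat)) set. closed H \<and> A n = fst ` H"
    using assms unfolding closed_projection_def by blast
  from choice[OF this] obtain H :: "nat \<Rightarrow> (real \<times> (nat \<Rightarrow> nat)) set"
    where H: "\<And>n. closed (H n)" "\<And>n. A n = fst ` (H n)" by blast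
  let ?G = "{z. \<forall>n. (fst z, (\<lambda>i. snd z (prod_encode (n, i)))) \<in> H n}"
  have "closed ?G" by (intro closed_Collect_all closed_vimage_reindex H)
  moreover have "(\<Inter>n. A n) = fst ` ?G"
  proof safe
    fix x assume "x \<in> (\<Inter>n. A n)"
    then have "\<exists>y. (x, y) \<in> H n" for n using H(2)[of n] by force
    then obtain y where "\<And>n. (x, y n) \<in> H n" by metis
    then have "(x, \<lambda>j. y (fst (prod_decode j)) (snd (prod_decode j))) \<in> ?G" by simp
    then show "x \<in> fst ` ?G" by (metis (no_types, lifting) fst_conv image_eqI)
  next
    fix x y n assume "\<forall>n. (fst (x, y), (\<lambda>i. snd (x, y) (prod_encode (n, i)))) \<in> H n"
    then have "(x, \<lambda>i. y (prod_encode (n, i))) \<in> H n" by simp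
    then show "fst (x, y) \<in> A n" unfolding H by force
  qed
  ultimately show ?thesis unfolding closed_projection_def by blast
qed

text \<open>Complements of such projections need not be projections, so the induction carries each
  set together with its complement. The only complement to be found by hand is the open half-line, a
  countable union of closed ones.\<close>

lemma closed_projection_borel:
  assumes "A \<in> sets borel"
  shows "closed_projection A"
proof -
  have "A \<in> sigma_sets UNIV (range (\<lambda>a :: real. {..a}))"
    using assms by (simp add: borel_eq_atMost)
  then have "closed_projection A \<and> closed_projection (- A)"
  proof induction
    case (Basic A)
    then obtain a where A: "A = {..a}" by auto
    have "{a<..} = (\<Union>n :: nat. {a + 1 / Suc n..})"
    proof safe
      fix x assume "a < x"
      then obtain n where "1 / Suc n < x - a"
        using nat_approx_posE[of "x - a"] by auto
      then show "x \<in> (\<Union>n :: nat. {a + 1 / Suc n..})" by (intro UN_I[of n]) auto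
    next
      fix x n assume "a + 1 / real (Suc n) \<le> x"
      moreover have "0 < 1 / real (Suc n)" by simp
      ultimately show "a < x" by linarith
    qed
    moreover have "- A = {a<..}" using A by auto
    ultimately have "- A = (\<Union>n :: nat. {a + 1 / Suc n..})" by simp
    moreover have "closed_projection (\<Union>n :: nat. {a + 1 / Suc n..})"
      by (intro closed_projection_UN closed_projection_closed closed_atLeast)
    ultimately show ?case using A by (auto intro: closed_projection_closed)
  next
    case Empty
    then show ?case by (auto intro: closed_projection_closed)
  next
    case (Compl A)
    then show ?case by (simp add: Compl_eq_Diff_UNIV[symmetric])
  next
    case (Union A)
    then show ?case by (auto intro: closed_projection_UN closed_projection_INT)
  qed
  then show ?thesis ..
qed

section \<open>Approximation of the content by open sets from outside and by compact sets from
  inside\<close>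

lemma powr_neg_tendsto_0: "0 < s \<Longrightarrow> (\<lambda>n. 2 powr (- s * real n)) \<longlonglongrightarrow> 0"
proof -
  assume s: "0 < s"
  have "(\<lambda>n. (2 powr (- s)) ^ n) \<longlonglongrightarrow> 0"
    using s by (intro LIMSEQ_power_zero) (simp add: powr_less_one)
  moreover have "2 powr (- s * real n) = (2 powr (- s)) ^ n" for n
    by (simp only: powr_powr[symmetric] powr_realpow powr_gt_zero)
  ultimately show ?thesis by simp
qed

text \<open>Dyadic intervals are half-open, so a dyadic cover need not be open. Each interval is
  enlarged to the left into one adjacent dyadic interval, so short that all the added costs sum to
  at most \<open>e\<close>; \<open>0 < s\<close> is what makes short intervals cheap.\<close>

lemma net_content_open_cover:
  assumes s: "0 < s" and e: "0 < e"
  obtains V where "open V" "dyadic_cover Q \<subseteq> V"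
    "net_content s V \<le> emeasure (code_measure s) Q + ennreal e"
proof -
  define q where "q = (\<lambda>i. from_nat i :: nat \<times> int)"
  have "\<exists>n > fst (q i). 2 powr (- s * real n) \<le> e * (1 / 2) ^ Suc i" for i
  proof -
    have "\<forall>\<^sub>F n in sequentially. 2 powr (- s * real n) < e * (1 / 2) ^ Suc i"
      using e by (intro order_tendstoD(2)[OF powr_neg_tendsto_0[OF s]]) auto
    then have "\<forall>\<^sub>F n in sequentially. n > fst (q i) \<and> 2 powr (- s * real n) < e * (1 / 2) ^ Suc i"
      by (intro eventually_conj eventually_gt_at_top)
    from eventually_happens[OF this] show ?thesis by (auto intro: less_imp_le)
  qed
  then obtain n where n: "\<And>i. n i > fst (q i)" "\<And>i. 2 powr (- s * real (n i)) \<le> e * (1 / 2) ^ Suc i"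
    by metis
  \<comment> \<open>The index at level \<open>n i\<close> of the dyadic interval that ends where the
    interval of \<open>q i\<close> begins.\<close>
  define a where "a = (\<lambda>i. snd (q i) * 2 ^ (n i - fst (q i)) - 1)"
  define l where "l = (\<lambda>i. (n i, a i))"
  define V where
    "V = (\<Union>i \<in> {i. q i \<in> Q}. {a i / 2 ^ n i <..< (snd (q i) + 1) / 2 ^ fst (q i)} :: real set)"
  have eq: "(2::real) ^ n i = 2 ^ fst (q i) * 2 ^ (n i - fst (q i))" for i
    using n(1)[of i] by (simp flip: power_add)
  have V: "x \<in> dyadic_interval (q i) \<or> x \<in> dyadic_interval (l i)"
    if "a i / 2 ^ n i < x" "x < (snd (q i) + 1) / 2 ^ fst (q i)" for x i
  proof (cases "snd (q i) / 2 ^ fst (q i) \<le> x")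
    case True
    then have "\<lfloor>x * 2 ^ fst (q i)\<rfloor> = snd (q i)" using that
      by (intro floor_unique) (auto simp: field_simps)
    then show ?thesis by (simp add: dyadic_interval_def dyadic_code_def prod_eq_iff)
  next
    case False
    have "\<lfloor>x * 2 ^ n i\<rfloor> = a i"
    proof (rule floor_unique)
      show "real_of_int (a i) \<le> x * 2 ^ n i"
        using that by (simp add: field_simps)
      have "x * 2 ^ fst (q i) < snd (q i)" using False by (simp add: field_simps)
      then have
        "x * 2 ^ fst (q i) * 2 ^ (n i - fst (q i)) < real_of_int (snd (q i))
        * 2 ^ (n i - fst (q i))"
        by (intro mult_strict_right_mono) auto
      then show "x * 2 ^ n i < real_of_int (a i) + 1"
        unfolding eq a_def by (simp add: mult_ac)
    qed
    then show ?thesis by (simp add: dyadic_interval_def dyadic_code_def l_def prod_eq_iff)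
  qed
  show thesis
  proof
    show "open V" unfolding V_def by auto
    show "dyadic_cover Q \<subseteq> V"
    proof
      fix x assume "x \<in> dyadic_cover Q"
      then obtain k where k: "dyadic_code x k \<in> Q" unfolding dyadic_cover_def by blast
      define i where "i = to_nat (dyadic_code x k)"
      have q: "q i = dyadic_code x k" by (simp add: q_def i_def)
      have q': "fst (q i) = k" "snd (q i) = \<lfloor>x * 2 ^ k\<rfloor>" by (simp_all add: q dyadic_code_def)
      have "real_of_int \<lfloor>x * 2 ^ k\<rfloor> \<le> x * 2 ^ k" "x * 2 ^ k < real_of_int \<lfloor>x * 2 ^ k\<rfloor> + 1"
        by linarith+
      then have 1: "snd (q i) / 2 ^ fst (q i) \<le> x" "x < (snd (q i) + 1) / 2 ^ fst (q i)"
        unfolding q' by (simp_all add: field_simps)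
      have "a i / 2 ^ n i < snd (q i) / (2 ^ fst (q i) :: real)"
        unfolding eq a_def by (simp add: field_simps)
      with 1 k show "x \<in> V" unfolding V_def by (intro UN_I[of i]) (auto simp: q)
    qed
    have "V \<subseteq> dyadic_cover (Q \<union> range l)"
    proof
      fix x assume "x \<in> V"
      then obtain i where i: "q i \<in> Q" "x \<in> {a i / 2 ^ n i <..< (snd (q i) + 1) / 2 ^ fst (q i)}"
        unfolding V_def by blast
      then have "x \<in> dyadic_interval (q i) \<or> x \<in> dyadic_interval (l i)" using V[of i x] by auto
      then show "x \<in> dyadic_cover (Q \<union> range l)"
        unfolding dyadic_cover_def dyadic_interval_def using i(1)
          by (metis (mono_tags) UnI1 UnI2 mem_Collect_eq rangeI)
    qed
    then have "net_content s V \<le> emeasure (code_measure s) (Q \<union> range l)" by (rule net_content_le)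
    also have "\<dots> \<le> emeasure (code_measure s) Q + emeasure (code_measure s) (\<Union>i. {l i})"
      by (intro order_trans[OF _ emeasure_subadditive] emeasure_mono) auto
    also have "emeasure (code_measure s) (\<Union>i. {l i}) \<le> (\<Sum>i. emeasure (code_measure s) {l i})"
      by (intro emeasure_subadditive_countably) auto
    also have "\<dots> \<le> (\<Sum>i. ennreal (e * (1 / 2) ^ Suc i))"
    proof (intro suminf_le summableI)
      fix i
      show "emeasure (code_measure s) {l i} \<le> ennreal (e * (1 / 2) ^ Suc i)"
        unfolding emeasure_code_measure_singleton using n(2)[of i]
          by (intro ennreal_leI) (simp add: l_def)
    qed
    also have "\<dots> = ennreal e"
      using e sums_mult[OF power_half_series, of e]
      by (intro suminf_ennreal_eq) auto
    finally show "net_content s V \<le> emeasure (code_measure s) Q + ennreal e"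
      by (simp add: add_left_mono)
  qed
qed

text \<open>Choquet's argument. For each entry of the sequences in turn, the parts of
  \<open>A\<close> that are left by a bound on this entry increase with the bound, so continuity
  along increasing sequences yields a bound that keeps the content above \<open>e\<close>. Once all
  entries are bounded, the sequences range over a compact product of finite sets.\<close>

lemma exists_compact_subset_net_content_pos:
  assumes s: "0 < s" and A: "closed_projection A" "A \<subseteq> {lo..hi}" and pos: "net_content s A > 0"
  shows "\<exists>K. compact K \<and> K \<subseteq> A \<and> net_content s K > 0"
proof -
  obtain H :: "(real \<times> (nat \<Rightarrow> nat)) set" where H: "closed H" "A = fst ` H"
    using A(1) unfolding closed_projection_def by blast
  define B where "B = (\<lambda>g k. fst ` {z \<in> H. \<forall>i<k. snd z i \<le> g i})"
  obtain e where e: "0 < e" "e < net_content s A" using pos dense by blast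
  \<comment> \<open>Step \<open>k\<close> chooses a bound for entry \<open>k\<close> alone and keeps
    the earlier ones, so that the diagonal \<open>f\<close> below agrees with \<open>g k\<close> on
    the first \<open>k\<close> entries.\<close>
  have "\<exists>g. \<forall>k. e < net_content s (B (g k) k) \<and> (\<forall>i<k. g (Suc k) i = g k i)"
  proof (rule dependent_nat_choice)
    show "\<exists>g. e < net_content s (B g 0)" using e H by (simp add: B_def)
  next
    fix g k assume g: "e < net_content s (B g k)"
    have "B g k = (\<Union>n. B (g(k := n)) (Suc k))"
    proof safe
      fix x assume "x \<in> B g k"
      then obtain z where z: "z \<in> H" "\<forall>i<k. snd z i \<le> g i" "x = fst z" unfolding B_def by blast
      then have "x \<in> B (g(k := snd z k)) (Suc k)" unfolding B_def by (auto simp: less_Suc_eq)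
      then show "x \<in> (\<Union>n. B (g(k := n)) (Suc k))" by blast
    qed (force simp: B_def less_Suc_eq)
    moreover have "incseq (\<lambda>n. B (g(k := n)) (Suc k))"
      unfolding B_def by (rule incseq_SucI) (force simp: less_Suc_eq)
    ultimately have "e < (SUP n. net_content s (B (g(k := n)) (Suc k)))"
      using g net_content_incseq by (metis (no_types) order.strict_trans2)
    then obtain n where "e < net_content s (B (g(k := n)) (Suc k))" by (auto simp: less_SUP_iff)
    then show "\<exists>g'. e < net_content s (B g' (Suc k)) \<and> (\<forall>i<k. g' i = g i)"
      by (intro exI[of _ "g(k := n)"]) auto
  qed
  then obtain g where g: "\<And>k. e < net_content s (B (g k) k)" "\<And>k i. i < k \<Longrightarrow> g (Suc k) i = g k i"
    by blast
  define f where "f = (\<lambda>i. g (Suc i) i)"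
  have gf: "g k i = f i" if "i < k" for k i
    using that
  proof (induction k)
    case (Suc k)
    then show ?case using g(2)[of i k] by (cases "i = k") (auto simp: f_def)
  qed simp
  have "B (g k) k = B f k" for k
    unfolding B_def by (intro arg_cong[where f = "image fst"]) (auto simp: gf)
  then have ef: "e < net_content s (B f k)" for k using g(1)[of k] by simp
  define Y where "Y = (\<Pi>\<^sub>E i\<in>UNIV. {..f i})"
  have "compactin (product_topology (\<lambda>i. euclidean) UNIV) Y"
    unfolding Y_def compactin_PiE by (auto intro: finite_imp_compact)
  then have Y: "compact Y" unfolding euclidean_product_topology by simp
  define K where "K = fst ` (H \<inter> ({lo..hi} \<times> Y))"
  have K: "compact K"
    unfolding K_def
    by (intro compact_continuous_image closed_Int_compact H compact_Times Y continuous_on_fst continuous_on_id) auto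
  have "K \<subseteq> A" unfolding K_def H by auto
  moreover have "e \<le> net_content s K"
    unfolding net_content_def
  proof (rule INF_greatest)
    fix Q assume "Q \<in> {Q. K \<subseteq> dyadic_cover Q}"
    then have Q: "K \<subseteq> dyadic_cover Q" by simp
    show "e \<le> emeasure (code_measure s) Q"
    proof (rule ennreal_le_epsilon)
      fix d :: real assume "0 < d"
      then obtain V where V: "open V" "dyadic_cover Q \<subseteq> V"
        "net_content s V \<le> emeasure (code_measure s) Q + ennreal d"
        using net_content_open_cover[OF s] by blast
      \<comment> \<open>\<open>B f k\<close> bounds only finitely many entries and need not be
        compact. If each of these sets had a point outside \<open>V\<close>, such points would still
        accumulate at a point of \<open>K\<close>, which lies in the open set
        \<open>V\<close>.\<close>
      have "\<exists>k. B f k \<subseteq> V"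
      proof (rule ccontr)
        assume "\<nexists>k. B f k \<subseteq> V"
        then have "\<forall>k. \<exists>z. z \<in> H \<and> (\<forall>i<k. snd z i \<le> f i) \<and> fst z \<notin> V"
          unfolding B_def by blast
        from choice[OF this] obtain z where z: "\<And>k. z k \<in> H" "\<And>k i. i < k \<Longrightarrow> snd (z k) i \<le> f i"
          "\<And>k. fst (z k) \<notin> V" by blast
        \<comment> \<open>Cutting the entries down to \<open>f\<close> moves the points into a
          compact set. At a fixed entry \<open>i\<close> the cut has no effect once
          \<open>k > i\<close>, so along the convergent subsequence the original points have the
          same limit, and this limit lies in the closed set \<open>H\<close>.\<close>
        define w where "w = (\<lambda>k. (fst (z k), \<lambda>i. min (snd (z k) i) (f i)))"
        have "w k \<in> {lo..hi} \<times> Y" for k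
        proof -
          have "fst (z k) \<in> {lo..hi}" using z(1)[of k] H A by blast
          then show ?thesis by (simp add: w_def Y_def PiE_UNIV_domain)
        qed
        moreover have "seq_compact ({lo..hi} \<times> Y)"
          by (intro compact_imp_seq_compact compact_Times Y compact_Icc)
        ultimately obtain p r where p: "p \<in> {lo..hi} \<times> Y" "strict_mono r" "(w \<circ> r) \<longlonglongrightarrow> p"
          unfolding seq_compact_def by metis
        have lim1: "(\<lambda>k. fst (z (r k))) \<longlonglongrightarrow> fst p"
          using tendsto_fst[OF p(3)] by (simp add: w_def)
        have "(\<lambda>k. snd (z (r k))) \<longlonglongrightarrow> snd p"
        proof -
          have "limitin (product_topology (\<lambda>i. euclidean) UNIV) (\<lambda>k i. min (snd (z (r k)) i) (f i)) (snd p) sequentially"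
            using tendsto_snd[OF p(3)] unfolding euclidean_product_topology by (simp add: w_def)
          then have lim: "(\<lambda>k. min (snd (z (r k)) i) (f i)) \<longlonglongrightarrow> snd p i" for i
            by (simp add: limitin_componentwise)
          have "(\<lambda>k. snd (z (r k)) i) \<longlonglongrightarrow> snd p i" for i
          proof (rule Lim_transform_eventually[OF lim])
            have "\<forall>\<^sub>F k in sequentially. i < k" by (rule eventually_gt_at_top)
            then show "\<forall>\<^sub>F k in sequentially. min (snd (z (r k)) i) (f i) = snd (z (r k)) i"
            proof eventually_elim
              case (elim k)
              then have "i < r k" using seq_suble[OF p(2), of k] by simp
              then show ?case using z(2)[of i "r k"] by simp
            qed
          qed
          then have
            "limitin (product_topology (\<lambda>i. euclidean) UNIV) (\<lambda>k. snd (z (r k))) (snd p) sequentially"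
            by (simp add: limitin_componentwise)
          then show ?thesis unfolding euclidean_product_topology by simp
        qed
        then have "(\<lambda>k. z (r k)) \<longlonglongrightarrow> p"
          using tendsto_Pair[OF lim1, of "\<lambda>k. snd (z (r k))" "snd p"] by simp
        then have "p \<in> H" using closed_sequentially[OF H(1), of "\<lambda>k. z (r k)" p] z(1) by simp
        then have "fst p \<in> K" unfolding K_def using p(1) by (intro imageI IntI)
        then have "fst p \<in> V" using Q V(2) by blast
        then have "\<forall>\<^sub>F k in sequentially. fst (z (r k)) \<in> V" using lim1 V(1)
          by (auto simp: tendsto_def)
        then show False using z(3) by simp
      qed
      then obtain k where "B f k \<subseteq> V" ..
      then have "e \<le> net_content s V" using ef[of k] net_content_mono[of _ V s]
        by (meson less_imp_le order_trans)
      then show "e \<le> emeasure (code_measure s) Q + ennreal d" using V(3) by (rule order_trans)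
    qed
  qed
  ultimately show ?thesis using K e(1) by (metis order.strict_trans2)
qed

subsection \<open>Frostman's lemma\<close>

lemma dyadic_interval_split:
  "dyadic_interval (k, i) = dyadic_interval (Suc k, 2 * i) \<union> dyadic_interval (Suc k, 2 * i + 1)"
proof -
  have "\<lfloor>x * 2 ^ k\<rfloor> = i \<longleftrightarrow> \<lfloor>x * 2 ^ Suc k\<rfloor> = 2 * i \<or> \<lfloor>x * 2 ^ Suc k\<rfloor> = 2 * i + 1" for x :: real
  proof -
    have "\<lfloor>x * 2 ^ k\<rfloor> = \<lfloor>x * 2 ^ Suc k\<rfloor> div 2" using floor_dyadic_div[of x k 1] by simp
    moreover have "a div 2 = i \<longleftrightarrow> a = 2 * i \<or> a = 2 * i + 1" for a :: int by presburger
    ultimately show ?thesis by (simp del: power_Suc)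
  qed
  then show ?thesis unfolding dyadic_interval_def dyadic_code_def by (auto simp del: power_Suc)
qed

text \<open>If both halves of an interval have content \<open>0\<close>, then so has the interval and its mass is \<open>0\<close>;
  hence the division by \<open>0\<close> does no harm.\<close>

fun split_mass :: "real \<Rightarrow> real set \<Rightarrow> nat \<Rightarrow> int \<Rightarrow> real" where
  "split_mass s K 0 i = enn2real (net_content s (K \<inter> dyadic_interval (0, i)))"
| "split_mass s K (Suc k) i = split_mass s K k (i div 2) *
     enn2real (net_content s (K \<inter> dyadic_interval (Suc k, i))) /
     (enn2real (net_content s (K \<inter> dyadic_interval (Suc k, 2 * (i div 2)))) +
      enn2real (net_content s (K \<inter> dyadic_interval (Suc k, 2 * (i div 2) + 1))))"

lemma enn2real_net_content_dyadic_interval: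
  "enn2real (net_content s (A \<inter> dyadic_interval (k, i))) \<le> 2 powr (- s * real k)"
  using net_content_dyadic_interval[of s A "(k, i)"] by (intro enn2real_leI) auto

lemma enn2real_net_content_split:
  "enn2real (net_content s (K \<inter> dyadic_interval (k, i)))
    \<le> enn2real (net_content s (K \<inter> dyadic_interval (Suc k, 2 * i)))
      + enn2real (net_content s (K \<inter> dyadic_interval (Suc k, 2 * i + 1)))"
proof -
  have fin: "net_content s (K \<inter> dyadic_interval q) < top" for q
    using net_content_dyadic_interval[of s K q] by (rule le_less_trans) simp
  have "net_content s (K \<inter> dyadic_interval (k, i))
    \<le> net_content s (K \<inter> dyadic_interval (Suc k, 2 * i)) + net_content s (K \<inter> dyadic_interval (Suc k, 2 * i + 1))"
    unfolding dyadic_interval_split[of k i] Int_Un_distrib by (rule net_content_Un)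
  then have "enn2real (net_content s (K \<inter> dyadic_interval (k, i)))
    \<le> enn2real (net_content s (K \<inter> dyadic_interval (Suc k, 2 * i)) + net_content s (K \<inter> dyadic_interval (Suc k, 2 * i + 1)))"
    using fin by (intro enn2real_mono) auto
  then show ?thesis using fin by (simp add: enn2real_plus)
qed

text \<open>The content of an interval is at most the sum \<open>?D\<close> of the contents of its
  halves, and by induction so is its mass. Each half receives its own content times the ratio of the
  mass to \<open>?D\<close>, a factor of at most 1.\<close>

lemma split_mass_bounds:
  "0 \<le> split_mass s K k i \<and> split_mass s K k i \<le> enn2real (net_content s (K
  \<inter> dyadic_interval (k, i)))"
proof (induction k arbitrary: i)
  case (Suc k)
  let ?c = "\<lambda>q. enn2real (net_content s (K \<inter> dyadic_interval q))"
  let ?j = "i div 2"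
  let ?D = "?c (Suc k, 2 * ?j) + ?c (Suc k, 2 * ?j + 1)"
  have "split_mass s K k ?j \<le> ?D"
    using Suc[of ?j] enn2real_net_content_split[of s K k ?j] by linarith
  then have "split_mass s K k ?j * ?c (Suc k, i) / ?D \<le> ?c (Suc k, i)"
  proof (cases "?D = 0")
    case False
    moreover have "0 \<le> ?D" by simp
    ultimately have "0 < ?D" by linarith
    moreover have "split_mass s K k ?j * ?c (Suc k, i) \<le> ?D * ?c (Suc k, i)"
      using \<open>split_mass s K k ?j \<le> ?D\<close> by (rule mult_right_mono) simp
    ultimately show ?thesis unfolding pos_divide_le_eq[OF \<open>0 < ?D\<close>] by (simp only: mult.commute)
  qed simp
  moreover have "0 \<le> split_mass s K k ?j * ?c (Suc k, i) / ?D"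
    using Suc[of ?j] by (intro divide_nonneg_nonneg mult_nonneg_nonneg add_nonneg_nonneg) auto
  ultimately show ?case by simp
qed simp

lemma split_mass_split:
  "split_mass s K (Suc k) (2 * i) + split_mass s K (Suc k) (2 * i + 1) = split_mass s K k i"
proof -
  let ?c = "\<lambda>q. enn2real (net_content s (K \<inter> dyadic_interval q))"
  let ?D = "?c (Suc k, 2 * i) + ?c (Suc k, 2 * i + 1)"
  have 1: "split_mass s K k i \<le> ?D" "0 \<le> split_mass s K k i"
    using split_mass_bounds[of s K k i] enn2real_net_content_split[of s K k i] by linarith+
  have "split_mass s K (Suc k) (2 * i) + split_mass s K (Suc k) (2 * i + 1)
    = split_mass s K k i * ?D / ?D"
    by (simp add: add_divide_distrib distrib_left)
  also have "\<dots> = split_mass s K k i" using 1 by (cases "?D = 0") auto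
  finally show ?thesis .
qed

text \<open>The mass of [j, n / 2^k), that is, the distribution function at the dyadic point n /
  2^k. By \<open>mass_below_double\<close> the value does not depend on the level at which that
  point is written.\<close>

definition mass_below :: "real \<Rightarrow> real set \<Rightarrow> int \<Rightarrow> nat \<Rightarrow> int \<Rightarrow> real" where
  "mass_below s K j k n = (\<Sum>i \<in> {j * 2 ^ k..<n}. split_mass s K k i)"

lemma mass_below_mono: "m \<le> n \<Longrightarrow> mass_below s K j k m \<le> mass_below s K j k n"
  unfolding mass_below_def using split_mass_bounds by (intro sum_mono2) auto

lemma mass_below_succ:
  "mass_below s K j k (n + 1) = mass_below s K j k n + (if j * 2 ^ k
  \<le> n then split_mass s K k n else 0)"
proof (cases "j * 2 ^ k \<le> n")
  case True
  then have "{j * 2 ^ k..<n + 1} = insert n {j * 2 ^ k..<n}" by auto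
  then show ?thesis using True by (simp add: mass_below_def)
next
  case False
  then show ?thesis by (simp add: mass_below_def)
qed

lemma mass_below_double: "mass_below s K j (Suc k) (2 * n) = mass_below s K j k n"
proof (cases "j * 2 ^ k \<le> n")
  case True
  then show ?thesis
  proof (induction n rule: int_ge_induct)
    case base
    then show ?case by (simp add: mass_below_def)
  next
    case (step n)
    have "mass_below s K j (Suc k) (2 * (n + 1)) = mass_below s K j (Suc k) (2 * n + 1 + 1)"
      by (simp add: algebra_simps)
    also have "\<dots> = mass_below s K j (Suc k) (2 * n)
        + (split_mass s K (Suc k) (2 * n) + split_mass s K (Suc k) (2 * n + 1))"
      using step.hyps unfolding mass_below_succ by (simp del: split_mass.simps)
    also have "\<dots> = mass_below s K j k (n + 1)"
      unfolding split_mass_split using step by (simp add: mass_below_succ)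
    finally show ?case .
  qed
qed (simp add: mass_below_def)

lemma mass_below_scale: "mass_below s K j (k + l) (n * 2 ^ l) = mass_below s K j k n"
proof (induction l)
  case (Suc l)
  have "mass_below s K j (k + Suc l) (n * 2 ^ Suc l) = mass_below s K j (Suc (k + l)) (2 * (n
    * 2 ^ l))"
    by (simp add: mult_ac)
  then show ?case using Suc by (simp only: mass_below_double)
qed simp

text \<open>Rounding down at one level never gives more than rounding up at another: both values are
  moved to the finer level and compared there. Hence the supremum in \<open>mass_cdf\<close> is over
  a bounded set.\<close>

lemma mass_below_floor_le:
  "mass_below s K j l \<lfloor>x * 2 ^ l\<rfloor> \<le> mass_below s K j k (\<lfloor>x * 2 ^ k\<rfloor> + 1)" for x :: real
proof (cases "l \<le> k")
  case True
  then obtain n where k: "k = l + n" by (auto simp: le_iff_add)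
  have "mass_below s K j l \<lfloor>x * 2 ^ l\<rfloor> = mass_below s K j k (\<lfloor>x * 2 ^ l\<rfloor> * 2 ^ n)"
    unfolding k by (simp add: mass_below_scale)
  also have "\<dots> \<le> mass_below s K j k (\<lfloor>x * 2 ^ k\<rfloor> + 1)"
  proof (rule mass_below_mono)
    have "\<lfloor>x * 2 ^ l\<rfloor> * 2 ^ n \<le> \<lfloor>x * 2 ^ k\<rfloor>"
      unfolding floor_dyadic_div[of x l n] k
      using div_mult_mod_eq[of "\<lfloor>x * 2 ^ (l + n)\<rfloor>" "2 ^ n"]
        pos_mod_sign[of "2 ^ n" "\<lfloor>x * 2 ^ (l + n)\<rfloor>", OF zero_less_power[OF zero_less_numeral]]
      by linarith
    then show "\<lfloor>x * 2 ^ l\<rfloor> * 2 ^ n \<le> \<lfloor>x * 2 ^ k\<rfloor> + 1" by simp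
  qed
  finally show ?thesis .
next
  case False
  then obtain n where l: "l = k + n" by (metis le_iff_add nle_le)
  have "x * 2 ^ k < real_of_int (\<lfloor>x * 2 ^ k\<rfloor> + 1)" by linarith
  then have "x * 2 ^ l < real_of_int ((\<lfloor>x * 2 ^ k\<rfloor> + 1) * 2 ^ n)"
    by (simp add: l power_add)
  then have "\<lfloor>x * 2 ^ l\<rfloor> \<le> (\<lfloor>x * 2 ^ k\<rfloor> + 1) * 2 ^ n" by linarith
  then have "mass_below s K j l \<lfloor>x * 2 ^ l\<rfloor> \<le> mass_below s K j l ((\<lfloor>x * 2 ^ k\<rfloor> + 1) * 2 ^ n)"
    by (rule mass_below_mono)
  then show ?thesis by (simp add: l mass_below_scale)
qed

definition mass_cdf :: "real \<Rightarrow> real set \<Rightarrow> int \<Rightarrow> real \<Rightarrow> real" where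
  "mass_cdf s K j x = (SUP k. mass_below s K j k \<lfloor>x * 2 ^ k\<rfloor>)"

lemma mass_cdf_upper: "mass_cdf s K j x \<le> mass_below s K j k (\<lfloor>x * 2 ^ k\<rfloor> + 1)"
  unfolding mass_cdf_def using mass_below_floor_le by (intro cSUP_least) auto

lemma mass_cdf_lower: "mass_below s K j k \<lfloor>x * 2 ^ k\<rfloor> \<le> mass_cdf s K j x"
  unfolding mass_cdf_def
  by (rule cSUP_upper) (auto intro!: bdd_aboveI2 mass_below_floor_le[where k = 0])

lemma mass_cdf_nonneg: "0 \<le> mass_cdf s K j x"
  using mass_cdf_lower[of s K j 0 x] unfolding mass_below_def
  by (rule order_trans[rotated])
    (use split_mass_bounds in \<open>auto intro!: sum_nonneg simp del: split_mass.simps\<close>)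

lemma mass_cdf_mono: "x \<le> y \<Longrightarrow> mass_cdf s K j x \<le> mass_cdf s K j y"
  unfolding mass_cdf_def[of s K j x]
  by (intro cSUP_least order_trans[OF mass_below_mono mass_cdf_lower] floor_mono) auto

text \<open>At levels finer than \<open>k\<close> the point is still dyadic and the value does not
  change; at coarser levels the floor can only lose mass.\<close>

lemma mass_cdf_dyadic: "mass_cdf s K j (real_of_int n / 2 ^ k) = mass_below s K j k n"
proof (rule antisym)
  show "mass_below s K j k n \<le> mass_cdf s K j (real_of_int n / 2 ^ k)"
    using mass_cdf_lower[of s K j k "real_of_int n / 2 ^ k"] by simp
  show "mass_cdf s K j (real_of_int n / 2 ^ k) \<le> mass_below s K j k n"
    unfolding mass_cdf_def
  proof (rule cSUP_least)
    fix l
    let ?x = "real_of_int n / 2 ^ k"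
    have le: "mass_below s K j (k + i) \<lfloor>?x * 2 ^ (k + i)\<rfloor> \<le> mass_below s K j k n" for i
    proof -
      have "?x * 2 ^ (k + i) = real_of_int (n * 2 ^ i)" by (simp add: power_add)
      then show ?thesis by (simp only: floor_of_int mass_below_scale)
    qed
    show "mass_below s K j l \<lfloor>?x * 2 ^ l\<rfloor> \<le> mass_below s K j k n"
    proof (cases "l \<le> k")
      case True
      then obtain i where k: "k = l + i" by (auto simp: le_iff_add)
      have "mass_below s K j l \<lfloor>?x * 2 ^ l\<rfloor> = mass_below s K j k (\<lfloor>?x * 2 ^ l\<rfloor> * 2 ^ i)"
        unfolding k by (simp only: mass_below_scale)
      also have "\<lfloor>?x * 2 ^ l\<rfloor> * 2 ^ i \<le> n"
      proof -
        have "real_of_int \<lfloor>?x * 2 ^ l\<rfloor> * 2 ^ i \<le> (?x * 2 ^ l) * 2 ^ i"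
          by (intro mult_right_mono) auto
        also have "\<dots> = n" by (simp add: k power_add)
        finally have "real_of_int (\<lfloor>?x * 2 ^ l\<rfloor> * 2 ^ i) \<le> n" by simp
        then show ?thesis by (simp only: of_int_le_iff)
      qed
      then have "mass_below s K j k (\<lfloor>?x * 2 ^ l\<rfloor> * 2 ^ i) \<le> mass_below s K j k n"
        by (rule mass_below_mono)
      finally show ?thesis .
    next
      case False
      then show ?thesis using le[of "l - k"] by simp
    qed
  qed auto
qed

lemma mass_cdf_zero: "x \<le> real_of_int j \<Longrightarrow> mass_cdf s K j x = 0"
proof (rule antisym)
  assume x: "x \<le> real_of_int j"
  have 0: "mass_cdf s K j (real_of_int j) = 0"
    using mass_cdf_dyadic[of s K j j 0] by (simp add: mass_below_def)
  show "mass_cdf s K j x \<le> 0" using mass_cdf_mono[OF x, of s K j] 0 by simp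
  show "0 \<le> mass_cdf s K j x" by (rule mass_cdf_nonneg)
qed

text \<open>If 2^-k lies between y - x and 2 (y - x), the two points are in the same or in adjacent
  dyadic intervals of level \<open>k\<close>, each of mass at most
  \<open>2 powr (- s * real k)\<close>. The two masses and the factor 2 in the choice of
  \<open>k\<close> make up the constant \<open>2 * 2 powr s\<close>. At distance 1 or more the total
  mass, which is at most 1, is bound enough.\<close>

lemma mass_cdf_Holder:
  assumes s: "0 \<le> s" and K: "K \<subseteq> dyadic_interval (0, j)" and xy: "x \<le> y"
  shows "mass_cdf s K j y - mass_cdf s K j x \<le> 2 * 2 powr s * (y - x) powr s"
proof (cases "x = y")
  case False
  then have d: "0 < y - x" using xy by simp
  show ?thesis
  proof (cases "1 \<le> y - x")
    case True
    have "mass_below s K j 0 n \<le> 1" for n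
    proof -
      have "split_mass s K 0 i = 0" if "i \<noteq> j" for i
      proof -
        have "K \<inter> dyadic_interval (0, i) = {}"
          using K that by (auto simp: dyadic_interval_def dyadic_code_def)
        then show ?thesis by simp
      qed
      then have "mass_below s K j 0 n = (\<Sum>i\<in>{j..<n}. if i = j then split_mass s K 0 j else 0)"
        unfolding mass_below_def by (intro sum.cong) auto
      also have "\<dots> \<le> split_mass s K 0 j" using split_mass_bounds[of s K 0 j] by simp
      also have "\<dots> \<le> 1"
        using split_mass_bounds[of s K 0 j] enn2real_net_content_dyadic_interval[of s K 0 j] by simp
      finally show ?thesis .
    qed
    then have "mass_cdf s K j y \<le> 1" using mass_cdf_upper[of s K j y 0] by (meson order_trans)
    moreover note mass_cdf_nonneg[of s K j x]
    moreover have "1 * 1 * 1 \<le> 2 * 2 powr s * (y - x) powr s"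
      using True s by (intro mult_mono ge_one_powr_ge_zero) auto
    ultimately show ?thesis by linarith
  next
    case False
    define k where "k = nat \<lfloor>- log 2 (y - x)\<rfloor>"
    have pos: "0 \<le> - log 2 (y - x)" using False d by simp
    have k: "real k \<le> - log 2 (y - x)" "- log 2 (y - x) < real k + 1"
      unfolding k_def using pos by (simp_all add: of_nat_nat)
    have 1: "y - x \<le> 2 powr (- real k)"
    proof -
      have "2 powr (log 2 (y - x)) \<le> 2 powr (- real k)" using k by (intro powr_mono) auto
      then show ?thesis using d by simp
    qed
    have 2: "2 powr (- real k) \<le> 2 * (y - x)"
    proof -
      have "2 powr (- real k) \<le> 2 powr (1 + log 2 (y - x))" using k by (intro powr_mono) auto
      then show ?thesis using d by (simp add: powr_add)
    qed
    have "(y - x) * 2 ^ k \<le> 2 powr (- real k) * 2 ^ k" using 1 by (intro mult_right_mono) auto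
    also have "\<dots> = 1" by (simp add: powr_minus powr_realpow)
    finally have "y * 2 ^ k \<le> x * 2 ^ k + 1" by (simp add: algebra_simps)
    then have "\<lfloor>y * 2 ^ k\<rfloor> \<le> \<lfloor>x * 2 ^ k\<rfloor> + 1" by linarith
    then have "mass_cdf s K j y \<le> mass_below s K j k (\<lfloor>x * 2 ^ k\<rfloor> + 1 + 1)"
      by (intro order_trans[OF mass_cdf_upper[of s K j y k]] mass_below_mono) simp
    also have "\<dots> \<le> mass_below s K j k \<lfloor>x * 2 ^ k\<rfloor> + 2 powr (- s * real k) + 2 powr (- s * real k)"
    proof -
      have "split_mass s K k i \<le> 2 powr (- s * real k)" for i
        using split_mass_bounds[of s K k i] enn2real_net_content_dyadic_interval[of s K k i]
          by linarith
      moreover have "(0::real) \<le> 2 powr (- s * real k)" by simp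
      ultimately show ?thesis unfolding mass_below_succ
        by (intro add_mono) (auto simp del: powr_ge_zero)
    qed
    also have "\<dots> \<le> mass_cdf s K j x + 2 powr (- s * real k) + 2 powr (- s * real k)"
      by (intro add_right_mono mass_cdf_lower)
    finally have "mass_cdf s K j y - mass_cdf s K j x \<le> 2 * (2 powr (- real k)) powr s"
      by (simp add: powr_powr mult.commute)
    also have "\<dots> \<le> 2 * (2 * (y - x)) powr s" using 2 s by (intro mult_left_mono powr_mono2) auto
    also have "(2 * (y - x)) powr s = 2 powr s * (y - x) powr s" by (rule powr_mult)
    also have "2 * (2 powr s * (y - x) powr s) = 2 * 2 powr s * (y - x) powr s" by simp
    finally show ?thesis .
  qed
qed simp

lemma Holder_continuous:
  fixes f :: "real \<Rightarrow> real"
  assumes s: "0 < s" and mono: "\<And>x y. x \<le> y \<Longrightarrow> f x \<le> f y"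
    and H: "\<And>x y. x \<le> y \<Longrightarrow> f y - f x \<le> C * (y - x) powr s"
  shows "continuous_on UNIV f"
proof -
  have "isCont f x" for x
  proof -
    have b: "\<bar>f y - f x\<bar> \<le> C * \<bar>y - x\<bar> powr s" for y
      using H[of x y] H[of y x] mono[of x y] mono[of y x] by (cases "x \<le> y") (auto simp: abs_if)
    have "((\<lambda>y. C * \<bar>y - x\<bar> powr s) \<longlongrightarrow> C * 0 powr s) (at x)"
      using s by (intro tendsto_intros tendsto_powr') (auto intro!: tendsto_eq_intros)
    then have "((\<lambda>y. C * \<bar>y - x\<bar> powr s) \<longlongrightarrow> 0) (at x)" by simp
    then have "((\<lambda>y. f y - f x) \<longlongrightarrow> 0) (at x)"
      by (rule Lim_null_comparison[rotated]) (use b in auto)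
    then show ?thesis by (simp add: isCont_def LIM_zero_iff)
  qed
  then show ?thesis by (simp add: continuous_on_eq_continuous_at)
qed

text \<open>The measure has distribution function \<open>mass_cdf\<close>, whose continuity lets
  closed intervals be measured by differences. A dyadic interval that misses \<open>K\<close> meets
  it in a set of content 0 and so has mass 0, which puts the whole measure on
  \<open>K\<close>.\<close>

lemma frostman_compact:
  assumes s: "0 < s" and K: "compact K" "K \<subseteq> dyadic_interval (0, j)" and pos: "net_content s K > 0"
  obtains \<mu> C where "finite_measure \<mu>" "sets \<mu> = sets borel" "0 < measure \<mu> K" "0 < C"
    "\<And>a b. a \<le> b \<Longrightarrow> measure \<mu> {a..b} \<le> C * (b - a) powr s"
proof -
  define \<Phi> where "\<Phi> = mass_cdf s K j"
  have mono: "x \<le> y \<Longrightarrow> \<Phi> x \<le> \<Phi> y" for x y unfolding \<Phi>_def by (rule mass_cdf_mono)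
  have H: "x \<le> y \<Longrightarrow> \<Phi> y - \<Phi> x \<le> 2 * 2 powr s * (y - x) powr s" for x y
    unfolding \<Phi>_def using s K by (intro mass_cdf_Holder) auto
  have cont: "continuous_on UNIV \<Phi>" by (rule Holder_continuous[OF s mono H])
  define \<mu> where "\<mu> = interval_measure \<Phi>"
  have sets: "sets \<mu> = sets borel" by (simp add: \<mu>_def)
  have em: "emeasure \<mu> {a..b} = ennreal (\<Phi> b - \<Phi> a)" if "a \<le> b" for a b
    unfolding \<mu>_def using that mono cont by (rule emeasure_interval_measure_Icc)
  have null: "emeasure \<mu> (- K) = 0"
  proof -
    \<comment> \<open>Indexing the null intervals by codes leaves only countably many null sets to
      unite.\<close>
    define N where
      "N = {q :: nat \<times> int. emeasure \<mu> {(snd q - 1) / 2 ^ fst q..(snd q + 1) / 2 ^ fst q} = 0}"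
    have "- K \<subseteq> (\<Union>q\<in>N. {(snd q - 1) / 2 ^ fst q..(snd q + 1) / 2 ^ fst q})"
    proof
      fix x assume "x \<in> - K"
      moreover have "open (- K)" using K compact_imp_closed by blast
      ultimately obtain e where e: "0 < e" "ball x e \<subseteq> - K" using open_contains_ball by blast
      obtain k where k: "(1 / 2) ^ k < e / 2" using real_arch_pow_inv[of "e / 2" "1 / 2"] e by auto
      define i where "i = \<lfloor>x * 2 ^ k\<rfloor>"
      have i: "real_of_int i \<le> x * 2 ^ k" "x * 2 ^ k < real_of_int i + 1" unfolding i_def
        by linarith+
      have near: "y \<in> ball x e" if "\<bar>y * 2 ^ k - x * 2 ^ k\<bar> < 2" for y
      proof -
        have "\<bar>y - x\<bar> * 2 ^ k < 2" using that by (simp add: abs_mult flip: left_diff_distrib)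
        then have "\<bar>y - x\<bar> < 2 * (1 / 2) ^ k" by (simp add: field_simps)
        also have "\<dots> < e" using k by simp
        finally show ?thesis by (simp add: dist_real_def abs_minus_commute)
      qed
      have "dyadic_interval (k, l) \<inter> K = {}" if l: "l = i - 1 \<or> l = i" for l
      proof -
        have "y \<in> ball x e" if "y \<in> dyadic_interval (k, l)" for y
        proof (rule near)
          have "\<lfloor>y * 2 ^ k\<rfloor> = l" using that by (simp add: dyadic_interval_def dyadic_code_def)
          then have "real_of_int l \<le> y * 2 ^ k" "y * 2 ^ k < real_of_int l + 1" by linarith+
          then show "\<bar>y * 2 ^ k - x * 2 ^ k\<bar> < 2" using i l by (auto simp: abs_less_iff)
        qed
        then show ?thesis using e(2) by blast
      qed
      then have z: "split_mass s K k l = 0" if "l = i - 1 \<or> l = i" for l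
        using split_mass_bounds[of s K k l] that by (simp add: Int_commute)
      have "mass_below s K j k (i + 1) = mass_below s K j k (i - 1)"
        using mass_below_succ[of s K j k i] mass_below_succ[of s K j k "i - 1"] z by simp
      moreover have "\<Phi> ((i + 1) / 2 ^ k) = mass_below s K j k (i + 1)"
        "\<Phi> ((i - 1) / 2 ^ k) = mass_below s K j k (i - 1)"
        unfolding \<Phi>_def
          using mass_cdf_dyadic[of s K j "i + 1" k] mass_cdf_dyadic[of s K j "i - 1" k] by simp_all
      ultimately have "emeasure \<mu> {(i - 1) / 2 ^ k..(i + 1) / 2 ^ k} = 0"
        by (subst em) (auto simp: divide_right_mono)
      then have "(k, i) \<in> N" by (simp add: N_def)
      moreover have "x \<in> {(i - 1) / 2 ^ k..(i + 1) / 2 ^ k}" using i by (auto simp: field_simps)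
      ultimately show "x \<in> (\<Union>q\<in>N. {(snd q - 1) / 2 ^ fst q..(snd q + 1) / 2 ^ fst q})" by force
    qed
    moreover have "(\<Union>q\<in>N. {(snd q - 1) / 2 ^ fst q..(snd q + 1) / 2 ^ fst q}) \<in> null_sets \<mu>"
      by (intro null_sets_UN' countableI_type) (auto simp: N_def null_sets_def sets)
    note S = this
    ultimately show ?thesis
      using emeasure_mono[OF _ null_setsD2[OF S], of "- K"] null_setsD1[OF S] by simp
  qed
  have Kb: "K \<in> sets borel" using K by (simp add: borel_compact)
  have total: "emeasure \<mu> {j - 1..j + 1} = split_mass s K 0 j"
  proof -
    have "\<Phi> (j - 1) = 0" unfolding \<Phi>_def by (rule mass_cdf_zero) simp
    moreover have "\<Phi> (j + 1) = split_mass s K 0 j"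
      using mass_cdf_dyadic[of s K j "j + 1" 0] mass_below_succ[of s K j 0 j]
      by (simp add: \<Phi>_def mass_below_def del: split_mass.simps)
    ultimately show ?thesis by (subst em) (auto simp del: split_mass.simps)
  qed
  have Ksub: "K \<subseteq> {j - 1..j + 1}"
  proof
    fix x assume "x \<in> K"
    then have "\<lfloor>x\<rfloor> = j" using K by (auto simp: dyadic_interval_def dyadic_code_def)
    then show "x \<in> {j - 1..j + 1}" by (simp, linarith)
  qed
  have split: "emeasure \<mu> A = emeasure \<mu> (A \<inter> K)" if "A \<in> sets borel" for A
  proof -
    have "emeasure \<mu> A \<le> emeasure \<mu> (A \<inter> K) + emeasure \<mu> (- K)"
      using that Kb by (intro order_trans[OF emeasure_mono emeasure_subadditive]) (auto simp: sets)
    moreover have "emeasure \<mu> (A \<inter> K) \<le> emeasure \<mu> A"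
      using that by (intro emeasure_mono) (auto simp: sets)
    ultimately show ?thesis using null by (intro antisym) auto
  qed
  have EK: "emeasure \<mu> K = ennreal (split_mass s K 0 j)"
    using split[of "{j - 1..j + 1}"] total Ksub by (simp add: Int_absorb1 del: split_mass.simps)
  have fin: "finite_measure \<mu>"
  proof
    have "emeasure \<mu> (space \<mu>) = emeasure \<mu> K" using split[of UNIV] by (simp add: \<mu>_def)
    then show "emeasure \<mu> (space \<mu>) \<noteq> \<infinity>" using EK by (simp del: split_mass.simps)
  qed
  have "0 < split_mass s K 0 j"
  proof -
    have "K \<inter> dyadic_interval (0, j) = K" using K by blast
    moreover have "net_content s (K \<inter> dyadic_interval (0, j)) < top"
      using net_content_dyadic_interval[of s K "(0, j)"] by (rule le_less_trans) simp
    ultimately show ?thesis using pos by (simp add: enn2real_positive_iff)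
  qed
  then have "0 < measure \<mu> K" using EK by (simp add: measure_def del: split_mass.simps)
  moreover have "measure \<mu> {a..b} \<le> 2 * 2 powr s * (b - a) powr s" if "a \<le> b" for a b
    using em[OF that] H[OF that] mono[OF that] by (simp add: measure_def)
  ultimately show thesis using that[OF fin sets, of "2 * 2 powr s"] by simp
qed

text \<open>Cutting the interval into n equal parts bounds its mass by a multiple of n powr (1 - s),
  which tends to 0 if s > 1. The Fourier dimension admits only exponents up to 1, so the target
  exponent has to be kept in this range.\<close>

lemma exponent_le_one:
  assumes \<mu>: "finite_measure \<mu>" "sets \<mu> = sets borel" and pos: "0 < measure \<mu> {a..b}"
    and C: "\<And>a b. a \<le> b \<Longrightarrow> measure \<mu> {a..b} \<le> C * (b - a) powr s"
  shows "s \<le> 1"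
proof (rule ccontr)
  assume "\<not> s \<le> 1"
  then have s: "s > 1" by simp
  interpret finite_measure \<mu> by (rule \<mu>)
  have ab: "a \<le> b" using pos by (cases "a \<le> b") auto
  have le: "measure \<mu> {a..a + real k * h} \<le> k * (C * h powr s)" if h: "0 \<le> h" for h k
  proof (induction k)
    case 0
    then show ?case using C[of a a] by simp
  next
    case (Suc k)
    have "measure \<mu> {a..a + real (Suc k) * h}
      \<le> measure \<mu> ({a..a + real k * h} \<union> {a + real k * h..a + real (Suc k) * h})"
      using h \<mu> by (intro finite_measure_mono) (auto simp: ivl_disj_un)
    also have "\<dots> \<le> measure \<mu> {a..a + real k * h} + measure \<mu> {a + real k * h..a + real (Suc k) * h}"
      using \<mu> by (intro measure_Un_le) auto
    also have "\<dots> \<le> k * (C * h powr s) + C * h powr s"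
      using Suc C[of "a + real k * h" "a + real (Suc k) * h"] h
        by (intro add_mono) (auto simp: algebra_simps)
    finally show ?case by (simp add: algebra_simps)
  qed
  have "measure \<mu> {a..b} \<le> C * (b - a) powr s * real (Suc n) powr (1 - s)" for n
  proof -
    have "measure \<mu> {a..b} \<le> real (Suc n) * (C * ((b - a) / real (Suc n)) powr s)"
      using le[of "(b - a) / real (Suc n)" "Suc n"] ab by simp
    also have "\<dots> = C * (b - a) powr s * real (Suc n) powr (1 - s)"
      using ab by (simp add: powr_divide powr_diff)
    finally show ?thesis .
  qed
  moreover have "(\<lambda>n. C * (b - a) powr s * real (Suc n) powr (1 - s)) \<longlonglongrightarrow> C * (b - a) powr s * 0"
    using s by (intro tendsto_intros tendsto_neg_powr filterlim_compose[OF filterlim_real_sequentially filterlim_Suc]) auto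
  ultimately have "measure \<mu> {a..b} \<le> 0"
    by (intro LIMSEQ_le_const) auto
  then show False using pos by simp
qed

text \<open>A cover that costs less than \<open>2 powr (- s * real k0)\<close> contains only
  intervals of levels beyond \<open>k0\<close>. Cheap covers are thus automatically fine, and the
  bound on diameters in \<open>hausdorff_premeasure\<close> is met.\<close>

lemma hausdorff_measure_eq_0:
  fixes F :: "real set"
  assumes s: "0 < s" and F: "net_content s F = 0"
  shows "hausdorff_measure s F = 0"
proof -
  have pre: "hausdorff_premeasure s e F \<le> 0 + ennreal d" if e: "0 < e" and d: "0 < d" for e d
  proof -
    have "\<forall>\<^sub>F k in sequentially. (1 / 2) ^ k < e"
      using e by (intro order_tendstoD(2)[OF LIMSEQ_power_zero]) auto
    then obtain k0 where k0: "\<And>k. k0 \<le> k \<Longrightarrow> (1 / 2) ^ k < e" by (auto simp: eventually_sequentially)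
    define d' where "d' = min d (2 powr (- s * real k0))"
    have "0 < d'" using d by (simp add: d'_def)
    then obtain Q where Q: "F \<subseteq> dyadic_cover Q" "emeasure (code_measure s) Q < ennreal d'"
      using net_content_exists_cover[of s F "ennreal d'"] F by auto
    have small: "k0 \<le> fst q" if "q \<in> Q" for q
    proof -
      have "emeasure (code_measure s) {q} \<le> emeasure (code_measure s) Q"
        using that by (intro emeasure_mono) auto
      then have "ennreal (2 powr (- s * real (fst q))) < ennreal d'"
        using Q(2) unfolding emeasure_code_measure_singleton by (rule le_less_trans)
      then have "2 powr (- s * real (fst q)) < 2 powr (- s * real k0)"
        by (simp add: d'_def ennreal_less_iff)
      then show ?thesis using s by simp
    qed
    \<comment> \<open>Covers in \<open>hausdorff_premeasure\<close> are sequences. All codes are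
      enumerated and those outside \<open>Q\<close> are replaced by the empty set, for which
      \<open>diam_pow\<close> is 0.\<close>
    obtain g :: "nat \<Rightarrow> nat \<times> int" where g: "bij g"
      using countableE_infinite[of "UNIV :: (nat \<times> int) set"]
      by (metis bij_betw_inv_into countableI_type finite_prod infinite_UNIV_int)
    define U where "U = (\<lambda>n. if g n \<in> Q then dyadic_interval (g n) else {})"
    have dist: "\<bar>x - y\<bar> \<le> (1 / 2) ^ fst q" if "x \<in> dyadic_interval q" "y \<in> dyadic_interval q"
      for x y q
    proof -
      have "\<lfloor>x * 2 ^ fst q\<rfloor> = \<lfloor>y * 2 ^ fst q\<rfloor>"
        using that by (metis dyadic_code_def dyadic_interval_iff snd_conv)
      then have "\<bar>x * 2 ^ fst q - y * 2 ^ fst q\<bar> \<le> 1" by linarith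
      then have "\<bar>x - y\<bar> * 2 ^ fst q \<le> 1" by (simp add: abs_mult flip: left_diff_distrib)
      then show ?thesis by (simp add: field_simps)
    qed
    have bdd: "bounded (U n)" for n
    proof (cases "U n = {}")
      case False
      then obtain x where "x \<in> U n" by blast
      then have "U n \<subseteq> cball x ((1 / 2) ^ fst (g n))"
        unfolding U_def using dist[of x "g n"] by (auto simp: dist_real_def split: if_splits)
      then show ?thesis by (rule bounded_subset[OF bounded_cball])
    qed simp
    have diam: "diameter (U n) \<le> (1 / 2) ^ fst (g n)" for n
    proof (rule diameter_le)
      show "norm (x - y) \<le> (1 / 2) ^ fst (g n)" if "x \<in> U n" "y \<in> U n" for x y
        using that dist[of x "g n" y] unfolding U_def by (simp split: if_splits)
    qed simp
    have diam_e: "diameter (U n) \<le> e" for n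
    proof (cases "g n \<in> Q")
      case True
      then show ?thesis using diam[of n] k0[OF small[OF True]] by linarith
    next
      case False
      then show ?thesis using e by (simp add: U_def)
    qed
    have cov: "F \<subseteq> (\<Union>n. U n)"
    proof
      fix x assume "x \<in> F"
      then obtain k where k: "dyadic_code x k \<in> Q" using Q(1) by (auto simp: dyadic_cover_def)
      obtain n where "g n = dyadic_code x k" using g by (metis bij_pointE)
      then show "x \<in> (\<Union>n. U n)" using k
        by (auto simp: U_def mem_dyadic_interval_code intro!: exI[of _ n])
    qed
    have "hausdorff_premeasure s e F \<le> (\<Sum>n. ennreal (diam_pow s (U n)))"
      unfolding hausdorff_premeasure_def using cov bdd diam_e by (intro INF_lower) auto
    also have "\<dots> \<le> (\<Sum>n. ennreal (2 powr (- s * real (fst (g n)))) * indicator Q (g n))"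
    proof (intro suminf_le summableI)
      fix n
      show "ennreal (diam_pow s (U n)) \<le> ennreal (2 powr (- s * real (fst (g n))))
        * indicator Q (g n)"
      proof (cases "g n \<in> Q")
        case True
        have "diameter (U n) powr s \<le> ((1 / 2) ^ fst (g n)) powr s"
          using diam[of n] diameter_ge_0[OF bdd[of n]] s by (intro powr_mono2) auto
        also have "((1 / 2 :: real) ^ fst (g n)) = 2 powr (- real (fst (g n)))"
          by (simp add: powr_minus powr_realpow power_one_over inverse_eq_divide)
        finally have "diameter (U n) powr s \<le> 2 powr (- s * real (fst (g n)))"
          by (simp add: powr_powr mult.commute)
        then show ?thesis using True s by (auto simp: diam_pow_def intro: ennreal_leI)
      next
        case False
        then show ?thesis by (simp add: U_def diam_pow_def)
      qed
    qed
    also have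
      "\<dots> = (\<integral>\<^sup>+ n. ennreal (2 powr (- s * real (fst (g n)))) * indicator Q (g n) \<partial>count_space UNIV)"
      by (rule nn_integral_count_space_nat[symmetric])
    also have "\<dots> = (\<integral>\<^sup>+ q. ennreal (2 powr (- s * real (fst q))) * indicator Q q \<partial>count_space UNIV)"
      by (rule nn_integral_bij_count_space[OF g])
    also have "\<dots> = emeasure (code_measure s) Q"
      by (simp add: code_measure_def emeasure_density)
    also have "\<dots> \<le> ennreal d"
      using Q(2) by (rule order_trans[OF less_imp_le]) (simp add: d'_def ennreal_leI)
    finally show ?thesis by simp
  qed
  have "hausdorff_premeasure s e F \<le> 0" if "0 < e" for e
    by (rule ennreal_le_epsilon) (rule pre[OF that])
  then have "hausdorff_measure s F \<le> 0"
    unfolding hausdorff_measure_def by (intro SUP_least) simp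
  then show ?thesis by simp
qed

text \<open>Some unit interval must meet \<open>F\<close> in positive content: otherwise finite
  subadditivity gives content 0 to each bounded part of \<open>F\<close>, and continuity along
  increasing sequences to \<open>F\<close> itself. Inside that interval a compact subset takes the
  place of the Borel set.\<close>

lemma frostman:
  fixes F :: "real set"
  assumes s: "0 < s" and F: "F \<in> sets borel" and pos: "hausdorff_measure s F > 0"
  obtains \<mu> C where "finite_measure \<mu>" "sets \<mu> = sets borel" "0 < measure \<mu> F" "0 < C"
    "\<And>a b. a \<le> b \<Longrightarrow> measure \<mu> {a..b} \<le> C * (b - a) powr s" "s \<le> 1"
proof -
  have posF: "net_content s F > 0"
    using pos hausdorff_measure_eq_0[OF s, of F] by (auto simp: zero_less_iff_neq_zero)
  have Dab: "dyadic_interval (0, j) = {real_of_int j..<real_of_int j + 1}" for j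
    by (auto simp: dyadic_interval_def dyadic_code_def floor_eq_iff)
  have "\<exists>j. net_content s (F \<inter> dyadic_interval (0, j)) > 0"
  proof (rule ccontr)
    assume "\<nexists>j. net_content s (F \<inter> dyadic_interval (0, j)) > 0"
    then have z: "net_content s (F \<inter> dyadic_interval (0, j)) = 0" for j
      by (auto simp: zero_less_iff_neq_zero)
    have fin: "net_content s (F \<inter> (\<Union>j\<in>J. dyadic_interval (0, j))) = 0" if "finite J" for J
      using that
    proof induction
      case (insert j J)
      have "F \<inter> (\<Union>j\<in>insert j J. dyadic_interval (0, j))
        = (F \<inter> dyadic_interval (0, j)) \<union> (F \<inter> (\<Union>j\<in>J. dyadic_interval (0, j)))" by blast
      then show ?case
        using net_content_Un[of s "F \<inter> dyadic_interval (0, j)" "F \<inter> (\<Union>j\<in>J. dyadic_interval (0, j))"]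
          z insert by simp
    qed simp
    have "F = (\<Union>n :: nat. F \<inter> (\<Union>j\<in>{- int n..int n}. dyadic_interval (0, j)))"
    proof safe
      fix x assume "x \<in> F"
      moreover have "x \<in> dyadic_interval (0, \<lfloor>x\<rfloor>)"
        by (simp add: dyadic_interval_def dyadic_code_def)
      moreover have "\<lfloor>x\<rfloor> \<in> {- int (nat \<bar>\<lfloor>x\<rfloor>\<bar>)..int (nat \<bar>\<lfloor>x\<rfloor>\<bar>)}"
        by (simp add: abs_le_iff del: of_nat_nat, linarith)
      ultimately show "x \<in> (\<Union>n :: nat. F \<inter> (\<Union>j\<in>{- int n..int n}. dyadic_interval (0, j)))" by blast
    qed
    moreover have "incseq (\<lambda>n. F \<inter> (\<Union>j\<in>{- int n..int n}. dyadic_interval (0, j)))"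
      by (intro incseq_SucI Int_mono UN_mono) auto
    ultimately have
      "net_content s F \<le> (SUP n. net_content s (F \<inter> (\<Union>j\<in>{- int n..int n}. dyadic_interval (0, j))))"
      using net_content_incseq by metis
    also have "\<dots> = 0" using fin by simp
    finally show False using posF by simp
  qed
  then obtain j where j: "net_content s (F \<inter> dyadic_interval (0, j)) > 0" ..
  have "closed_projection (F \<inter> dyadic_interval (0, j))"
    using F by (intro closed_projection_borel) (simp add: Dab)
  moreover have "F \<inter> dyadic_interval (0, j) \<subseteq> {real_of_int j..real_of_int j + 1}"
    by (auto simp: Dab)
  ultimately obtain K where K: "compact K" "K \<subseteq> F \<inter> dyadic_interval (0, j)" "net_content s K > 0"
    using exists_compact_subset_net_content_pos[OF s _ _ j] by blast
  have Kj: "K \<subseteq> dyadic_interval (0, j)" using K by blast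
  obtain \<mu> C where \<mu>: "finite_measure \<mu>" "sets \<mu> = sets borel" "0 < measure \<mu> K" "0 < C"
    "\<And>a b. a \<le> b \<Longrightarrow> measure \<mu> {a..b} \<le> C * (b - a) powr s"
    using frostman_compact[OF s K(1) Kj K(3)] by metis
  interpret finite_measure \<mu> by (rule \<mu>)
  have "measure \<mu> K \<le> measure \<mu> F" using K F \<mu> by (intro finite_measure_mono) auto
  then have F: "0 < measure \<mu> F" using \<mu> by simp
  have "measure \<mu> K \<le> measure \<mu> {real_of_int j..real_of_int j + 1}"
    using Kj \<mu> by (intro finite_measure_mono) (auto simp: Dab)
  then have "0 < measure \<mu> {real_of_int j..real_of_int j + 1}" using \<mu>(3) by simp
  then have "s \<le> 1" using exponent_le_one[OF \<mu>(1,2) _ \<mu>(5)] by blast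
  then show thesis using that[OF \<mu>(1,2) F \<mu>(4,5)] by blast
qed

subsection \<open>Gaps and the Cantor set\<close>

lemma gap_properties:
  assumes "closed K" "U \<in> gaps K"
  shows gap_open: "open U" and gap_nonempty: "U \<noteq> {}" and gap_connected: "connected U"
    and gap_bounded: "bounded U"
  using assms open_components[of "- K" U] in_components_nonempty[of U "- K"]
    in_components_connected[of U "- K"]
  by (auto simp: gaps_def)

lemma gaps_disjoint: "disjoint (gaps K)"
  using pairwise_disjoint_components[of "- K"]
    by (auto simp: gaps_def pairwise_def disjnt_def disjoint_def)

lemma countable_gaps: "closed K \<Longrightarrow> countable (gaps K)"
  by (rule countable_disjoint_open_subsets) (auto simp: gap_open gaps_disjoint)

lemma gap_subset:
  fixes K :: "real set"
  assumes K: "K \<subseteq> {a..b}" and U: "U \<in> gaps K"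
  shows "U \<subseteq> {a..b}"
proof
  have Uc: "U \<in> components (- K)" "bounded U" using U by (auto simp: gaps_def)
  fix x assume x: "x \<in> U"
  have "\<not> x < a"
  proof
    assume "x < a"
    then have "{..<a} \<subseteq> U" using K x by (intro components_maximal[OF Uc(1)]) auto
    then have "bounded {..<a}" using Uc(2) bounded_subset by blast
    then obtain B where B: "\<And>x. x < a \<Longrightarrow> \<bar>x\<bar> \<le> B" by (auto simp: bounded_iff)
    have "min a (- B) - 1 < a" "min a (- B) \<le> - B" by auto
    then show False using B[of "min a (- B) - 1"] by linarith
  qed
  moreover have "\<not> b < x"
  proof
    assume "b < x"
    then have "{b<..} \<subseteq> U" using K x by (intro components_maximal[OF Uc(1)]) auto
    then have "bounded {b<..}" using Uc(2) bounded_subset by blast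
    then obtain B where B: "\<And>x. b < x \<Longrightarrow> \<bar>x\<bar> \<le> B" by (auto simp: bounded_iff)
    have "b < max b B + 1" "B \<le> max b B" by auto
    then show False using B[of "max b B + 1"] by linarith
  qed
  ultimately show "x \<in> {a..b}" by auto
qed

text \<open>A gap is connected and avoids \<open>x\<close>, so it lies on one side of
  \<open>x\<close>, and any one of its points tells on which.\<close>

lemma gap_below_iff:
  fixes K :: "real set"
  assumes U: "U \<in> gaps K" and q: "q \<in> U" and x: "x \<in> K"
  shows "U \<subseteq> {..<x} \<longleftrightarrow> q < x"
proof -
  have "U \<in> components (- K)" using U by (simp add: gaps_def)
  then have c: "connected U" "x \<notin> U"
    using x in_components_connected in_components_subset by blast+
  have "U \<subseteq> {..<x} \<or> U \<subseteq> {x<..}"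
  proof (rule ccontr)
    assume "\<not> ?thesis"
    then obtain y z where "y \<in> U" "y \<ge> x" "z \<in> U" "z \<le> x" by force
    then have "x \<in> U" using c(1) by (meson connectedD_interval)
    then show False using c by simp
  qed
  then show ?thesis using q by auto
qed

lemma exists_gap_between:
  fixes K :: "real set"
  assumes "x \<in> K" "y \<in> K" "x \<le> a" "a < b" "b \<le> y" "{a<..<b} \<inter> K = {}"
  shows "\<exists>U \<in> gaps K. {a<..<b} \<subseteq> U \<and> U \<subseteq> {x<..<y}"
proof -
  have "{a<..<b} \<subseteq> - K" "(a + b) / 2 \<in> {a<..<b}" using assms by auto
  then have "\<exists>U. U \<in> components (- K) \<and> {a<..<b} \<subseteq> U"
    by (intro exists_component_superset) auto
  then obtain U where U: "U \<in> components (- K)" "{a<..<b} \<subseteq> U" by blast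
  have "connected U" using U in_components_connected by blast
  have "x \<notin> U" "y \<notin> U" using assms U in_components_subset by blast+
  have m: "(a + b) / 2 \<in> U" using U assms by auto
  have "U \<subseteq> {x<..<y}"
  proof
    fix z assume z: "z \<in> U"
    have "x < z"
    proof (rule ccontr)
      assume "\<not> x < z"
      then have "x \<in> U" using z m assms by (intro connectedD_interval[OF \<open>connected U\<close> z m]) auto
      then show False using \<open>x \<notin> U\<close> by simp
    qed
    moreover have "z < y"
    proof (rule ccontr)
      assume "\<not> z < y"
      then have "y \<in> U" using z m assms by (intro connectedD_interval[OF \<open>connected U\<close> m z]) auto
      then show False using \<open>y \<notin> U\<close> by simp
    qed
    ultimately show "z \<in> {x<..<y}" by simp
  qed
  moreover from this have "bounded U"
    by (meson bounded_closed_interval bounded_subset greaterThanLessThan_subseteq_atLeastAtMost_iff order_refl)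
  ultimately show ?thesis using U by (auto simp: gaps_def)
qed

lemma gap_fmeasurable:
  fixes K :: "real set"
  assumes "closed K" "U \<in> gaps K"
  shows "U \<in> fmeasurable lborel"
  by (intro fmeasurableI emeasure_bounded_finite gap_bounded[OF assms])
    (simp add: gap_open[OF assms])

lemma interval_fmeasurable:
  fixes a b :: real
  shows "{a..b} \<in> fmeasurable lborel" "{a<..<b} \<in> fmeasurable lborel"
  by (intro fmeasurableI emeasure_bounded_finite; simp)+

lemma sum_gap_measure_le:
  fixes K :: "real set"
  assumes K: "closed K" "K \<subseteq> {0..1}" and J: "finite J" "J \<subseteq> gaps K"
  shows "(\<Sum>U\<in>J. measure lborel U) \<le> 1"
proof -
  have "(\<Sum>U\<in>J. measure lborel U) = measure lborel (\<Union>U\<in>J. U)"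
  proof (rule measure_finite_Union[symmetric])
    show "disjoint_family_on (\<lambda>U. U) J"
      using J(2) gaps_disjoint[of K] unfolding disjoint_family_on_def disjoint_def by blast
  qed (use J gap_fmeasurable[OF K(1)] in \<open>auto simp: fmeasurable_def less_top[symmetric]\<close>)
  also have "\<dots> \<le> measure lborel {0..1 :: real}"
  proof (rule measure_mono_fmeasurable)
    show "(\<Union>U\<in>J. U) \<subseteq> {0..1}" using J gap_subset[OF K(2)] by blast
    show "(\<Union>U\<in>J. U) \<in> sets lborel"
      using J by (intro sets.finite_UN fmeasurableD gap_fmeasurable[OF K(1)]) auto
  qed (rule interval_fmeasurable)
  finally show ?thesis by simp
qed

text \<open>The point at distance \<open>e / 2\<close> to the right of each interval is outside the
  union, and a connected subset cannot pass over it. This turns the components in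
  \<open>cantor_stage\<close> into explicit intervals.\<close>

lemma components_separated_intervals:
  fixes l e :: real
  assumes l: "0 \<le> l" and e: "0 < e"
    and sep: "\<And>p q. p \<in> P \<Longrightarrow> q \<in> P \<Longrightarrow> p < q \<Longrightarrow> p + l + e \<le> q"
  shows "components (\<Union>p\<in>P. {p..p + l}) = (\<lambda>p. {p..p + l}) ` P"
proof -
  let ?S = "\<Union>p\<in>P. {p..p + l}"
  have eq: "I = {p..p + l}" if I: "I \<in> components ?S" and x: "x \<in> I" and p: "p \<in> P" "x \<in> {p..p + l}"
    for I x p
  proof
    show "{p..p + l} \<subseteq> I"
      using p x by (intro components_maximal[OF I]) auto
    have conn: "connected I" using I in_components_connected by blast
    have out: "q + l + e / 2 \<notin> ?S" if "q \<in> P" for q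
    proof
      assume "q + l + e / 2 \<in> ?S"
      then obtain r where r: "r \<in> P" "r \<le> q + l + e / 2" "q + l + e / 2 \<le> r + l" by auto
      then show False using sep[of q r] sep[of r q] that e l
        by (cases q r rule: linorder_cases) auto
    qed
    show "I \<subseteq> {p..p + l}"
    proof
      fix y assume y: "y \<in> I"
      then obtain q where q: "q \<in> P" "y \<in> {q..q + l}" using I in_components_subset by blast
      show "y \<in> {p..p + l}"
      proof (cases p q rule: linorder_cases)
        case less
        then have "p + l + e / 2 \<in> I"
          using sep[of p q] p q e by (intro connectedD_interval[OF conn x y]) auto
        then show ?thesis using out[OF p(1)] I in_components_subset by blast
      next
        case greater
        then have "q + l + e / 2 \<in> I"
          using sep[of q p] p q e by (intro connectedD_interval[OF conn y x]) auto
        then show ?thesis using out[OF q(1)] I in_components_subset by blast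
      qed (use q in auto)
    qed
  qed
  show ?thesis
  proof safe
    fix I assume I: "I \<in> components ?S"
    then obtain x where x: "x \<in> I" using in_components_nonempty by blast
    then obtain p where "p \<in> P" "x \<in> {p..p + l}" using I in_components_subset by blast
    then show "I \<in> (\<lambda>p. {p..p + l}) ` P" using eq[OF I x] by blast
  next
    fix p assume p: "p \<in> P"
    then obtain I where I: "I \<in> components ?S" "{p..p + l} \<subseteq> I"
      using exists_component_superset[of "{p..p + l}" ?S] l by auto
    then show "{p..p + l} \<in> components ?S" using eq[of I p p] p l by force
  qed
qed

section \<open>The stages of the Cantor set as explicit finite unions of intervals\<close>

definition cantor_length :: "(nat \<Rightarrow> real) \<Rightarrow> nat \<Rightarrow> real" where
  "cantor_length c k = (\<Prod>i<k. c (Suc i))"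

text \<open>Left end points of the intervals of stage \<open>k\<close>. The shift places the second
  of the two remaining intervals at the right end of its parent.\<close>

fun cantor_points :: "(nat \<Rightarrow> real) \<Rightarrow> nat \<Rightarrow> real set" where
  "cantor_points c 0 = {0}"
| "cantor_points c (Suc k) = cantor_points c k \<union>
     (\<lambda>p. p + (cantor_length c k - cantor_length c (Suc k))) ` cantor_points c k"

text \<open>There is a single interval at stage \<open>0\<close>; the value \<open>1\<close> only keeps the sequence positive and
  decreasing.\<close>

fun cantor_separation :: "(nat \<Rightarrow> real) \<Rightarrow> nat \<Rightarrow> real" where
  "cantor_separation c 0 = 1"
| "cantor_separation c (Suc k) = (1 - 2 * c (Suc k)) * cantor_length c k"

context
  fixes c :: "nat \<Rightarrow> real"
  assumes c: "\<And>k. k \<ge> 1 \<Longrightarrow> 0 < c k \<and> c k < 1/2"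
    and c_mono: "\<And>k l. 1 \<le> k \<Longrightarrow> k \<le> l \<Longrightarrow> c k \<le> c l"
begin

lemma cantor_length_pos: "0 < cantor_length c k"
  unfolding cantor_length_def using c by (intro prod_pos) auto

lemma cantor_length_Suc: "cantor_length c (Suc k) = c (Suc k) * cantor_length c k"
  by (simp add: cantor_length_def)

lemma cantor_length_le: "cantor_length c k \<le> (1 / 2) ^ k"
proof -
  have "cantor_length c k \<le> (\<Prod>i<k. 1 / 2)"
    unfolding cantor_length_def using c by (intro prod_mono) (auto simp: less_imp_le)
  then show ?thesis by simp
qed

lemma cantor_length_Suc_less: "2 * cantor_length c (Suc k) < cantor_length c k"
  using c[of "Suc k"] cantor_length_pos[of k] by (simp add: cantor_length_Suc)

lemma cantor_length_antimono: "j \<le> k \<Longrightarrow> cantor_length c k \<le> cantor_length c j"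
proof (rule lift_Suc_antimono_le)
  show "cantor_length c (Suc n) \<le> cantor_length c n" for n
    using cantor_length_Suc_less[of n] cantor_length_pos[of "Suc n"] by linarith
qed

lemma cantor_separation_Suc:
  "cantor_separation c (Suc k) = cantor_length c k - 2 * cantor_length c (Suc k)"
  by (simp add: cantor_length_Suc algebra_simps)

lemma cantor_separation_pos: "0 < cantor_separation c k"
  using cantor_length_Suc_less
    by (cases k) (auto simp: cantor_separation_Suc simp del: cantor_separation.simps(2))

text \<open>Since \<open>c\<close> increases, both the removed proportions and the lengths decrease.
  The intervals removed last are therefore the shortest, and their length bounds every distance
  between intervals of the stage from below.\<close>

lemma cantor_separation_antimono: "cantor_separation c (Suc k) \<le> cantor_separation c k"
proof (cases k)
  case 0
  then show ?thesis using c[of 1] by (simp add: cantor_length_def)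
next
  case (Suc j)
  have "(1 - 2 * c (Suc k)) * cantor_length c k \<le> (1 - 2 * c k) * cantor_length c j"
    using c[of "Suc k"] c[of k] c_mono[of k "Suc k"] Suc cantor_length_pos[of k] cantor_length_antimono[of j k]
    by (intro mult_mono) auto
  then show ?thesis by (simp add: Suc)
qed

text \<open>Two intervals with the same parent are separated by exactly the length just removed;
  with different parents they inherit the separation of the previous stage, which is no
  smaller.\<close>

lemma cantor_points_separated:
  "p \<in> cantor_points c k \<Longrightarrow> q \<in> cantor_points c k \<Longrightarrow> p < q \<Longrightarrow>
    p + cantor_length c k + cantor_separation c k \<le> q"
proof (induction k arbitrary: p q)
  case (Suc k)
  let ?l = "cantor_length c k" and ?l' = "cantor_length c (Suc k)"
  obtain a where a: "a \<in> cantor_points c k" "p = a \<or> p = a + (?l - ?l')" using Suc.prems(1) by auto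
  obtain b where b: "b \<in> cantor_points c k" "q = b \<or> q = b + (?l - ?l')" using Suc.prems(2) by auto
  note * = cantor_length_Suc_less[of k] cantor_length_pos[of "Suc k"] cantor_separation_antimono[of k]
    cantor_separation_pos[of "Suc k"] cantor_separation_Suc[of k]
  show ?case
  proof (cases a b rule: linorder_cases)
    case less
    then show ?thesis using Suc.IH[OF a(1) b(1)] a b * by auto
  next
    case equal
    then show ?thesis using a b * \<open>p < q\<close> by auto
  next
    case greater
    then show ?thesis using Suc.IH[OF b(1) a(1)] a b * \<open>p < q\<close> by auto
  qed
qed simp

lemma finite_cantor_points: "finite (cantor_points c k)"
  and card_cantor_points: "card (cantor_points c k) \<le> 2 ^ k"
proof (induction k)
  case (Suc k)
  { case 1 then show ?case using Suc by simp }
  { case 2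
    have "card (cantor_points c (Suc k)) \<le> card (cantor_points c k) + card (cantor_points c k)"
      unfolding cantor_points.simps
      by (intro order_trans[OF card_Un_le] add_mono card_image_le Suc) simp
    then show ?case using Suc by simp }
qed simp_all

lemma cantor_stage_eq:
  "cantor_stage c k = (\<Union>p\<in>cantor_points c k. {p..p + cantor_length c k})"
proof (induction k)
  case 0
  then show ?case by (simp add: cantor_length_def)
next
  case (Suc k)
  let ?l = "cantor_length c k" and ?l' = "cantor_length c (Suc k)" and ?P = "cantor_points c k"
  note * = cantor_length_Suc_less[of k] cantor_length_pos[of "Suc k"] cantor_length_pos[of k] cantor_separation_pos[of k]
  have comp: "components (cantor_stage c k) = (\<lambda>p. {p..p + ?l}) ` ?P"
    unfolding Suc using * cantor_points_separated
      by (intro components_separated_intervals[where e = "cantor_separation c k"]) auto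
  have conc:
    "concentric_interval {p..p + ?l} ((1 - 2 * c (Suc k)) * measure lborel {p..p + ?l}) = {p
    + ?l'<..<p + ?l - ?l'}" for p
  proof -
    have "(1 - 2 * c (Suc k)) * measure lborel {p..p + ?l} = ?l - 2 * ?l'"
      using * by (simp add: cantor_length_Suc algebra_simps)
    moreover have "(p + (p + ?l)) / 2 - (?l - 2 * ?l') / 2 = p + ?l'"
      "(p + (p + ?l)) / 2 + (?l - 2 * ?l') / 2 = p + ?l - ?l'" by (simp_all add: field_simps)
    ultimately show ?thesis using *
      by (simp add: concentric_interval_def del: times_divide_eq_right)
  qed
  have "cantor_stage c (Suc k) = (\<Union>p\<in>?P. {p..p + ?l}) - (\<Union>p\<in>?P. {p + ?l'<..<p + ?l - ?l'})"
    unfolding cantor_stage.simps(2) comp unfolding Suc by (simp only: image_image conc)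
  also have "\<dots> = (\<Union>p\<in>?P. {p..p + ?l'} \<union> {p + ?l - ?l'..p + ?l})"
  proof safe
    fix x p assume "p \<in> ?P" "x \<in> {p..p + ?l}" "x \<notin> (\<Union>p\<in>?P. {p + ?l'<..<p + ?l - ?l'})"
    then show "x \<in> (\<Union>p\<in>?P. {p..p + ?l'} \<union> {p + ?l - ?l'..p + ?l})" by (intro UN_I[of p]) auto
  next
    fix x p assume "p \<in> ?P" "x \<in> {p..p + ?l'}"
    then show "x \<in> (\<Union>p\<in>?P. {p..p + ?l})" using * by (intro UN_I[of p]) auto
  next
    fix x p assume "p \<in> ?P" "x \<in> {p + ?l - ?l'..p + ?l}"
    then show "x \<in> (\<Union>p\<in>?P. {p..p + ?l})" using * by (intro UN_I[of p]) auto
  next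
    fix x p q assume "p \<in> ?P" "x \<in> {p..p + ?l'}" "q \<in> ?P" "x \<in> {q + ?l'<..<q + ?l - ?l'}"
    then show False using cantor_points_separated[of p k q] cantor_points_separated[of q k p] *
      by (cases p q rule: linorder_cases) auto
  next
    fix x p q assume "p \<in> ?P" "x \<in> {p + ?l - ?l'..p + ?l}" "q \<in> ?P" "x \<in> {q + ?l'<..<q + ?l - ?l'}"
    then show False using cantor_points_separated[of p k q] cantor_points_separated[of q k p] *
      by (cases p q rule: linorder_cases) auto
  qed
  also have "\<dots> = (\<Union>p\<in>cantor_points c (Suc k). {p..p + ?l'})"
    by (auto simp: algebra_simps)
  finally show ?case .
qed

lemma closed_cantor_stage: "closed (cantor_stage c k)"
  unfolding cantor_stage_eq using finite_cantor_points by (intro closed_UN) auto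

lemma cantor_stage_antimono: "j \<le> k \<Longrightarrow> cantor_stage c k \<subseteq> cantor_stage c j"
  by (rule lift_Suc_antimono_le) auto

lemma cantor_stage_subset: "cantor_stage c k \<subseteq> {0..1}"
  using cantor_stage_antimono[of 0 k] by simp

lemma closed_cantor_set: "closed (cantor_set c)"
  unfolding cantor_set_def using closed_cantor_stage by auto

lemma cantor_set_subset: "cantor_set c \<subseteq> {0..1}"
  unfolding cantor_set_def using cantor_stage_subset by auto

lemma cantor_stage_fmeasurable: "cantor_stage c k \<in> fmeasurable lborel"
  by (rule fmeasurableI2[of "{0..1}"])
    (use cantor_stage_subset closed_cantor_stage in \<open>auto intro: interval_fmeasurable\<close>)

text \<open>One step removes at most 2^k intervals of length l_k - 2 l_(k+1), where l_k is
  \<open>cantor_length c k\<close>, and subtracting this from 2^k l_k leaves 2^(k+1)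
  l_(k+1).\<close>

lemma measure_cantor_stage: "2 ^ k * cantor_length c k \<le> measure lborel (cantor_stage c k)"
proof (induction k)
  case 0
  then show ?case by (simp add: cantor_length_def)
next
  case (Suc k)
  let ?l = "cantor_length c k" and ?l' = "cantor_length c (Suc k)" and ?P = "cantor_points c k"
  note * = cantor_length_Suc_less[of k] cantor_length_pos[of "Suc k"]
  let ?R = "\<Union>p\<in>?P. {p + ?l'<..<p + ?l - ?l'}"
  have sub: "cantor_stage c k \<subseteq> cantor_stage c (Suc k) \<union> ?R"
  proof
    fix x assume "x \<in> cantor_stage c k"
    then obtain p where p: "p \<in> ?P" "p \<le> x" "x \<le> p + ?l" unfolding cantor_stage_eq by auto
    then have "x \<in> {p..p + ?l'} \<or> x \<in> ?R \<or> x \<in> {p + (?l - ?l')..p + (?l - ?l') + ?l'}" by force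
    then show "x \<in> cantor_stage c (Suc k) \<union> ?R" unfolding cantor_stage_eq using p(1) by auto
  qed
  have R: "?R \<in> fmeasurable lborel"
    using finite_cantor_points by (intro fmeasurable.finite_UN interval_fmeasurable)
  have "2 ^ k * ?l \<le> measure lborel (cantor_stage c k)" by (rule Suc)
  also have "\<dots> \<le> measure lborel (cantor_stage c (Suc k) \<union> ?R)"
    by (rule measure_mono_fmeasurable[OF sub])
      (use cantor_stage_fmeasurable R closed_cantor_stage in \<open>auto simp del: cantor_stage.simps\<close>)
  also have "\<dots> \<le> measure lborel (cantor_stage c (Suc k)) + measure lborel ?R"
    using cantor_stage_fmeasurable[of "Suc k"] R by (intro measure_Un_le fmeasurableD)
  also have "measure lborel ?R \<le> (\<Sum>p\<in>?P. measure lborel {p + ?l'<..<p + ?l - ?l'})"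
    using finite_cantor_points by (intro measure_UNION_le) auto
  also have "\<dots> = card ?P * (?l - 2 * ?l')" using * by simp
  also have "\<dots> \<le> 2 ^ k * (?l - 2 * ?l')"
    using of_nat_mono[OF card_cantor_points[of k], where 'a = real] *
      by (intro mult_right_mono) auto
  finally show ?case by (simp add: algebra_simps)
qed

text \<open>The partial products are \<open>2 ^ n * cantor_length c n\<close> and decrease to
  \<open>p\<close>. So the stages have length at least \<open>p\<close>, and continuity from above
  passes this on to their intersection.\<close>

lemma measure_cantor_set_pos:
  assumes "p > 0" "(\<lambda>k. 2 * c (Suc k)) has_prod p"
  shows "0 < measure lborel (cantor_set c)"
proof -
  have lim: "(\<lambda>n. \<Prod>i\<le>n. 2 * c (Suc i)) \<longlonglongrightarrow> p"
    using assms by (auto simp: has_prod_def raw_has_prod_def)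
  have "p \<le> (\<Prod>i\<le>n. 2 * c (Suc i))" for n
  proof (rule decseq_ge[OF _ lim], rule decseq_SucI)
    fix n
    have "0 \<le> (\<Prod>i\<le>n. 2 * c (Suc i))" using c by (intro prod_nonneg) (auto simp: less_imp_le)
    then have "(\<Prod>i\<le>n. 2 * c (Suc i)) * (2 * c (Suc (Suc n))) \<le> (\<Prod>i\<le>n. 2 * c (Suc i)) * 1"
      using c[of "Suc (Suc n)"] by (intro mult_left_mono) auto
    then show "(\<Prod>i\<le>Suc n. 2 * c (Suc i)) \<le> (\<Prod>i\<le>n. 2 * c (Suc i))" by simp
  qed
  moreover have "(\<Prod>i\<le>n. 2 * c (Suc i)) = 2 ^ Suc n * cantor_length c (Suc n)" for n
    unfolding cantor_length_def lessThan_Suc_atMost prod.distrib by simp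
  ultimately have ge: "p \<le> measure lborel (cantor_stage c (Suc n))" for n
    using measure_cantor_stage[of "Suc n"] by (metis order_trans)
  have "(\<lambda>n. measure lborel (cantor_stage c (Suc n))) \<longlonglongrightarrow> measure lborel (\<Inter>n. cantor_stage c (Suc n))"
  proof (rule Lim_measure_decseq)
    show "range (\<lambda>n. cantor_stage c (Suc n)) \<subseteq> sets lborel" using closed_cantor_stage
      by (auto simp del: cantor_stage.simps)
    show "decseq (\<lambda>n. cantor_stage c (Suc n))" using cantor_stage_antimono
      by (auto simp: decseq_def simp del: cantor_stage.simps)
    show "emeasure lborel (cantor_stage c (Suc i)) \<noteq> \<infinity>" for i
      using fmeasurableD2[OF cantor_stage_fmeasurable[of "Suc i"]] by simp
  qed
  moreover have "(\<Inter>n. cantor_stage c (Suc n)) = cantor_set c"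
  proof -
    have "cantor_stage c n \<supseteq> cantor_stage c (Suc n)" for n by auto
    then show ?thesis unfolding cantor_set_def by (blast)
  qed
  ultimately have "p \<le> measure lborel (cantor_set c)"
    using ge by (intro LIMSEQ_le_const) auto
  then show ?thesis using assms by simp
qed

text \<open>Points more than \<open>cantor_length c k\<close> apart lie in different intervals of
  stage \<open>k\<close>. The stretch of length \<open>cantor_separation c k\<close> immediately to
  the right of the interval of \<open>x\<close> misses the stage and belongs to a single
  gap.\<close>

lemma cantor_set_gap:
  assumes "x \<in> cantor_set c" "y \<in> cantor_set c" "cantor_length c k < y - x"
  shows "\<exists>U \<in> gaps (cantor_set c). U \<subseteq> {x<..<y} \<and> cantor_separation c k \<le> measure lborel U"
proof -
  let ?l = "cantor_length c k" and ?g = "cantor_separation c k"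
  have xy: "x \<in> cantor_stage c k" "y \<in> cantor_stage c k" using assms by (auto simp: cantor_set_def)
  obtain p where p: "p \<in> cantor_points c k" "p \<le> x" "x \<le> p + ?l" using xy(1)
    unfolding cantor_stage_eq by auto
  obtain q where q: "q \<in> cantor_points c k" "q \<le> y" "y \<le> q + ?l" using xy(2)
    unfolding cantor_stage_eq by auto
  have "p < q" using assms p q cantor_length_pos[of k] by linarith
  then have sep: "p + ?l + ?g \<le> q" using cantor_points_separated p q by blast
  have "{p + ?l<..<p + ?l + ?g} \<inter> cantor_stage c k = {}"
  proof safe
    fix z assume z: "z \<in> {p + ?l<..<p + ?l + ?g}" "z \<in> cantor_stage c k"
    then obtain r where r: "r \<in> cantor_points c k" "r \<le> z" "z \<le> r + ?l" unfolding cantor_stage_eq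
      by auto
    then show "z \<in> {}" using z cantor_points_separated[OF p(1) r(1)] by (cases "p < r") auto
  qed
  then have "{p + ?l<..<p + ?l + ?g} \<inter> cantor_set c = {}" unfolding cantor_set_def by blast
  then have "\<exists>U \<in> gaps (cantor_set c). {p + ?l<..<p + ?l + ?g} \<subseteq> U \<and> U \<subseteq> {x<..<y}"
    by (intro exists_gap_between) (use assms p q sep cantor_separation_pos[of k] in auto)
  then obtain U where U: "U \<in> gaps (cantor_set c)" "{p + ?l<..<p + ?l + ?g} \<subseteq> U" "U \<subseteq> {x<..<y}"
    by blast
  have "measure lborel {p + ?l<..<p + ?l + ?g} \<le> measure lborel U"
    using gap_fmeasurable[OF closed_cantor_set U(1)] U(2) by (intro measure_mono_fmeasurable) auto
  then have "?g \<le> measure lborel U" using cantor_separation_pos[of k] by simp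
  then show ?thesis using U by blast
qed

text \<open>Let \<open>k\<close> be the first stage whose intervals are no longer than
  \<open>r\<close>. The length removed there is \<open>1 - 2 * c k\<close> times a length above
  \<open>r\<close>. By the limit hypothesis this factor decays more slowly than any exponential in
  \<open>k\<close>, whereas \<open>r\<close> itself is exponentially small in \<open>k\<close>; so
  the factor is at least \<open>r powr (\<theta> - 1)\<close>.\<close>

lemma cantor_set_large_gaps:
  assumes lim: "(\<lambda>k. ln (1 - 2 * c k) / real k) \<longlonglongrightarrow> 0" and \<theta>: "1 < \<theta>"
  shows "\<exists>r0>0. \<forall>r x y. 0 < r \<longrightarrow> r < r0 \<longrightarrow> x \<in> cantor_set c \<longrightarrow> y \<in> cantor_set c \<longrightarrow> r < y - x \<longrightarrow>
    (\<exists>U \<in> gaps (cantor_set c). U \<subseteq> {x<..<y} \<and> r powr \<theta> \<le> measure lborel U)"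
proof -
  \<comment> \<open>One half of the exponent \<open>\<theta> - 1\<close> yields
    \<open>exp (- e * j)\<close> from \<open>r \<le> (1 / 2) ^ j\<close>; the other half yields the
    missing \<open>exp (- e)\<close> from \<open>r \<le> 1 / 2\<close>, as
    \<open>k = Suc j\<close>.\<close>
  define e where "e = (\<theta> - 1) * ln 2 / 2"
  have e: "0 < e" using \<theta> by (simp add: e_def)
  have "\<forall>\<^sub>F k in sequentially. - e < ln (1 - 2 * c k) / real k"
    using e by (intro order_tendstoD(1)[OF lim]) simp
  then obtain k0 where k0: "\<And>k. k0 \<le> k \<Longrightarrow> - e < ln (1 - 2 * c k) / real k"
    by (auto simp: eventually_sequentially)
  define r0 where "r0 = min (cantor_length c k0) (1 / 2)"
  have "0 < r0" using cantor_length_pos by (simp add: r0_def)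
  moreover have "\<exists>U \<in> gaps (cantor_set c). U \<subseteq> {x<..<y} \<and> r powr \<theta> \<le> measure lborel U"
    if r: "0 < r" "r < r0" and xy: "x \<in> cantor_set c" "y \<in> cantor_set c" "r < y - x" for r x y
  proof -
    obtain n where "(1 / 2) ^ n < r" using real_arch_pow_inv[of r "1 / 2"] r by auto
    then have ex: "cantor_length c n \<le> r" using cantor_length_le[of n] by linarith
    define k where "k = (LEAST k. cantor_length c k \<le> r)"
    have k: "cantor_length c k \<le> r" unfolding k_def using ex by (rule LeastI)
    have "k0 < k"
    proof (rule ccontr)
      assume "\<not> k0 < k"
      then show False using cantor_length_antimono[of k k0] k r by (simp add: r0_def)
    qed
    then obtain j where j: "k = Suc j" by (cases k) auto
    have lj: "r < cantor_length c j" using not_less_Least[of j "\<lambda>k. cantor_length c k \<le> r"] j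
      by (simp add: k_def)
    have kpos: "0 < real k" by (simp add: j)
    have "- e * k < ln (1 - 2 * c k)"
      using k0[of k] \<open>k0 < k\<close> kpos by (simp add: field_simps)
    then have "exp (- e * k) < exp (ln (1 - 2 * c k))" by (simp only: exp_less_cancel_iff)
    moreover have "0 < 1 - 2 * c k" using c[of k] j by simp
    ultimately have ck: "exp (- e * k) < 1 - 2 * c k" by (simp only: exp_ln)
    have "r powr ((\<theta> - 1) / 2) \<le> exp (- e * j)"
    proof -
      have "r \<le> (1 / 2) ^ j" using lj cantor_length_le[of j] by linarith
      then have "r powr ((\<theta> - 1) / 2) \<le> ((1 / 2) ^ j) powr ((\<theta> - 1) / 2)"
        using r \<theta> by (intro powr_mono2) auto
      also have "\<dots> = exp (- e * j)" by (simp add: powr_def ln_realpow ln_div e_def)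
      finally show ?thesis .
    qed
    moreover have "r powr ((\<theta> - 1) / 2) \<le> exp (- e)"
    proof -
      have "r powr ((\<theta> - 1) / 2) \<le> (1 / 2) powr ((\<theta> - 1) / 2)"
        using r \<theta> by (intro powr_mono2) (auto simp: r0_def)
      also have "\<dots> = exp (- e)" by (simp add: powr_def ln_div e_def)
      finally show ?thesis .
    qed
    ultimately have "r powr ((\<theta> - 1) / 2) * r powr ((\<theta> - 1) / 2) \<le> exp (- e * j) * exp (- e)"
      by (intro mult_mono) auto
    also have "\<dots> = exp (- e * k)" by (simp add: j exp_add[symmetric] algebra_simps)
    finally have "r powr (\<theta> - 1) \<le> 1 - 2 * c k" using ck by (simp add: powr_add[symmetric])
    then have "r powr (\<theta> - 1) * r \<le> (1 - 2 * c k) * cantor_length c j"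
      using lj r c[of k] j by (intro mult_mono) auto
    then have le: "r powr \<theta> \<le> cantor_separation c k" using r by (simp add: j powr_diff)
    have "cantor_length c k < y - x" using k xy(3) by linarith
    then obtain U where "U \<in> gaps (cantor_set c)"
      "U \<subseteq> {x<..<y}" "cantor_separation c k \<le> measure lborel U"
      using cantor_set_gap[OF xy(1,2)] by blast
    then show ?thesis using le by (intro bexI[of _ U] conjI order_trans[OF le])
  qed
  ultimately show ?thesis by blast
qed

end

subsection \<open>The random map\<close>

definition gap_point :: "real set \<Rightarrow> real" where
  "gap_point U = (SOME x. x \<in> U)"

text \<open>The index set is fixed and \<open>x\<close> enters only through an indicator, so the sum
  splits along disjoint sets of gaps and its terms are jointly measurable in \<open>\<omega>\<close>
  and \<open>x\<close>. On \<open>K\<close>, with all gaps as index set, it is the sum in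
  \<open>random_map\<close>; off \<open>K\<close> it serves as a monotone extension.\<close>

definition jump_sum :: "real set set \<Rightarrow> (real set \<Rightarrow> real) \<Rightarrow> real \<Rightarrow> real" where
  "jump_sum J \<omega> x = (\<Sum>\<^sub>\<infinity>U\<in>J. \<omega> U * of_bool (gap_point U < x))"

lemma gap_point_in: "closed K \<Longrightarrow> U \<in> gaps K \<Longrightarrow> gap_point U \<in> U"
  unfolding gap_point_def using gap_nonempty by (metis ex_in_conv someI)

lemma gap_modulus_nonneg: "0 \<le> gap_modulus \<alpha> t"
proof -
  have "0 \<le> max (- ln t) (ln 2)" by (simp add: le_max_iff_disj)
  then show ?thesis by (simp add: gap_modulus_def)
qed

lemma gap_bound_nonneg: "0 \<le> gap_bound m \<alpha> U"
  by (simp add: gap_bound_def gap_modulus_nonneg)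

text \<open>The constant comes from the cut at \<open>ln 2\<close> in the case
  \<open>\<alpha> = 0\<close>. As the gap lengths sum to at most 1, the same constant bounds every
  total of jumps.\<close>

lemma gap_modulus_le:
  assumes "0 \<le> \<alpha>" "0 \<le> t" "t \<le> 1"
  shows "gap_modulus \<alpha> t \<le> 1 / ln 2"
proof (cases "\<alpha> = 0")
  case True
  have "1 / max (- ln t) (ln 2) \<le> 1 / ln 2"
    by (rule divide_left_mono) (auto simp: less_max_iff_disj intro: mult_pos_pos)
  then show ?thesis using True by (simp add: gap_modulus_def)
next
  case False
  have "t powr \<alpha> \<le> 1" using assms by (intro powr_le1) auto
  also have "1 \<le> 1 / ln (2 :: real)" using ln_2_less_1 by simp
  finally show ?thesis using False by (simp add: gap_modulus_def)
qed

text \<open>The logarithm of the case \<open>\<alpha> = 0\<close> is absorbed by an arbitrarily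
  small power, since \<open>- \<kappa> * ln t \<le> t powr (- \<kappa>)\<close>. This gives one
  power bound for all \<open>\<alpha>\<close>.\<close>

lemma gap_modulus_ge:
  assumes "0 < \<kappa>" "0 < t" "t \<le> 1"
  shows "min 1 \<kappa> * t powr (\<alpha> + \<kappa>) \<le> gap_modulus \<alpha> t"
proof (cases "\<alpha> = 0")
  case True
  have t1: "1 \<le> t powr (- \<kappa>)" using assms powr_mono'[of "-\<kappa>" 0 t] by simp
  have "- \<kappa> * ln t \<le> exp (- \<kappa> * ln t)" using exp_ge_add_one_self[of "- \<kappa> * ln t"] by linarith
  also have "\<dots> = t powr (- \<kappa>)" using assms by (simp add: powr_def)
  finally have 1: "- ln t \<le> t powr (- \<kappa>) / \<kappa>" using assms by (simp add: field_simps)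
  have "t powr (- \<kappa>) / \<kappa> \<le> t powr (- \<kappa>) / min 1 \<kappa>" using assms by (intro divide_left_mono) auto
  moreover have "t powr (- \<kappa>) / 1 \<le> t powr (- \<kappa>) / min 1 \<kappa>" using assms
    by (intro divide_left_mono) auto
  ultimately have "max (- ln t) (ln 2) \<le> t powr (- \<kappa>) / min 1 \<kappa>"
    using 1 t1 ln_2_less_1 by (intro max.boundedI) linarith+
  moreover have "0 < max (- ln t) (ln 2)" by (simp add: less_max_iff_disj)
  ultimately have "1 / (t powr (- \<kappa>) / min 1 \<kappa>) \<le> 1 / max (- ln t) (ln 2)"
    using assms by (intro divide_left_mono mult_pos_pos) auto
  moreover have "1 / (t powr (- \<kappa>) / min 1 \<kappa>) = min 1 \<kappa> * t powr (\<alpha> + \<kappa>)"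
    using True by (simp add: powr_minus_divide)
  ultimately show ?thesis using True by (simp add: gap_modulus_def)
next
  case False
  have "min 1 \<kappa> * t powr (\<alpha> + \<kappa>) \<le> 1 * t powr \<alpha>"
    using assms by (intro mult_mono powr_mono') auto
  then show ?thesis using False by (simp add: gap_modulus_def)
qed

lemma scaled_measure_measurable:
  assumes "sets \<nu> = sets (restrict_space borel {0..1})" "0 \<le> (d :: real)"
  shows "(\<lambda>x. d * x) \<in> \<nu> \<rightarrow>\<^sub>M restrict_space borel {0..d}"
proof -
  have "(\<lambda>x :: real. d * x) \<in> restrict_space borel {0..1} \<rightarrow>\<^sub>M restrict_space borel {0..d}"
    using assms(2) by (intro measurable_restrict_space3) (auto intro: mult_left_le)
  then show ?thesis using assms(1) by (simp cong: measurable_cong_sets)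
qed

lemma prob_space_scaled_measure:
  assumes "prob_space \<nu>" "sets \<nu> = sets (restrict_space borel {0..1})" "0 \<le> d"
  shows "prob_space (scaled_measure \<nu> d)"
  unfolding scaled_measure_def
  by (rule prob_space.prob_space_distr[OF assms(1) scaled_measure_measurable[OF assms(2,3)]])

lemma borel_measurable_scaled_measure:
  assumes "f \<in> borel_measurable borel"
  shows "f \<in> borel_measurable (scaled_measure \<nu> d)"
proof -
  have "f \<in> borel_measurable (restrict_space borel {0..d})"
    using assms by (rule measurable_restrict_space1)
  then show ?thesis by (simp add: scaled_measure_def)
qed

lemma integral_scaled_measure:
  assumes "sets \<nu> = sets (restrict_space borel {0..1})" "0 \<le> d"
  shows "(\<integral>y. exp (- 2 * pi * \<i> * \<xi> * complex_of_real y) \<partial>scaled_measure \<nu> d)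
    = fourier_transform \<nu> (\<xi> * d)"
proof -
  have "(\<lambda>y. exp (- 2 * pi * \<i> * \<xi> * complex_of_real y))
    \<in> borel_measurable (restrict_space borel {0..d})"
    by (intro measurable_restrict_space1) measurable
  then show ?thesis
    unfolding scaled_measure_def fourier_transform_def
    by (subst integral_distr[OF scaled_measure_measurable[OF assms]]) (simp_all add: mult_ac)
qed

lemma down_closed_eq_lessThan:
  fixes A :: "nat set"
  assumes "finite A" and "\<And>i j. i \<in> A \<Longrightarrow> j < i \<Longrightarrow> j \<in> A"
  shows "A = {..<card A}"
proof -
  define n where "n = (LEAST n. n \<notin> A)"
  have "\<exists>n. n \<notin> A" using assms(1) infinite_UNIV_nat by (metis UNIV_eq_I)
  then have n: "n \<notin> A" unfolding n_def by (rule LeastI_ex)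
  have "A = {..<n}"
  proof safe
    fix i assume "i \<in> A"
    then show "i < n" using n assms(2)[of i n] by (cases i n rule: linorder_cases) auto
  next
    fix i assume "i < n"
    then show "i \<in> A" unfolding n_def using not_less_Least by blast
  qed
  then show ?thesis by simp
qed

context
  fixes K :: "real set" and m :: nat and \<alpha> :: real and \<nu> :: "real measure"
  assumes K: "closed K" "K \<subseteq> {0..1}" and m: "m \<ge> 1" and \<alpha>: "0 \<le> \<alpha>"
    and \<nu>: "prob_space \<nu>" "sets \<nu> = sets (restrict_space borel {0..1})"
begin

abbreviation (input) "\<Omega> \<equiv> omega_measure K m \<alpha> \<nu>"

lemma gap_measure_le_1: "U \<in> gaps K \<Longrightarrow> measure lborel U \<le> 1"
  using sum_gap_measure_le[OF K, of "{U}"] by simp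

lemma gap_bound_le: "U \<in> gaps K \<Longrightarrow> gap_bound m \<alpha> U \<le> measure lborel U * (1 / ln 2)"
  unfolding gap_bound_def
  using gap_measure_le_1[of U] m \<alpha> power_decreasing[of 1 m "measure lborel U"]
  by (intro mult_mono gap_modulus_le) (auto simp: gap_modulus_nonneg)

lemma gap_point_less_iff:
  assumes "U \<in> gaps K" "x \<in> K"
  shows "U \<subseteq> {..<x} \<longleftrightarrow> gap_point U < x"
  using gap_below_iff[OF assms(1) gap_point_in[OF K(1) assms(1)] assms(2)] by auto

lemma inj_on_gap_point: "inj_on gap_point (gaps K)"
proof (rule inj_onI)
  fix U V assume "U \<in> gaps K" "V \<in> gaps K" "gap_point U = gap_point V"
  then have "gap_point U \<in> U \<inter> V" using gap_point_in[OF K(1)] by (metis IntI)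
  then show "U = V" using gaps_disjoint[of K] \<open>U \<in> gaps K\<close> \<open>V \<in> gaps K\<close> by (auto simp: disjoint_def)
qed

lemma omega_bounds: "\<omega> \<in> space \<Omega> \<Longrightarrow> U \<in> gaps K \<Longrightarrow> 0 \<le> \<omega> U \<and> \<omega> U \<le> gap_bound m \<alpha> U"
  unfolding space_omega_measure by (auto simp: PiE_iff)

lemma sum_omega_le:
  assumes "\<omega> \<in> space \<Omega>" "finite J" "J \<subseteq> gaps K"
  shows "sum \<omega> J \<le> 1 / ln 2"
proof -
  have "sum \<omega> J \<le> (\<Sum>U\<in>J. measure lborel U * (1 / ln 2))"
    using assms omega_bounds gap_bound_le by (intro sum_mono) (meson order_trans subsetD)
  also have "\<dots> = (\<Sum>U\<in>J. measure lborel U) * (1 / ln 2)" by (rule sum_distrib_right[symmetric])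
  also have "\<dots> \<le> 1 * (1 / ln 2)"
    using sum_gap_measure_le[OF K assms(2,3)] by (intro mult_right_mono) auto
  finally show ?thesis by simp
qed

lemma jump_sum_summable:
  assumes w: "\<omega> \<in> space \<Omega>" and J: "J \<subseteq> gaps K"
  shows "(\<lambda>U. \<omega> U * of_bool (gap_point U < x)) summable_on J"
proof (rule nonneg_bdd_above_summable_on)
  show "0 \<le> \<omega> U * of_bool (gap_point U < x)" if "U \<in> J" for U
    using omega_bounds[OF w] that J by auto
  show "bdd_above (sum (\<lambda>U. \<omega> U * of_bool (gap_point U < x)) ` {F. F \<subseteq> J \<and> finite F})"
  proof (rule bdd_aboveI2)
    fix F assume "F \<in> {F. F \<subseteq> J \<and> finite F}"
    then have F: "F \<subseteq> J" "finite F" by auto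
    have "sum (\<lambda>U. \<omega> U * of_bool (gap_point U < x)) F \<le> sum \<omega> F"
      using omega_bounds[OF w] F J by (intro sum_mono) (auto simp: of_bool_def)
    also have "\<dots> \<le> 1 / ln 2" using sum_omega_le[OF w F(2)] F J by auto
    finally show "sum (\<lambda>U. \<omega> U * of_bool (gap_point U < x)) F \<le> 1 / ln 2" .
  qed
qed

lemma jump_sum_nonneg: "\<omega> \<in> space \<Omega> \<Longrightarrow> J \<subseteq> gaps K \<Longrightarrow> 0 \<le> jump_sum J \<omega> x"
  unfolding jump_sum_def using omega_bounds by (intro infsum_nonneg) auto

lemma jump_sum_mono:
  assumes "\<omega> \<in> space \<Omega>" "J \<subseteq> gaps K" "x \<le> y"
  shows "jump_sum J \<omega> x \<le> jump_sum J \<omega> y"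
  unfolding jump_sum_def
  using assms omega_bounds by (intro infsum_mono jump_sum_summable) (auto simp: of_bool_def)

lemma jump_sum_le:
  assumes w: "\<omega> \<in> space \<Omega>" and J: "J \<subseteq> gaps K"
  shows "jump_sum J \<omega> x \<le> 1 / ln 2"
  unfolding jump_sum_def
proof (rule infsum_le_finite_sums[OF jump_sum_summable[OF w J]])
  fix F assume F: "finite F" "F \<subseteq> J"
  have "sum (\<lambda>U. \<omega> U * of_bool (gap_point U < x)) F \<le> sum \<omega> F"
    using omega_bounds[OF w] F J by (intro sum_mono) (auto simp: of_bool_def)
  also have "\<dots> \<le> 1 / ln 2" using sum_omega_le[OF w F(1)] F J by auto
  finally show "sum (\<lambda>U. \<omega> U * of_bool (gap_point U < x)) F \<le> 1 / ln 2" .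
qed

lemma random_map_eq_jump_sum:
  assumes "x \<in> K"
  shows "random_map K \<omega> x = x + jump_sum (gaps K) \<omega> x"
  unfolding random_map_def jump_sum_def
  by (intro arg_cong2[where f = "(+)"] refl infsum_cong_neutral)
    (auto simp: gap_point_less_iff[OF _ assms])

text \<open>The infinite sum is a limit along the filter of finite subsets. An enumeration of
  \<open>J\<close> provides finite sets \<open>F n\<close> that eventually contain every finite
  subset, so that it becomes a limit of a sequence of measurable functions.\<close>

lemma jump_sum_measurable [measurable]:
  assumes J: "J \<subseteq> gaps K"
  shows "(\<lambda>(\<omega>, x). jump_sum J \<omega> x) \<in> borel_measurable (\<Omega> \<Otimes>\<^sub>M borel)"
proof -
  have J': "countable J" using countable_gaps[OF K(1)] J countable_subset by blast
  define F where "F = (\<lambda>n. {U \<in> J. to_nat_on J U < n})"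
  have F: "finite (F n)" "F n \<subseteq> J" for n
  proof -
    have "inj_on (to_nat_on J) (F n)"
      using inj_on_to_nat_on[OF J'] by (rule inj_on_subset) (auto simp: F_def)
    moreover have "to_nat_on J ` F n \<subseteq> {..<n}" by (auto simp: F_def)
    ultimately show "finite (F n)" by (meson finite_imageD finite_lessThan finite_subset)
    show "F n \<subseteq> J" by (auto simp: F_def)
  qed
  have filt: "filterlim F (finite_subsets_at_top J) sequentially"
    unfolding filterlim_finite_subsets_at_top
  proof (intro allI impI)
    fix X assume X: "finite X \<and> X \<subseteq> J"
    define N where "N = Suc (Max (insert 0 (to_nat_on J ` X)))"
    have "X \<subseteq> F n" if "n \<ge> N" for n
    proof
      fix U assume "U \<in> X"
      then have "to_nat_on J U \<le> Max (insert 0 (to_nat_on J ` X))" using X by (intro Max_ge) auto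
      then have "to_nat_on J U < n" using that unfolding N_def by linarith
      then show "U \<in> F n" using X \<open>U \<in> X\<close> by (auto simp: F_def)
    qed
    then show "\<forall>\<^sub>F n in sequentially. finite (F n) \<and> X \<subseteq> F n \<and> F n \<subseteq> J"
      unfolding eventually_sequentially using F by blast
  qed
  have comp: "(\<lambda>(\<omega>, x). \<omega> U * of_bool (gap_point U < x)) \<in> borel_measurable (\<Omega> \<Otimes>\<^sub>M borel)"
    if U: "U \<in> gaps K" for U
  proof -
    have "(\<lambda>\<omega>. \<omega> U) \<in> borel_measurable \<Omega>"
      unfolding omega_measure_def
      by (rule measurable_compose[OF measurable_component_singleton[OF U]])
        (rule borel_measurable_scaled_measure, simp)
    moreover have "(\<lambda>x. of_bool (gap_point U < x) :: real) \<in> borel_measurable borel"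
      unfolding of_bool_def by measurable
    ultimately show ?thesis
      unfolding split_beta'
      by (intro borel_measurable_times measurable_compose[OF measurable_fst] measurable_compose[OF measurable_snd])
  qed
  have meas:
    "(\<lambda>z. \<Sum>U\<in>F n. fst z U * of_bool (gap_point U < snd z)) \<in> borel_measurable (\<Omega> \<Otimes>\<^sub>M borel)" for n
    using comp F(2)[of n] J by (intro borel_measurable_sum) (auto simp: split_beta')
  show ?thesis
  proof (rule borel_measurable_LIMSEQ_real[OF _ meas])
    fix z :: "(real set \<Rightarrow> real) \<times> real" assume "z \<in> space (\<Omega> \<Otimes>\<^sub>M borel)"
    then have w: "fst z \<in> space \<Omega>" by (auto simp: space_pair_measure)
    show "(\<lambda>n. \<Sum>U\<in>F n. fst z U * of_bool (gap_point U < snd z)) \<longlonglongrightarrow> (\<lambda>(\<omega>, x). jump_sum J \<omega> x) z"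
      using filterlim_compose[OF infsum_tendsto[OF jump_sum_summable[OF w J, of "snd z"]] filt]
      by (simp add: split_beta' jump_sum_def)
  qed
qed

lemma jump_sum_measurable_snd:
  assumes "\<omega> \<in> space \<Omega>" "J \<subseteq> gaps K"
  shows "jump_sum J \<omega> \<in> borel_measurable borel"
  using measurable_compose[OF measurable_Pair1'[OF assms(1), of borel] jump_sum_measurable[OF assms(2)]] by simp

lemma prob_space_omega: "prob_space \<Omega>"
  unfolding omega_measure_def
  by (intro prob_space_PiM prob_space_scaled_measure \<nu> gap_bound_nonneg)

lemma finite_large_gaps:
  assumes "0 < \<eta>"
  shows "finite {U \<in> gaps K. \<eta> \<le> measure lborel U}"
proof (rule ccontr)
  assume inf: "infinite {U \<in> gaps K. \<eta> \<le> measure lborel U}"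
  obtain n :: nat where n: "1 / \<eta> < n" using reals_Archimedean2 by blast
  obtain J where J: "J \<subseteq> {U \<in> gaps K. \<eta> \<le> measure lborel U}" "finite J" "card J = n"
    using infinite_arbitrarily_large[OF inf] by blast
  have "n * \<eta> = (\<Sum>U\<in>J. \<eta>)" using J by simp
  also have "\<dots> \<le> (\<Sum>U\<in>J. measure lborel U)" using J by (intro sum_mono) auto
  also have "\<dots> \<le> 1" using J by (intro sum_gap_measure_le[OF K]) auto
  finally show False using n assms by (simp add: field_simps)
qed

lemma jump_phase_measurable:
  fixes \<rho> :: "real measure" and c :: complex and f :: "real \<Rightarrow> complex"
  assumes J: "J \<subseteq> gaps K" and f [measurable]: "f \<in> borel_measurable borel"
    and \<rho>: "sets \<rho> = sets borel"
  shows "(\<lambda>(\<omega>, x). f x * exp (c * complex_of_real (x + jump_sum J \<omega> x)))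
    \<in> borel_measurable (\<Omega> \<Otimes>\<^sub>M \<rho>)"
proof -
  have [measurable]: "(\<lambda>z. jump_sum J (fst z) (snd z)) \<in> borel_measurable (\<Omega> \<Otimes>\<^sub>M borel)"
    using jump_sum_measurable[OF J] by (simp add: split_beta')
  have "(\<lambda>z. f (snd z) * exp (c * complex_of_real (snd z + jump_sum J (fst z) (snd z))))
    \<in> borel_measurable (\<Omega> \<Otimes>\<^sub>M borel)"
    by measurable
  moreover have "sets (\<Omega> \<Otimes>\<^sub>M \<rho>) = sets (\<Omega> \<Otimes>\<^sub>M borel)"
    by (intro sets_pair_measure_cong) (simp_all add: \<rho>)
  ultimately show ?thesis by (simp add: split_beta' cong: measurable_cong_sets)
qed

lemma fourier_coefficient_measurable:
  assumes "real_distribution \<rho>"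
  shows "(\<lambda>\<omega>. \<integral>x. exp (- 2 * pi * \<i> * \<xi> * complex_of_real (x + jump_sum (gaps K) \<omega> x)) \<partial>\<rho>)
    \<in> borel_measurable \<Omega>"
proof -
  interpret \<rho>: real_distribution \<rho> by (rule assms)
  have "(\<lambda>(\<omega>, x). 1 * exp ((- 2 * pi * \<i> * \<xi>) * complex_of_real (x + jump_sum (gaps K) \<omega> x)))
    \<in> borel_measurable (\<Omega> \<Otimes>\<^sub>M \<rho>)"
    by (intro jump_phase_measurable) auto
  from \<rho>.borel_measurable_lebesgue_integral[OF this] show ?thesis by simp
qed

text \<open>The gaps of length at least \<open>\<eta>\<close> are sorted from left to right, and
  \<open>A k\<close> consists of the points with exactly \<open>k\<close> of them on their left. On
  \<open>A k\<close> the large gaps contribute the product of the first \<open>k\<close> phases,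
  independently of the point; the integral \<open>a k\<close> that remains involves small gaps only
  and is unaffected by resampling a large one. By \<open>sep\<close>, two points of \<open>K\<close>
  in the same \<open>A k\<close> are at most \<open>r\<close> apart.\<close>

lemma prob_fourier_coefficient:
  fixes \<rho> :: "real measure"
  assumes \<rho>: "real_distribution \<rho>" "AE x in \<rho>. x \<in> K"
    and C: "\<And>a b. a \<le> b \<Longrightarrow> measure \<rho> {a..b} \<le> C * (b - a) powr s"
    and \<eta>: "0 < \<eta>" and r: "0 < r"
    and sep: "\<And>x y. x \<in> K \<Longrightarrow> y \<in> K \<Longrightarrow> r < y - x \<Longrightarrow>
      \<exists>U \<in> gaps K. U \<subseteq> {x<..<y} \<and> \<eta> \<le> measure lborel U"
    and half: "\<And>U. U \<in> gaps K \<Longrightarrow> \<eta> \<le> measure lborel U \<Longrightarrow>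
      cmod (fourier_transform \<nu> (\<xi> * gap_bound m \<alpha> U)) \<le> 1 / 2"
    and R: "0 \<le> R" and B: "B = C * (2 * r) powr s"
  defines "X \<equiv> \<lambda>\<omega>. \<integral>x. exp (- 2 * pi * \<i> * \<xi> * complex_of_real (x + jump_sum (gaps K) \<omega> x)) \<partial>\<rho>"
  shows "measure \<Omega> {\<omega> \<in> space \<Omega>. v \<le> cmod (X \<omega>)} \<le> 4 * exp (2 * R * B + 8 * R\<^sup>2 * B - R * v / 2)"
proof -
  interpret \<rho>: real_distribution \<rho> by (rule \<rho>)
  have sets_\<rho> [measurable_cong]: "sets \<rho> = sets borel" by simp
  define e where "e = (\<lambda>y :: real. exp (- 2 * pi * \<i> * \<xi> * complex_of_real y))"
  have e_add: "e (x + y) = e x * e y" for x y by (simp add: e_def exp_add[symmetric] algebra_simps)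
  have e1: "cmod (e y) = 1" for y by (simp add: e_def)
  have e_meas [measurable]: "e \<in> borel_measurable borel" unfolding e_def by measurable
  have prod_meas: "(\<lambda>(\<omega>, x). f x * e (x + jump_sum J \<omega> x)) \<in> borel_measurable (\<Omega> \<Otimes>\<^sub>M \<rho>)"
    if "J \<subseteq> gaps K" "f \<in> borel_measurable borel" for J and f :: "real \<Rightarrow> complex"
    using jump_phase_measurable[OF that, of \<rho> "- 2 * pi * \<i> * \<xi>"] by (simp add: e_def)
  have X_meas: "X \<in> borel_measurable \<Omega>"
    unfolding X_def by (rule fourier_coefficient_measurable[OF \<rho>(1)])
  define G where "G = {U \<in> gaps K. \<eta> \<le> measure lborel U}"
  have G: "finite G" "G \<subseteq> gaps K" unfolding G_def using finite_large_gaps[OF \<eta>] by auto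
  have injG: "inj_on gap_point G" using inj_on_gap_point G(2) by (rule inj_on_subset)
  define N where "N = card G"
  define l where "l = sorted_list_of_set (gap_point ` G)"
  have l: "length l = N" "set l = gap_point ` G" "sorted_wrt (<) l"
    unfolding l_def N_def using G injG by (simp_all add: card_image)
  have l_less: "l ! i < l ! j" if "i < j" "j < N" for i j
    using sorted_wrt_nth_less[OF l(3) that(1)] that l(1) by simp
  define u where "u = (\<lambda>i. inv_into G gap_point (l ! i))"
  have u: "u i \<in> G" "gap_point (u i) = l ! i" if "i < N" for i
  proof -
    have "l ! i \<in> gap_point ` G" using that l by (metis nth_mem)
    then show "u i \<in> G" "gap_point (u i) = l ! i"
      unfolding u_def by (auto intro: inv_into_into f_inv_into_f)
  qed
  have inj_u: "inj_on u {..<N}"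
  proof (rule inj_onI)
    fix i j assume "i \<in> {..<N}" "j \<in> {..<N}" "u i = u j"
    then show "i = j" using u(2)[of i] u(2)[of j] l_less[of i j] l_less[of j i]
      by (cases i j rule: linorder_cases) auto
  qed
  have img_u: "u ` {..<N} = G"
    using u(1) inj_u G(1) by (intro card_subset_eq) (auto simp: card_image N_def)
  define j where "j = (\<lambda>x. card {i. i < N \<and> l ! i < x})"
  \<comment> \<open>Because \<open>l\<close> increases, the indices counted by \<open>j x\<close>
    form an initial segment; hence the phases occur in products over \<open>i < k\<close>.\<close>
  have j_set: "{i. i < N \<and> l ! i < x} = {..<j x}" for x
    unfolding j_def by (intro down_closed_eq_lessThan) (auto dest: l_less)
  have j_le: "j x \<le> N" for x
    using card_mono[of "{..<N}" "{i. i < N \<and> l ! i < x}"] by (auto simp: j_def)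
  define A where "A = (\<lambda>k. {x. j x = k})"
  have A_meas [measurable]: "A k \<in> sets borel" for k
  proof -
    have "real (j x) = (\<Sum>i<N. indicator {l ! i<..} x)" for x
    proof -
      have "(\<Sum>i<N. indicator {l ! i<..} x) = (\<Sum>i<N. if l ! i < x then 1 else 0 :: real)"
        by (intro sum.cong) (auto simp: indicator_def)
      also have "\<dots> = (\<Sum>i\<in>{i \<in> {..<N}. l ! i < x}. 1)"
        by (rule sum.inter_filter[symmetric]) simp
      also have "\<dots> = real (j x)" unfolding j_def by simp
      finally show ?thesis by simp
    qed
    then have "A k = (\<lambda>x. \<Sum>i<N. indicator {l ! i<..} x :: real) -` {real k} \<inter> space borel"
      by (auto simp: A_def simp flip: of_nat_eq_iff[where 'a = real])
    also have "\<dots> \<in> sets borel" by (rule measurable_sets[of _ borel borel]) auto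
    finally show ?thesis .
  qed
  define a where "a = (\<lambda>k \<omega>. \<integral>x. indicator (A k) x * e (x + jump_sum (gaps K - G) \<omega> x) \<partial>\<rho>)"
  define b where "b = (\<lambda>k. measure \<rho> (A k))"
  have B0: "0 \<le> B" unfolding B using order_trans[OF measure_nonneg C[of 0 "2 * r"]] r by simp
  have b_le: "b k \<le> B" for k
  proof (cases "A k \<inter> K = {}")
    case True
    then have "AE x in \<rho>. x \<notin> A k" using \<rho>(2) by (auto elim: eventually_mono)
    then have "b k = 0" unfolding b_def by (subst \<rho>.prob_eq_0) auto
    then show ?thesis using B0 by simp
  next
    case False
    then obtain x0 where x0: "x0 \<in> A k" "x0 \<in> K" by blast
    have near: "y - x \<le> r" if xy: "x \<in> A k" "y \<in> A k" "x \<in> K" "y \<in> K" for x y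
    proof (rule ccontr)
      assume "\<not> y - x \<le> r"
      then obtain U where U: "U \<in> gaps K" "U \<subseteq> {x<..<y}" "\<eta> \<le> measure lborel U"
        using sep[of x y] xy by auto
      then have "U \<in> u ` {..<N}" unfolding img_u G_def by simp
      then obtain i where i: "i < N" "U = u i" by blast
      have "gap_point U \<in> {x<..<y}" using U gap_point_in[OF K(1)] by blast
      then have "x < l ! i" "l ! i < y" using i u(2)[of i] by auto
      then have "i \<in> {..<j y}" "i \<notin> {..<j x}" using i unfolding j_set[symmetric] by auto
      then show False using xy by (simp add: A_def)
    qed
    \<comment> \<open>Only the part of \<open>A k\<close> inside \<open>K\<close> is known to be
      small, so the inclusion holds almost everywhere. The interval of radius \<open>r\<close> about
      \<open>x0\<close> is the origin of \<open>2 * r\<close> in \<open>B\<close>.\<close>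
    have "b k \<le> measure \<rho> {x0 - r..x0 + r}"
      unfolding b_def
    proof (rule \<rho>.finite_measure_mono_AE)
      show "AE x in \<rho>. x \<in> A k \<longrightarrow> x \<in> {x0 - r..x0 + r}"
        using \<rho>(2)
      proof eventually_elim
        case (elim x)
        then show ?case using near[of x x0] near[of x0 x] x0 by auto
      qed
    qed simp
    also have "\<dots> \<le> B" using C[of "x0 - r" "x0 + r"] r by (simp add: B)
    finally show ?thesis .
  qed
  have b_sum: "(\<Sum>k\<le>N. b k) \<le> 1"
  proof -
    have "(\<Sum>k\<le>N. b k) = measure \<rho> (\<Union>k\<le>N. A k)"
      unfolding b_def
    proof (intro \<rho>.finite_measure_finite_Union[symmetric])
      show "disjoint_family_on A {..N}" by (auto simp: disjoint_family_on_def A_def)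
    qed auto
    also have "\<dots> \<le> 1" by (rule \<rho>.prob_le_1)
    finally show ?thesis .
  qed
  have section_meas: "(\<lambda>x. f x * e (x + jump_sum J \<omega> x)) \<in> borel_measurable \<rho>"
    if "J \<subseteq> gaps K" "f \<in> borel_measurable borel" "\<omega> \<in> space \<Omega>" for J \<omega> and f :: "real \<Rightarrow> complex"
    using measurable_compose[OF measurable_Pair1'[OF that(3)] prod_meas[OF that(1,2)]] by simp
  have int: "integrable \<rho> (\<lambda>x. indicator (A k) x * e (x + jump_sum (gaps K - G) \<omega> x))"
    if "\<omega> \<in> space \<Omega>" for k \<omega>
    by (rule \<rho>.integrable_const_bound[where B = 1])
      (use section_meas[OF _ _ that] in \<open>auto simp: norm_mult e1 split: split_indicator\<close>)
  have X_eq: "X \<omega> = (\<Sum>k\<le>N. a k \<omega> * (\<Prod>i<k. e (\<omega> (u i))))" if w: "\<omega> \<in> space \<Omega>" for \<omega>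
  proof -
    have pt: "e (x + jump_sum (gaps K) \<omega> x)
      = (\<Sum>k\<le>N. indicator (A k) x * e (x + jump_sum (gaps K - G) \<omega> x) * (\<Prod>i<k. e (\<omega> (u i))))" for x
    proof -
      have "jump_sum (gaps K) \<omega> x = jump_sum (G \<union> (gaps K - G)) \<omega> x" using G
        by (simp add: Un_absorb1)
      also have "\<dots> = jump_sum G \<omega> x + jump_sum (gaps K - G) \<omega> x"
        unfolding jump_sum_def using G by (intro infsum_Un_disjoint jump_sum_summable[OF w]) auto
      also have "jump_sum G \<omega> x = (\<Sum>i<N. \<omega> (u i) * of_bool (gap_point (u i) < x))"
        unfolding jump_sum_def infsum_finite[OF G(1)] img_u[symmetric]
          by (simp add: sum.reindex[OF inj_u])
      also have "\<dots> = (\<Sum>i<N. if l ! i < x then \<omega> (u i) else 0)"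
        by (intro sum.cong) (auto simp: u)
      also have "\<dots> = (\<Sum>i\<in>{i \<in> {..<N}. l ! i < x}. \<omega> (u i))"
        by (rule sum.inter_filter[symmetric]) simp
      also have "{i \<in> {..<N}. l ! i < x} = {..<j x}" unfolding j_set[symmetric] by auto
      finally have S: "jump_sum (gaps K) \<omega> x = (\<Sum>i<j x. \<omega> (u i)) + jump_sum (gaps K - G) \<omega> x" .
      have e_sum: "e (\<Sum>i<n. \<omega> (u i)) = (\<Prod>i<n. e (\<omega> (u i)))" for n
        by (induction n) (simp_all add: e_add, simp add: e_def)
      have "e (x + jump_sum (gaps K) \<omega> x)
        = e (x + jump_sum (gaps K - G) \<omega> x) * (\<Prod>i<j x. e (\<omega> (u i)))"
        unfolding S e_sum[symmetric] e_add[symmetric] by (simp add: ac_simps)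
      also have
        "\<dots> = (\<Sum>k\<le>N. if j x = k then e (x + jump_sum (gaps K - G) \<omega> x) * (\<Prod>i<k. e (\<omega> (u i))) else 0)"
        using j_le[of x] by (subst sum.delta') auto
      also have
        "\<dots> = (\<Sum>k\<le>N. indicator (A k) x * e (x + jump_sum (gaps K - G) \<omega> x) * (\<Prod>i<k. e (\<omega> (u i))))"
        by (intro sum.cong) (auto simp: A_def)
      finally show ?thesis .
    qed
    have "X \<omega> = (\<integral>x. e (x + jump_sum (gaps K) \<omega> x) \<partial>\<rho>)"
      unfolding X_def e_def ..
    also have
      "\<dots> = (\<integral>x. (\<Sum>k\<le>N. indicator (A k) x * e (x + jump_sum (gaps K - G) \<omega> x)
      * (\<Prod>i<k. e (\<omega> (u i)))) \<partial>\<rho>)"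
      by (simp only: pt)
    also have
      "\<dots> = (\<Sum>k\<le>N. (\<integral>x. indicator (A k) x * e (x + jump_sum (gaps K - G) \<omega> x)
      * (\<Prod>i<k. e (\<omega> (u i))) \<partial>\<rho>))"
      using int[OF w] by (intro Bochner_Integration.integral_sum integrable_mult_left)
    also have "\<dots> = (\<Sum>k\<le>N. a k \<omega> * (\<Prod>i<k. e (\<omega> (u i))))"
      unfolding a_def using int[OF w] by (intro sum.cong refl integral_mult_left) auto
    finally show ?thesis .
  qed
  let ?M = "\<lambda>U. scaled_measure \<nu> (gap_bound m \<alpha> U)"
  have \<Omega>_eq: "\<Omega> = PiM (gaps K) ?M" by (simp add: omega_measure_def)
  show "measure \<Omega> {\<omega> \<in> space \<Omega>. v \<le> cmod (X \<omega>)} \<le> 4 * exp (2 * R * B + 8 * R\<^sup>2 * B - R * v / 2)"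
    unfolding \<Omega>_eq
  proof (rule prob_random_phases[where a = a and b = b and p = "\<lambda>_. e" and u = u and N = N])
    show "prob_space (?M U)" for U
      by (intro prob_space_scaled_measure \<nu> gap_bound_nonneg)
    show "inj_on u {..<N}" by (rule inj_u)
    show "u n \<in> gaps K" if "n < N" for n using u(1)[OF that] G by blast
    show "e \<in> borel_measurable (?M (u n))" for n
      by (rule borel_measurable_scaled_measure) simp
    show "cmod (e y) \<le> 1" for y by (simp add: e1)
    show "cmod (integral\<^sup>L (?M (u n)) e) \<le> 1 / 2" if "n < N" for n
      using half[of "u n"] u(1)[OF that] unfolding e_def
      by (subst integral_scaled_measure[OF \<nu>(2) gap_bound_nonneg]) (auto simp: G_def)
    show "a k \<in> borel_measurable (PiM (gaps K) ?M)" for k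
      unfolding a_def \<Omega>_eq[symmetric]
      using \<rho>.borel_measurable_lebesgue_integral[OF prod_meas[of "gaps K - G" "indicator (A k)"]]
        by auto
    show "a k (fun_upd \<omega> (u n) y) = a k \<omega>" if "n < N" for k n \<omega> y
    proof -
      have "jump_sum (gaps K - G) (fun_upd \<omega> (u n) y) x = jump_sum (gaps K - G) \<omega> x" for x
        unfolding jump_sum_def using u(1)[OF that] by (intro infsum_cong) auto
      then show ?thesis by (simp add: a_def)
    qed
    show "cmod (a k \<omega>) \<le> b k" if "\<omega> \<in> space (PiM (gaps K) ?M)" for k \<omega>
    proof -
      have w: "\<omega> \<in> space \<Omega>" using that by (simp add: \<Omega>_eq)
      have "cmod (a k \<omega>) \<le> (\<integral>x. cmod (indicator (A k) x * e (x + jump_sum (gaps K - G) \<omega> x)) \<partial>\<rho>)"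
        unfolding a_def by (rule integral_norm_bound)
      also have "\<dots> = (\<integral>x. indicator (A k) x \<partial>\<rho>)"
        by (intro Bochner_Integration.integral_cong) (auto simp: norm_mult e1 split: split_indicator)
      finally show ?thesis by (simp add: b_def)
    qed
    show "b k \<le> B" "0 \<le> b k" for k by (rule b_le) (simp add: b_def)
    show "X \<omega> = (\<Sum>k\<le>N. a k \<omega> * (\<Prod>i<k. e (\<omega> (u i))))" if "\<omega> \<in> space (PiM (gaps K) ?M)" for \<omega>
      using X_eq that by (simp add: \<Omega>_eq)
    show "X \<in> borel_measurable (PiM (gaps K) ?M)" using X_meas by (simp add: \<Omega>_eq)
  qed (use b_sum R in auto)
qed

end

subsection \<open>Decay of the Fourier transform\<close>

lemma norm_exp_i_diff_le:
  "cmod (exp (\<i> * complex_of_real a) - exp (\<i> * complex_of_real b)) \<le> \<bar>a - b\<bar>"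
proof -
  have "exp (\<i> * complex_of_real a) - exp (\<i> * complex_of_real b)
    = exp (\<i> * complex_of_real b) * (exp (\<i> * complex_of_real (a - b)) - 1)"
    by (simp add: algebra_simps exp_add[symmetric])
  then have "cmod (exp (\<i> * complex_of_real a) - exp (\<i> * complex_of_real b))
    = cmod (exp (\<i> * complex_of_real (a - b)) - 1)"
    by (simp add: norm_mult)
  also have "\<dots> \<le> \<bar>a - b\<bar>" using iexp_approx1[of "a - b" 0] by simp
  finally show ?thesis .
qed

text \<open>With y = n powr (\<tau> / 2), the elementary inequality (y / (2 k))^k \<le> exp (y / 2)
  brings in the power y^k, and \<open>k > 4 / \<tau>\<close> makes this at least n^2.\<close>

lemma summable_exp_neg_powr:
  assumes "0 < \<tau>"
  shows "summable (\<lambda>n. exp (- (sqrt (real n) powr \<tau>) / 2))"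
proof -
  obtain k :: nat where k: "4 / \<tau> < k" using reals_Archimedean2 by blast
  have k0: "0 < real k" using k assms by (meson divide_pos_pos less_trans zero_less_numeral)
  have "summable (\<lambda>n. (2 * real k) ^ k * real n powr (- 2))"
    by (intro summable_mult) (simp add: summable_real_powr_iff)
  then show ?thesis
  proof (rule summable_comparison_test_ev[rotated])
    show "\<forall>\<^sub>F n in sequentially. norm (exp (- (sqrt (real n) powr \<tau>) / 2)) \<le> (2 * real k) ^ k
      * real n powr (- 2)"
      using eventually_ge_at_top[of 1]
    proof eventually_elim
      case (elim n)
      define y where "y = sqrt (real n) powr \<tau>"
      have y: "0 < y" using elim by (simp add: y_def)
      have "(y / (2 * k)) ^ k \<le> exp (y / (2 * k)) ^ k"
        using y exp_ge_add_one_self[of "y / (2 * k)"] by (intro power_mono, linarith) simp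
      also have "\<dots> = exp (y / 2)" using k0 by (simp add: exp_of_nat_mult[symmetric])
      finally have 1: "y ^ k / (2 * k) ^ k \<le> exp (y / 2)" by (simp add: power_divide)
      have "real n powr 2 \<le> real n powr (k * \<tau> / 2)"
        using elim k assms by (intro powr_mono) (auto simp: field_simps)
      also have "\<dots> = y ^ k"
        using elim
          by (simp add: y_def powr_half_sqrt[symmetric] powr_powr powr_realpow[symmetric] mult_ac)
      finally have "real n powr 2 / (2 * k) ^ k \<le> exp (y / 2)"
        using 1 by (meson divide_right_mono order_trans zero_le_power mult_nonneg_nonneg of_nat_0_le_iff zero_le_numeral)
      then have "inverse (exp (y / 2)) \<le> inverse (real n powr 2 / (2 * k) ^ k)"
        using elim k0 by (intro le_imp_inverse_le) auto
      then show ?case by (simp add: y_def exp_minus powr_minus field_simps)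
    qed
  qed
qed

text \<open>If n is the integer part of \<xi>^2, then \<xi> - sqrt n is at most 1 / \<xi>, because
  \<xi>^2 - n is at most 1. The Lipschitz error \<open>L / \<xi>\<close> is harmless against
  \<open>\<xi> powr (- \<sigma> / 2)\<close>, and \<xi> \<le> 2 sqrt n carries the decay rate from
  the grid point over to \<xi>.\<close>

lemma bounded_range_powr_of_sqrt_grid:
  fixes \<phi> :: "real \<Rightarrow> complex"
  assumes even: "\<And>\<xi>. cmod (\<phi> (- \<xi>)) = cmod (\<phi> \<xi>)" and le1: "\<And>\<xi>. cmod (\<phi> \<xi>) \<le> 1"
    and lip: "\<And>\<xi> \<zeta>. cmod (\<phi> \<xi> - \<phi> \<zeta>) \<le> L * \<bar>\<xi> - \<zeta>\<bar>" and L: "0 \<le> L"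
    and ev: "\<forall>\<^sub>F n in sequentially. cmod (\<phi> (sqrt (real n))) < sqrt (real n) powr (- \<sigma> / 2)"
    and \<sigma>: "0 \<le> \<sigma>" "\<sigma> \<le> 1"
  shows "bounded (range (\<lambda>\<xi>. cmod (\<phi> \<xi>) * \<bar>\<xi>\<bar> powr (\<sigma> / 2)))"
proof -
  obtain n1 where n1: "\<And>n. n1 \<le> n \<Longrightarrow> cmod (\<phi> (sqrt (real n))) < sqrt (real n) powr (- \<sigma> / 2)"
    using ev by (auto simp: eventually_sequentially)
  define n0 where "n0 = max 1 n1"
  have n0: "1 \<le> n0" "n1 \<le> n0" by (auto simp: n0_def)
  have main: "cmod (\<phi> \<xi>) * \<xi> powr (\<sigma> / 2) \<le> max (2 + L) (real n0)" if \<xi>: "0 \<le> \<xi>" for \<xi>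
  proof (cases "n0 \<le> nat \<lfloor>\<xi>\<^sup>2\<rfloor>")
    case True
    define n where "n = nat \<lfloor>\<xi>\<^sup>2\<rfloor>"
    have n: "1 \<le> n" "n1 \<le> n" using True n0 by (auto simp: n_def)
    have n\<xi>: "real n \<le> \<xi>\<^sup>2" "\<xi>\<^sup>2 < real n + 1" by (auto simp: n_def of_nat_nat)
    have sq: "sqrt (real n) \<le> \<xi>" using n\<xi>(1) \<xi> by (simp add: real_le_lsqrt)
    have \<xi>1: "1 \<le> \<xi>" 
    proof -
      have "1 \<le> sqrt (real n)" using n(1) by simp
      then show ?thesis using sq by linarith
    qed
    have "(\<xi> - sqrt (real n)) * \<xi> \<le> (\<xi> - sqrt (real n)) * (\<xi> + sqrt (real n))"
      using sq by (intro mult_left_mono) auto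
    also have "\<dots> = \<xi>\<^sup>2 - real n" by (simp add: power2_eq_square algebra_simps)
    finally have "(\<xi> - sqrt (real n)) * \<xi> \<le> 1" using n\<xi> by simp
    then have d: "\<xi> - sqrt (real n) \<le> 1 / \<xi>" using \<xi>1 by (simp add: field_simps)
    have "\<xi>\<^sup>2 \<le> (2 * sqrt (real n))\<^sup>2" using n\<xi> n by (simp add: power_mult_distrib)
    then have "\<xi> \<le> 2 * sqrt (real n)" by (rule power2_le_imp_le) simp
    then have half: "\<xi> / 2 \<le> sqrt (real n)" by simp
    have "cmod (\<phi> \<xi>) \<le> cmod (\<phi> (sqrt (real n))) + cmod (\<phi> \<xi> - \<phi> (sqrt (real n)))"
      by (metis add.commute diff_add_cancel norm_triangle_ineq)
    also have "\<dots> \<le> sqrt (real n) powr (- \<sigma> / 2) + L * (1 / \<xi>)"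
      using n1[OF n(2)] lip[of \<xi> "sqrt (real n)"] mult_left_mono[OF d L] sq by (intro add_mono) auto
    also have "sqrt (real n) powr (- \<sigma> / 2) \<le> (\<xi> / 2) powr (- \<sigma> / 2)"
      using half \<xi>1 \<sigma> by (intro powr_mono2') auto
    finally have
      "cmod (\<phi> \<xi>) * \<xi> powr (\<sigma> / 2) \<le> ((\<xi> / 2) powr (- \<sigma> / 2) + L * (1 / \<xi>)) * \<xi> powr (\<sigma> / 2)"
      by (intro mult_right_mono) auto
    also have "\<dots> = 2 powr (\<sigma> / 2) + L * (\<xi> powr (\<sigma> / 2) / \<xi>)"
      using \<xi>1 by (simp add: powr_divide powr_minus algebra_simps)
    also have "\<dots> \<le> 2 powr 1 + L * 1"
    proof (intro add_mono mult_left_mono L)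
      have "\<xi> powr (\<sigma> / 2) \<le> \<xi> powr 1" using \<xi>1 \<sigma> by (intro powr_mono) auto
      then show "\<xi> powr (\<sigma> / 2) / \<xi> \<le> 1" using \<xi>1 by simp
      show "2 powr (\<sigma> / 2) \<le> (2 :: real) powr 1" using \<sigma> by (intro powr_mono) auto
    qed
    finally show ?thesis by simp
  next
    case False
    then have "\<xi>\<^sup>2 < real n0" by linarith
    also have "\<dots> \<le> (real n0)\<^sup>2" using n0 by (simp add: power2_eq_square)
    finally have "\<xi> \<le> real n0" using \<xi> by (simp add: power_less_imp_less_base less_imp_le)
    then have "\<xi> powr (\<sigma> / 2) \<le> real n0 powr (\<sigma> / 2)" using \<xi> \<sigma> by (intro powr_mono2) auto
    also have "\<dots> \<le> real n0 powr 1" using n0 \<sigma> by (intro powr_mono) auto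
    finally have "\<xi> powr (\<sigma> / 2) \<le> real n0" using n0 by simp
    then have "cmod (\<phi> \<xi>) * \<xi> powr (\<sigma> / 2) \<le> 1 * real n0" using le1 by (intro mult_mono) auto
    then show ?thesis by simp
  qed
  have "cmod (\<phi> \<bar>\<xi>\<bar>) = cmod (\<phi> \<xi>)" for \<xi> using even[of \<xi>] by (simp add: abs_if)
  then have "norm (cmod (\<phi> \<xi>) * \<bar>\<xi>\<bar> powr (\<sigma> / 2)) \<le> max (2 + L) (real n0)" for \<xi>
    using main[of "\<bar>\<xi>\<bar>"] by (simp add: abs_mult)
  then show ?thesis unfolding bounded_iff by blast
qed

text \<open>The function may jump, but its generalised inverse \<open>g\<close> is monotone, hence
  Borel, and \<open>y\<close> is in the image of \<open>B\<close> iff \<open>f (g y) = y\<close> and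
  \<open>g y \<in> B\<close>. The bounds on \<open>f\<close> keep the set whose supremum defines
  \<open>g\<close> nonempty and bounded above.\<close>

lemma borel_image_expanding:
  fixes f :: "real \<Rightarrow> real"
  assumes exp: "\<And>x y. x \<le> y \<Longrightarrow> y - x \<le> f y - f x" and bnd: "\<And>x. x \<le> f x" "\<And>x. f x \<le> x + L"
    and B: "B \<in> sets borel"
  shows "f ` B \<in> sets borel"
proof -
  define g where "g = (\<lambda>y. Sup {x. f x \<le> y})"
  have ne: "{x. f x \<le> y} \<noteq> {}" for y using bnd(2)[of "y - L"] by auto
  have bd: "bdd_above {x. f x \<le> y}" for y using bnd(1)
    by (intro bdd_aboveI[of _ y]) (auto intro: order_trans)
  have f_mono: "mono f" using exp by (intro monoI) force
  have "mono g" unfolding g_def by (intro monoI cSup_subset_mono ne bd) auto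
  have gf: "g (f x) = x" for x
  proof -
    have "{z. f z \<le> f x} = {..x}"
    proof safe
      fix z assume "f z \<le> f x"
      then show "z \<le> x" using exp[of x z] by (cases "x \<le> z") auto
    qed (use f_mono in \<open>auto simp: mono_def\<close>)
    then show ?thesis by (simp add: g_def)
  qed
  have [measurable]: "f \<in> borel_measurable borel" "g \<in> borel_measurable borel"
    using f_mono \<open>mono g\<close> by (auto intro: borel_measurable_mono)
  have [measurable]: "B \<in> sets borel" by (rule B)
  have "f ` B = {y \<in> space borel. f (g y) = y \<and> g y \<in> B}" using gf by (auto simp: image_iff) metis
  also have "\<dots> \<in> sets borel" by measurable
  finally show ?thesis .
qed

text \<open>By Fubini, integrating the measure of these sets over \<open>t\<close> gives
  \<open>emeasure \<mu> E * emeasure lborel C\<close>, which is positive, so they cannot all be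
  null.\<close>

lemma exists_translate_pos:
  fixes \<mu> :: "real measure"
  assumes \<mu>: "finite_measure \<mu>" "sets \<mu> = sets borel" and E: "E \<in> sets borel" "0 < measure \<mu> E"
    and C: "C \<in> sets borel" "0 < emeasure lborel C"
  shows "\<exists>t. 0 < measure \<mu> {x \<in> E. x + t \<in> C}"
proof (rule ccontr)
  interpret \<mu>: finite_measure \<mu> by (rule \<mu>)
  interpret pair_sigma_finite \<mu> lborel ..
  note [measurable_cong] = \<mu>(2)
  note [measurable] = E(1) C(1)
  assume "\<nexists>t. 0 < measure \<mu> {x \<in> E. x + t \<in> C}"
  then have "measure \<mu> {x \<in> E. x + t \<in> C} = 0" for t
    by (metis measure_nonneg order.order_iff_strict)
  then have z: "emeasure \<mu> {x \<in> E. x + t \<in> C} = 0" for t by (simp add: \<mu>.emeasure_eq_measure)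
  define h where "h = (\<lambda>(x, t). indicator E x * indicator C (x + t) :: ennreal)"
  have h: "h \<in> borel_measurable (\<mu> \<Otimes>\<^sub>M lborel)" unfolding h_def by measurable
  have "(\<integral>\<^sup>+x. (\<integral>\<^sup>+t. h (x, t) \<partial>lborel) \<partial>\<mu>) = (\<integral>\<^sup>+x. indicator E x * emeasure lborel C \<partial>\<mu>)"
  proof (intro nn_integral_cong)
    fix x
    have "(\<integral>\<^sup>+t. h (x, t) \<partial>lborel) = indicator E x * (\<integral>\<^sup>+t. indicator C (x + t) \<partial>lborel)"
      unfolding h_def by (simp add: nn_integral_cmult)
    also have
      "(\<integral>\<^sup>+t. indicator C (x + t) \<partial>lborel) = (\<integral>\<^sup>+t. indicator C t \<partial>distr lborel borel ((+) x))"
      by (subst nn_integral_distr) auto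
    also have "\<dots> = emeasure lborel C" unfolding lborel_distr_plus by simp
    finally show "(\<integral>\<^sup>+t. h (x, t) \<partial>lborel) = indicator E x * emeasure lborel C" .
  qed
  also have "\<dots> = emeasure \<mu> E * emeasure lborel C" using E \<mu> by (simp add: nn_integral_multc)
  finally have 1: "(\<integral>\<^sup>+x. (\<integral>\<^sup>+t. h (x, t) \<partial>lborel) \<partial>\<mu>) = emeasure \<mu> E * emeasure lborel C" .
  have "(\<integral>\<^sup>+t. (\<integral>\<^sup>+x. h (x, t) \<partial>\<mu>) \<partial>lborel) = (\<integral>\<^sup>+t. 0 \<partial>(lborel :: real measure))"
  proof (intro nn_integral_cong)
    fix t :: real
    have "(\<integral>\<^sup>+x. h (x, t) \<partial>\<mu>) = (\<integral>\<^sup>+x. indicator {x \<in> E. x + t \<in> C} x \<partial>\<mu>)"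
      unfolding h_def by (intro nn_integral_cong) (auto split: split_indicator)
    also have "\<dots> = emeasure \<mu> {x \<in> E. x + t \<in> C}"
    proof (rule nn_integral_indicator)
      have "{x \<in> space \<mu>. x \<in> E \<and> x + t \<in> C} \<in> sets \<mu>" by measurable
      then show "{x \<in> E. x + t \<in> C} \<in> sets \<mu>" using sets_eq_imp_space_eq[OF \<mu>(2)] by simp
    qed
    finally show "(\<integral>\<^sup>+x. h (x, t) \<partial>\<mu>) = 0" by (simp add: z)
  qed
  then have "emeasure \<mu> E * emeasure lborel C = 0"
    using Fubini[OF h] 1 by (simp add: Fubini')
  then show False using E(2) C(2) by (auto simp: \<mu>.emeasure_eq_measure)
qed

section \<open>Elementary bounds for the Fourier dimension\<close>

lemma norm_fourier_transform_le_1: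
  assumes "real_distribution \<mu>"
  shows "cmod (fourier_transform \<mu> \<xi>) \<le> 1"
  unfolding fourier_transform_char using assms by (rule real_distribution.cmod_char_le_1)

lemma fourier_dim_measure_le_1:
  assumes "real_distribution \<mu>"
  shows "fourier_dim_measure \<mu> \<le> 1"
  unfolding fourier_dim_measure_def
proof (rule cSup_least)
  have "norm (norm (fourier_transform \<mu> \<xi>) * \<bar>\<xi>\<bar> powr (0 / 2)) \<le> 1" for \<xi>
    using norm_fourier_transform_le_1[OF assms, of \<xi>] by simp
  then have "bounded (range (\<lambda>\<xi>. norm (fourier_transform \<mu> \<xi>) * \<bar>\<xi>\<bar> powr (0 / 2)))"
    unfolding bounded_iff by blast
  then show
    "{s \<in> {0..1}. bounded (range (\<lambda>\<xi>. norm (fourier_transform \<mu> \<xi>) * \<bar>\<xi>\<bar> powr (s / 2)))} \<noteq> {}"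
    by fastforce
qed auto

lemma fourier_dim_measure_ge:
  assumes "0 \<le> \<sigma>" "\<sigma> \<le> 1" "bounded (range (\<lambda>\<xi>. norm (fourier_transform \<mu> \<xi>) * \<bar>\<xi>\<bar> powr (\<sigma> / 2)))"
  shows "\<sigma> \<le> fourier_dim_measure \<mu>"
  unfolding fourier_dim_measure_def using assms by (intro cSup_upper) auto

lemma bdd_above_fourier_dims:
  "bdd_above (insert 0 {fourier_dim_measure \<mu> | \<mu>. real_distribution \<mu> \<and> measure \<mu> G = 1})"
  by (intro bdd_aboveI[of _ 1]) (auto intro: fourier_dim_measure_le_1)

lemma fourier_dim_nonneg: "0 \<le> fourier_dim G"
  unfolding fourier_dim_def by (intro cSup_upper bdd_above_fourier_dims) simp

lemma fourier_dim_ge: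
  assumes "real_distribution \<mu>" "measure \<mu> G = 1"
  shows "fourier_dim_measure \<mu> \<le> fourier_dim G"
  unfolding fourier_dim_def using assms by (intro cSup_upper bdd_above_fourier_dims) auto

text \<open>The slack between \<open>\<sigma>\<close> and \<open>s / (real m + \<alpha>)\<close> is
  halved at \<open>\<sigma>'\<close>. The part below \<open>\<sigma>'\<close> becomes the exponent
  \<open>\<tau>\<close> of the stretched exponential; the part above pays for
  \<open>\<theta>\<close>, the loss in the lengths of gaps, and \<open>\<kappa>\<close>, the loss in
  the modulus.\<close>

lemma AE_fourier_decay:
  fixes K :: "real set" and m :: nat and \<alpha> :: real and \<nu> \<rho> :: "real measure"
  assumes K: "closed K" "K \<subseteq> {0..1}" and m: "m \<ge> 1" and \<alpha>: "0 \<le> \<alpha>"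
    and \<nu>: "prob_space \<nu>" "sets \<nu> = sets (restrict_space borel {0..1})"
    and \<nu>0: "(fourier_transform \<nu> \<longlongrightarrow> 0) at_infinity"
    and large: "\<And>\<theta>. 1 < \<theta> \<Longrightarrow> \<exists>r0>0. \<forall>r x y. 0 < r \<longrightarrow> r < r0 \<longrightarrow> x \<in> K \<longrightarrow> y \<in> K \<longrightarrow> r < y - x \<longrightarrow>
      (\<exists>U \<in> gaps K. U \<subseteq> {x<..<y} \<and> r powr \<theta> \<le> measure lborel U)"
    and \<rho>: "real_distribution \<rho>" "AE x in \<rho>. x \<in> K"
    and C: "\<And>a b. a \<le> b \<Longrightarrow> measure \<rho> {a..b} \<le> C * (b - a) powr s"
    and s: "0 < s" and \<sigma>: "0 < \<sigma>" "\<sigma> < s / (real m + \<alpha>)" "\<sigma> \<le> 1"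
  shows "AE \<omega> in omega_measure K m \<alpha> \<nu>. bounded (range (\<lambda>\<xi>.
    cmod (fourier_transform (distr \<rho> borel (\<lambda>x. x + jump_sum (gaps K) \<omega> x)) \<xi>) * \<bar>\<xi>\<bar> powr (\<sigma> / 2)))"
proof -
  note ctx = K m \<alpha> \<nu>
  let ?\<Omega> = "omega_measure K m \<alpha> \<nu>"
  interpret \<rho>: real_distribution \<rho> by (rule \<rho>)
  interpret \<Omega>: prob_space ?\<Omega> by (rule prob_space_omega[OF ctx])
  define X where
    "X = (\<lambda>(\<xi> :: real) \<omega>. \<integral>x. exp (- 2 * pi * \<i> * \<xi> * complex_of_real (x
    + jump_sum (gaps K) \<omega> x)) \<partial>\<rho>)"
  define M where "M = real m + \<alpha>"
  have M: "1 \<le> M" using m \<alpha> by (simp add: M_def)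
  have C0: "0 \<le> C" using order_trans[OF measure_nonneg C[of 0 1]] by simp
  define \<sigma>' where "\<sigma>' = (\<sigma> + s / M) / 2"
  have "\<sigma> < s / M" using \<sigma> by (simp add: M_def)
  then have "\<sigma> < (\<sigma> + s / M) / 2" "(\<sigma> + s / M) / 2 < s / M" by (simp_all add: add_divide_distrib)
  then have \<sigma>': "\<sigma> < \<sigma>'" "\<sigma>' < s / M" "0 < \<sigma>'" using \<sigma>(1) unfolding \<sigma>'_def by simp_all
  \<comment> \<open>With pieces of diameter \<open>r = \<xi> powr (- \<beta>)\<close>, the mass
    bound \<open>r powr s\<close> becomes \<open>\<xi> powr (- \<sigma>')\<close>.\<close>
  define \<beta> where "\<beta> = \<sigma>' / s"
  have \<beta>: "0 < \<beta>" "\<beta> * M < 1" using \<sigma>' s M by (auto simp: \<beta>_def field_simps)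
  \<comment> \<open>The room left by \<open>\<beta> * M < 1\<close> is split into two factors
    \<open>\<theta>\<close>. One is used for the gap length \<open>r powr \<theta>\<close>; the
    other leaves space for \<open>\<kappa>\<close>, as \<open>M + \<kappa> < M * \<theta>\<close>.
    This is what makes the exponent \<open>E\<close> positive.\<close>
  define \<theta> where "\<theta> = sqrt (1 / (\<beta> * M))"
  have \<theta>: "1 < \<theta>" and \<theta>2: "\<theta> * \<theta> * M * \<beta> = 1" using \<beta> M by (auto simp: \<theta>_def)
  define \<kappa> where "\<kappa> = M * (\<theta> - 1) / 2"
  have \<kappa>: "0 < \<kappa>" using \<theta> M by (simp add: \<kappa>_def)
  define E where "E = 1 - \<beta> * \<theta> * (M + \<kappa>)"
  have "\<beta> * \<theta> * (M + \<kappa>) < \<beta> * \<theta> * (M * \<theta>)"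
    using \<theta> M \<beta> by (intro mult_strict_left_mono) (auto simp: \<kappa>_def field_simps)
  then have E: "0 < E" using \<theta>2 by (simp add: E_def mult_ac)
  define A where "A = min 1 \<kappa>"
  have A: "0 < A" using \<kappa> by (simp add: A_def)
  define \<tau> where "\<tau> = (\<sigma>' - \<sigma>) / 2"
  have \<tau>: "0 < \<tau>" using \<sigma>' by (simp add: \<tau>_def)
  define C' where "C' = C * 2 powr s"
  have C'0: "0 \<le> C'" using C0 by (simp add: C'_def)
  obtain r0 where r0: "0 < r0" "\<And>r x y. 0 < r \<Longrightarrow> r < r0 \<Longrightarrow> x \<in> K \<Longrightarrow> y \<in> K \<Longrightarrow> r < y - x \<Longrightarrow>
      \<exists>U \<in> gaps K. U \<subseteq> {x<..<y} \<and> r powr \<theta> \<le> measure lborel U"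
    using large[OF \<theta>] by blast
  have "\<forall>\<^sub>F x in at_infinity. cmod (fourier_transform \<nu> x) < 1 / 2"
    using order_tendstoD(2)[OF tendsto_norm[OF \<nu>0], of "1 / 2"] by simp
  then obtain Q0 where Q0: "\<And>x. Q0 \<le> norm x \<Longrightarrow> cmod (fourier_transform \<nu> x) < 1 / 2"
    unfolding eventually_at_infinity by blast
  define Q where "Q = max 1 Q0"
  have Q: "0 < Q" by (simp add: Q_def)
  have small: "\<forall>\<^sub>F \<xi> in at_top. \<xi> powr (- c) < d" if "0 < c" "0 < d" for c d :: real
    using that by (intro order_tendstoD(2)[OF tendsto_neg_powr[OF _ filterlim_ident]]) auto
  have meas_X: "X \<xi> \<in> borel_measurable ?\<Omega>" for \<xi>
    unfolding X_def by (rule fourier_coefficient_measurable[OF ctx \<rho>(1)])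
  have est: "\<forall>\<^sub>F \<xi> in at_top. measure ?\<Omega> {\<omega> \<in> space ?\<Omega>. \<xi> powr (- \<sigma> / 2) \<le> cmod (X \<xi> \<omega>)}
    \<le> 4 * exp (10 * C') * exp (- (\<xi> powr \<tau>) / 2)"
    using eventually_ge_at_top[of 1] small[OF \<beta>(1) r0(1)] small[OF E divide_pos_pos[OF A Q]]
  proof eventually_elim
    case (elim \<xi>)
    define r where "r = \<xi> powr (- \<beta>)"
    define \<eta> where "\<eta> = r powr \<theta>"
    \<comment> \<open>The Chernoff parameter: it keeps \<open>R^2 * B\<close> equal to the constant
      \<open>C'\<close>, while \<open>R * \<xi> powr (- \<sigma> / 2)\<close> is the growing power
      \<open>\<xi> powr \<tau>\<close>.\<close>
    define R where "R = \<xi> powr (\<sigma>' / 2)"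
    define B where "B = C * (2 * r) powr s"
    have r: "0 < r" "r < r0" using elim by (auto simp: r_def)
    have \<eta>: "0 < \<eta>" using r by (simp add: \<eta>_def)
    have B_eq: "B = C' * \<xi> powr (- \<sigma>')"
      using elim s by (simp add: B_def C'_def r_def powr_mult powr_powr \<beta>_def)
    \<comment> \<open>A gap of length at least \<open>\<eta>\<close> satisfies
      \<open>\<xi> * gap_bound m \<alpha> U \<ge> A * \<xi> powr E\<close>, and this is at least
      \<open>Q\<close> at the frequencies considered.\<close>
    have half: "cmod (fourier_transform \<nu> (\<xi> * gap_bound m \<alpha> U)) \<le> 1 / 2"
      if U: "U \<in> gaps K" "\<eta> \<le> measure lborel U" for U
    proof -
      let ?u = "measure lborel U"
      have u: "0 < ?u" "?u \<le> 1" using U \<eta> gap_measure_le_1[OF ctx U(1)] by auto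
      have "Q \<le> A * \<xi> powr E"
      proof -
        have "\<xi> powr (- E) * \<xi> powr E = 1" using elim by (simp add: powr_add[symmetric])
        moreover have "\<xi> powr (- E) * \<xi> powr E \<le> A / Q * \<xi> powr E"
          using elim by (intro mult_right_mono) auto
        ultimately show ?thesis using Q by (simp add: field_simps)
      qed
      also have "A * \<xi> powr E = \<xi> * (A * \<eta> powr (M + \<kappa>))"
      proof -
        have "\<eta> powr (M + \<kappa>) = \<xi> powr (- \<beta> * \<theta> * (M + \<kappa>))"
          by (simp only: \<eta>_def r_def powr_powr)
        moreover have "\<xi> powr E = \<xi> powr 1 * \<xi> powr (- \<beta> * \<theta> * (M + \<kappa>))"
          by (simp only: powr_add[symmetric] E_def) simp
        ultimately show ?thesis using elim by simp
      qed
      also have "\<dots> \<le> \<xi> * (A * ?u powr (M + \<kappa>))"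
        using elim A U \<eta> M \<kappa> by (intro mult_left_mono powr_mono2) auto
      also have "A * ?u powr (M + \<kappa>) = ?u ^ m * (A * ?u powr (\<alpha> + \<kappa>))"
        using u by (simp add: M_def powr_add powr_realpow)
      also have "\<xi> * (?u ^ m * (A * ?u powr (\<alpha> + \<kappa>))) \<le> \<xi> * gap_bound m \<alpha> U"
        unfolding gap_bound_def A_def using elim u \<kappa> by (intro mult_left_mono gap_modulus_ge) auto
      finally have "Q0 \<le> norm (\<xi> * gap_bound m \<alpha> U)" by (simp add: Q_def)
      then show ?thesis using Q0 by (intro less_imp_le)
    qed
    have "measure ?\<Omega> {\<omega> \<in> space ?\<Omega>. \<xi> powr (- \<sigma> / 2) \<le> cmod (X \<xi> \<omega>)}
      \<le> 4 * exp (2 * R * B + 8 * R\<^sup>2 * B - R * \<xi> powr (- \<sigma> / 2) / 2)"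
      unfolding X_def
    proof (rule prob_fourier_coefficient[OF ctx \<rho> C \<eta> r(1)])
      show "\<exists>U\<in>gaps K. U \<subseteq> {x<..<y} \<and> \<eta> \<le> measure lborel U" if "x \<in> K" "y \<in> K" "r < y - x" for x y
        using r0(2)[OF r that] by (simp add: \<eta>_def)
    qed (use half in \<open>auto simp: R_def B_def\<close>)
    also have "2 * R * B + 8 * R\<^sup>2 * B - R * \<xi> powr (- \<sigma> / 2) / 2 \<le> 10 * C' + - (\<xi> powr \<tau>) / 2"
    proof -
      have "R * B = C' * \<xi> powr (- \<sigma>' / 2)"
        using elim by (simp add: R_def B_eq powr_add[symmetric] mult_ac)
      also have "\<dots> \<le> C' * 1"
        using elim C'0 \<sigma>' powr_mono[of "- \<sigma>' / 2" 0 \<xi>] by (intro mult_left_mono) auto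
      finally have "R * B \<le> C'" by simp
      moreover have "R\<^sup>2 * B = C'"
        using elim by (simp add: R_def B_eq power2_eq_square powr_add[symmetric] mult_ac)
      moreover have "R * \<xi> powr (- \<sigma> / 2) = \<xi> powr \<tau>"
        by (simp add: R_def \<tau>_def powr_add[symmetric] diff_divide_distrib)
      ultimately show ?thesis by simp
    qed
    finally show ?case by (simp add: exp_add[symmetric] mult.assoc)
  qed
  define S where
    "S = (\<lambda>n. {\<omega> \<in> space ?\<Omega>. sqrt (real n) powr (- \<sigma> / 2) \<le> cmod (X (sqrt (real n)) \<omega>)})"
  have "AE \<omega> in ?\<Omega>. \<forall>\<^sub>F n in sequentially. \<omega> \<in> space ?\<Omega> - S n"
  proof (rule borel_cantelli_AE1)
    show "S n \<in> sets ?\<Omega>" for n unfolding S_def using meas_X by measurable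
    show "emeasure ?\<Omega> (S n) < \<infinity>" for n by (simp add: \<Omega>.emeasure_eq_measure)
    have "summable (\<lambda>n. 4 * exp (10 * C') * exp (- (sqrt (real n) powr \<tau>) / 2))"
      by (intro summable_mult summable_exp_neg_powr \<tau>)
    then show "summable (\<lambda>n. measure ?\<Omega> (S n))"
    proof (rule summable_comparison_test_ev[rotated])
      have "filterlim (\<lambda>n. sqrt (real n)) at_top sequentially"
        by (intro filterlim_compose[OF sqrt_at_top filterlim_real_sequentially])
      from eventually_compose_filterlim[OF est this]
      show "\<forall>\<^sub>F n in sequentially. norm (measure ?\<Omega> (S n)) \<le> 4 * exp (10 * C')
        * exp (- (sqrt (real n) powr \<tau>) / 2)"
        by (simp add: S_def)
    qed
  qed
  then show ?thesis
    using AE_space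
  proof eventually_elim
    case (elim \<omega>)
    define f where "f = (\<lambda>x. x + jump_sum (gaps K) \<omega> x)"
    have f_meas [measurable]: "f \<in> borel_measurable borel"
      unfolding f_def using jump_sum_measurable_snd[OF ctx elim(2) order_refl] by measurable
    have fX: "fourier_transform (distr \<rho> borel f) \<xi> = X \<xi> \<omega>" for \<xi>
    proof -
      have "fourier_transform (distr \<rho> borel f) \<xi> = (\<integral>x. exp (- 2 * pi * \<i> * \<xi>
        * complex_of_real (f x)) \<partial>\<rho>)"
        unfolding fourier_transform_def by (rule integral_distr) auto
      then show ?thesis by (simp add: X_def f_def)
    qed
    note w = elim(2)
    interpret d: real_distribution "distr \<rho> borel f"
      by (rule \<rho>.real_distribution_distr) simp
    \<comment> \<open>Almost everywhere with respect to \<open>\<rho>\<close> the point lies in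
      \<open>K\<close>, and there \<open>0 \<le> f x \<le> 1 + 1 / ln 2\<close>.\<close>
    define L where "L = 2 * pi * (1 + 1 / ln 2)"
    have lip: "cmod (X \<xi> \<omega> - X \<zeta> \<omega>) \<le> L * \<bar>\<xi> - \<zeta>\<bar>" for \<xi> \<zeta>
    proof -
      let ?e = "\<lambda>\<xi> x. exp (- 2 * pi * \<i> * \<xi> * complex_of_real (f x))"
      have int: "integrable \<rho> (?e \<xi>)" for \<xi> :: real
        by (rule \<rho>.integrable_const_bound[where B = 1]) auto
      have "cmod (X \<xi> \<omega> - X \<zeta> \<omega>) = cmod (\<integral>x. ?e \<xi> x - ?e \<zeta> x \<partial>\<rho>)"
      proof -
        have "X \<xi> \<omega> = (\<integral>x. ?e \<xi> x \<partial>\<rho>)" for \<xi> by (simp add: X_def f_def)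
        then show ?thesis using int by simp
      qed
      also have "\<dots> \<le> (\<integral>x. cmod (?e \<xi> x - ?e \<zeta> x) \<partial>\<rho>)" by (rule integral_norm_bound)
      also have "\<dots> \<le> (\<integral>x. L * \<bar>\<xi> - \<zeta>\<bar> \<partial>\<rho>)"
      proof (rule integral_mono_AE)
        show "AE x in \<rho>. cmod (?e \<xi> x - ?e \<zeta> x) \<le> L * \<bar>\<xi> - \<zeta>\<bar>"
          using \<rho>(2)
        proof eventually_elim
          case (elim x)
          have "0 \<le> x" "x \<le> 1" using elim K(2) by auto
          then have "\<bar>f x\<bar> \<le> 1 + 1 / ln 2"
            using jump_sum_nonneg[OF ctx w order_refl, of x] jump_sum_le[OF ctx w order_refl, of x]
            unfolding f_def by linarith
          have "cmod (?e \<xi> x - ?e \<zeta> x) \<le> \<bar>- 2 * pi * \<xi> * f x - (- 2 * pi * \<zeta> * f x)\<bar>"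
            using norm_exp_i_diff_le[of "- 2 * pi * \<xi> * f x" "- 2 * pi * \<zeta> * f x"]
              by (simp add: mult_ac)
          also have "- 2 * pi * \<xi> * f x - (- 2 * pi * \<zeta> * f x) = - (2 * pi * f x * (\<xi> - \<zeta>))"
            by (simp add: algebra_simps)
          also have "\<bar>\<dots>\<bar> = 2 * pi * \<bar>f x\<bar> * \<bar>\<xi> - \<zeta>\<bar>"
            by (simp add: abs_mult)
          also have "\<dots> \<le> L * \<bar>\<xi> - \<zeta>\<bar>"
            unfolding L_def using \<open>\<bar>f x\<bar> \<le> 1 + 1 / ln 2\<close>
              by (intro mult_right_mono mult_left_mono) auto
          finally show ?case .
        qed
      qed (use int in auto)
      also have "\<dots> = L * \<bar>\<xi> - \<zeta>\<bar>" using \<rho>.prob_space by simp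
      finally show ?thesis .
    qed
    have "bounded (range (\<lambda>\<xi>. cmod (X \<xi> \<omega>) * \<bar>\<xi>\<bar> powr (\<sigma> / 2)))"
    proof (rule bounded_range_powr_of_sqrt_grid[OF _ _ lip])
      show "cmod (X \<xi> \<omega>) \<le> 1" for \<xi>
        using norm_fourier_transform_le_1[OF d.real_distribution_axioms, of \<xi>] by (simp add: fX)
      show "cmod (X (- \<xi>) \<omega>) = cmod (X \<xi> \<omega>)" for \<xi>
      proof -
        have "X (- \<xi>) \<omega> = cnj (X \<xi> \<omega>)"
          unfolding X_def Bochner_Integration.integral_cnj[symmetric] by (simp add: exp_cnj)
        then show ?thesis by simp
      qed
      show "\<forall>\<^sub>F n in sequentially. cmod (X (sqrt (real n)) \<omega>) < sqrt (real n) powr (- \<sigma> / 2)"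
        using elim(1) by eventually_elim (auto simp: S_def)
    qed (use \<sigma> in \<open>auto simp: L_def\<close>)
    then show ?case unfolding f_def[symmetric] fX .
  qed
qed

theorem theorem5:
  fixes c :: "nat \<Rightarrow> real" and m :: nat and \<alpha> s :: real and \<nu> :: "real measure"
    and F :: "real set"
  assumes "m \<ge> 1" and "0 \<le> \<alpha>" and "\<alpha> \<le> 1"
    and "\<And>k. k \<ge> 1 \<Longrightarrow> 0 < c k \<and> c k < 1/2"
    and "\<And>k l. 1 \<le> k \<Longrightarrow> k \<le> l \<Longrightarrow> c k \<le> c l"
    and "c \<longlonglongrightarrow> 1/2"
    and "\<exists>p>0. (\<lambda>k. 2 * c (Suc k)) has_prod p"
    and "(\<lambda>k. ln (1 - 2 * c k) / real k) \<longlonglongrightarrow> 0"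
    and "prob_space \<nu>" and "sets \<nu> = sets (restrict_space borel {0..1})"
    and "(fourier_transform \<nu> \<longlongrightarrow> 0) at_infinity"
    and "s \<ge> 0" and "F \<in> sets borel" and "hausdorff_measure s F > 0"
  shows "\<exists>t. AE \<omega> in omega_measure (cantor_set c) m \<alpha> \<nu>.
           fourier_dim (random_map (cantor_set c) \<omega> ` (cantor_set c \<inter> (\<lambda>x. x + t) ` F))
             \<ge> s / (real m + \<alpha>)"
proof (cases "s = 0")
  case True
  then show ?thesis by (simp add: fourier_dim_nonneg)
next
  case False
  then have s: "0 < s" using assms(12) by simp
  define K where "K = cantor_set c"
  note cc = assms(4,5)
  have K: "closed K" "K \<subseteq> {0..1}"
    unfolding K_def
      using closed_cantor_set[where c = c, OF cc] cantor_set_subset[where c = c, OF cc] by auto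
  note ctx = K assms(1,2,9,10)
  have Kb: "K \<in> sets borel" using K(1) by simp
  have "0 < measure lborel K"
    using assms(7) measure_cantor_set_pos[where c = c, OF cc] unfolding K_def by blast
  then have Kpos: "0 < emeasure lborel K" by (simp add: measure_def enn2real_positive_iff)
  obtain \<mu> C where \<mu>: "finite_measure \<mu>" "sets \<mu> = sets borel" "0 < measure \<mu> F" "0 < C"
    "\<And>a b. a \<le> b \<Longrightarrow> measure \<mu> {a..b} \<le> C * (b - a) powr s" and s1: "s \<le> 1"
    using frostman[OF s assms(13,14)] by metis
  interpret \<mu>: finite_measure \<mu> by (rule \<mu>)
  note [measurable_cong] = \<mu>(2)
  note [measurable] = assms(13) Kb
  obtain t where t: "0 < measure \<mu> {x \<in> F. x + t \<in> K}"
    using exists_translate_pos[OF \<mu>(1,2) assms(13) \<mu>(3) Kb Kpos] by blast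
  define E where "E = {x \<in> F. x + t \<in> K}"
  have "{x \<in> space borel. x \<in> F \<and> x + t \<in> K} \<in> sets borel" by measurable
  then have Eb [measurable]: "E \<in> sets borel" by (simp add: E_def)
  have Epos: "0 < measure \<mu> E" using t by (simp add: E_def)
  \<comment> \<open>The Frostman measure is translated by \<open>t\<close>, so that its normalised
    restriction lives on \<open>K\<close> and on the translate of \<open>F\<close>.\<close>
  define \<rho> where "\<rho> = distr (uniform_measure \<mu> E) borel (\<lambda>x. x + t)"
  have "prob_space (uniform_measure \<mu> E)"
    using Epos by (intro prob_space_uniform_measure) (auto simp: \<mu>.emeasure_eq_measure)
  then have \<rho>p: "prob_space \<rho>"
    unfolding \<rho>_def by (rule prob_space.prob_space_distr) measurable
  have \<rho>: "real_distribution \<rho>"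
    using \<rho>p by (intro real_distribution.intro real_distribution_axioms.intro) (simp_all add: \<rho>_def)
  interpret \<rho>: real_distribution \<rho> by (rule \<rho>)
  define H where "H = K \<inter> (\<lambda>x. x + t) ` F"
  have H_iff: "x \<in> H \<longleftrightarrow> x \<in> K \<and> x - t \<in> F" for x
    unfolding H_def by (auto simp: image_iff intro: bexI[of _ "x - t"])
  have "{x \<in> space borel. x \<in> K \<and> x - t \<in> F} \<in> sets borel" by measurable
  moreover have "H = {x \<in> space borel. x \<in> K \<and> x - t \<in> F}" using H_iff by auto
  ultimately have Hb [measurable]: "H \<in> sets borel" by simp
  have \<rho>_eq: "measure \<rho> B = measure \<mu> (E \<inter> {x. x + t \<in> B}) / measure \<mu> E"
    if [measurable]: "B \<in> sets borel" for B
  proof -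
    have m: "(\<lambda>x. x + t) \<in> uniform_measure \<mu> E \<rightarrow>\<^sub>M borel" by measurable
    have "{x \<in> space borel. x + t \<in> B} \<in> sets borel" by measurable
    then have "{x. x + t \<in> B} \<in> sets \<mu>" by (simp add: \<mu>(2))
    then show ?thesis
      unfolding \<rho>_def measure_distr[OF m that]
      using Epos sets_eq_imp_space_eq[OF \<mu>(2)]
      by (subst measure_uniform_measure) (auto simp: \<mu>.emeasure_eq_measure \<mu>(2) vimage_def)
  qed
  have \<rho>H: "measure \<rho> H = 1"
  proof -
    have "E \<inter> {x. x + t \<in> H} = E" by (auto simp: E_def H_iff)
    then show ?thesis using \<rho>_eq[OF Hb] Epos by simp
  qed
  have \<rho>K: "AE x in \<rho>. x \<in> K"
  proof -
    have "AE x in \<rho>. x \<in> H" using \<rho>.AE_in_set_eq_1[of H] \<rho>H Hb by simp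
    then show ?thesis by eventually_elim (simp add: H_iff)
  qed
  have \<rho>C: "measure \<rho> {a..b} \<le> (C / measure \<mu> E) * (b - a) powr s" if "a \<le> b" for a b
  proof -
    have "measure \<mu> (E \<inter> {x. x + t \<in> {a..b}}) \<le> measure \<mu> {a - t..b - t}"
      by (intro \<mu>.finite_measure_mono) (auto simp: \<mu>(2))
    also have "\<dots> \<le> C * (b - a) powr s" using \<mu>(5)[of "a - t" "b - t"] that by simp
    finally show ?thesis using Epos \<rho>_eq[of "{a..b}"] by (simp add: divide_right_mono)
  qed
  have large: "\<exists>r0>0. \<forall>r x y. 0 < r \<longrightarrow> r < r0 \<longrightarrow> x \<in> K \<longrightarrow> y \<in> K \<longrightarrow> r < y - x \<longrightarrow>
      (\<exists>U \<in> gaps K. U \<subseteq> {x<..<y} \<and> r powr \<theta> \<le> measure lborel U)" if "1 < \<theta>" for \<theta>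
    unfolding K_def by (rule cantor_set_large_gaps[where c = c, OF cc assms(8) that])
  define d where "d = s / (real m + \<alpha>)"
  \<comment> \<open>The bound \<open>s \<le> 1\<close> supplied by Frostman's lemma enters
    here.\<close>
  have d: "0 < d" "d \<le> 1" using s s1 assms(1,2) by (auto simp: d_def)
  \<comment> \<open>A sequence increasing to \<open>d\<close>. The exceptional null set depends on
    the exponent, so only countably many exponents are used.\<close>
  define \<sigma> where "\<sigma> = (\<lambda>n. d * (1 - inverse (real (Suc (Suc n)))))"
  have \<sigma>: "0 < \<sigma> n" "\<sigma> n < d" for n using d by (auto simp: \<sigma>_def field_simps add_pos_nonneg)
  have "AE \<omega> in omega_measure K m \<alpha> \<nu>. \<forall>n. bounded (range (\<lambda>\<xi>.
    cmod (fourier_transform (distr \<rho> borel (\<lambda>x. x + jump_sum (gaps K) \<omega> x)) \<xi>) * \<bar>\<xi>\<bar> powr (\<sigma> n / 2)))"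
    (is "AE \<omega> in _. \<forall>n. ?bounded \<omega> n")
    unfolding AE_all_countable
  proof
    fix n
    have "\<sigma> n < s / (real m + \<alpha>)" "\<sigma> n \<le> 1" using \<sigma>[of n] d by (auto simp: d_def)
    then show "AE \<omega> in omega_measure K m \<alpha> \<nu>. ?bounded \<omega> n"
      using AE_fourier_decay[OF ctx assms(11) large \<rho> \<rho>K \<rho>C s \<sigma>(1)[of n]] by blast
  qed
  then have "AE \<omega> in omega_measure K m \<alpha> \<nu>. d \<le> fourier_dim (random_map K \<omega> ` H)"
    using AE_space
  proof eventually_elim
    case (elim \<omega>)
    define f where "f = (\<lambda>x. x + jump_sum (gaps K) \<omega> x)"
    note w = elim(2)
    have f_meas [measurable]: "f \<in> borel_measurable borel"
      unfolding f_def using jump_sum_measurable_snd[OF ctx w order_refl] by measurable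
    have dist: "real_distribution (distr \<rho> borel f)"
      by (rule \<rho>.real_distribution_distr) simp
    \<comment> \<open>\<open>random_map\<close> and \<open>f\<close> are known to agree on
      \<open>K\<close>, which contains \<open>H\<close>.\<close>
    have img: "random_map K \<omega> ` H = f ` H"
      using random_map_eq_jump_sum[OF ctx] by (auto simp: f_def H_def intro!: image_cong)
    \<comment> \<open>The image has to be Borel, since \<open>measure\<close> gives the value 0 to
      any set outside the sigma-algebra.\<close>
    have fH: "f ` H \<in> sets borel"
    proof (rule borel_image_expanding[OF _ _ _ Hb])
      show "y - x \<le> f y - f x" if "x \<le> y" for x y
        using jump_sum_mono[OF ctx w order_refl that] by (simp add: f_def)
      show "x \<le> f x" for x using jump_sum_nonneg[OF ctx w order_refl, of x] by (simp add: f_def)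
      show "f x \<le> x + 1 / ln 2" for x using jump_sum_le[OF ctx w order_refl, of x]
        by (simp add: f_def)
    qed
    have "1 \<le> measure (distr \<rho> borel f) (f ` H)"
    proof -
      have "measure \<rho> H \<le> measure \<rho> (f -` (f ` H) \<inter> space \<rho>)"
        by (intro \<rho>.finite_measure_mono measurable_sets[OF _ fH]) auto
      then show ?thesis using \<rho>H fH by (simp add: measure_distr)
    qed
    then have "measure (distr \<rho> borel f) (f ` H) = 1"
      using prob_space.prob_le_1[OF real_distribution.axioms(1)[OF dist]] by (intro antisym)
    then have "fourier_dim_measure (distr \<rho> borel f) \<le> fourier_dim (f ` H)"
      by (rule fourier_dim_ge[OF dist])
    moreover have "\<sigma> n \<le> fourier_dim_measure (distr \<rho> borel f)" for n
      using elim(1) \<sigma>[of n] d unfolding f_def by (intro fourier_dim_measure_ge) auto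
    ultimately have "\<sigma> n \<le> fourier_dim (f ` H)" for n by (meson order_trans)
    moreover have "\<sigma> \<longlonglongrightarrow> d * (1 - 0)"
      unfolding \<sigma>_def by (intro tendsto_intros LIMSEQ_Suc[OF LIMSEQ_inverse_real_of_nat])
    ultimately show ?case unfolding img by (intro LIMSEQ_le_const2[of \<sigma>]) auto
  qed
  then show ?thesis unfolding K_def H_def d_def by blast
qed

end
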